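(* Let $1<p<\infty$, let $a\in GL^\infty(\mathbb T)$, and let $A$ denote any one of the operators $$T(a)+H(at),\quad T(a)-H(at^{-1}),\quad T(a)+H(a),\quad T(a)-H(a)$$ acting on $H^p$ (here $t$ denotes the function $t\mapsto t$ on $\mathbb T$). Then $$\min\{\dim\ker A,\ \dim\operatorname{coker}A\}=0.$$
   Context: $\mathbb T$ is the unit circle, $L^p=L^p(\mathbb T)$, and $\hat f_n$ denotes the $n$-th Fourier coefficient. $H^p=\{f\in L^p:\hat f_n=0 \text{ for all } n<0\}$, $\overline{H^p}=\{f\in L^p:\hat f_n=0\text{ for all } n>0\}$. $P$ is the Riesz projection $\sum_n\hat f_n t^n\mapsto\sum_{n\ge0}\hat f_nt^n$ (bounded from $L^p$ onto $H^p$ for $1<p<\infty$), $Q=I-P$, $(Jf)(t)=t^{-1}f(t^{-1})$, and $\tilde a(t)=a(1/t)$. For $a\in L^\infty$ the Toeplitz operator on $H^p$ is $T(a)f=P(af)$ and the Hankel operator is $H(a)f=P(a\,QJf)$. $GL^\infty$ denotes the invertible elements of $L^\infty(\mathbb T)$. $\operatorname{coker}A$ is $H^p/\overline{\operatorname{im}A}$ (equivalently its dimension is that of the kernel of the adjoint). *)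

theory Defs
  imports "HOL-Analysis.Analysis"
begin

text \<open>Functions on the unit circle are represented as functions complex \<Rightarrow> complex,
  of which only the values at points cis theta matter.  The normalized
  Lebesgue measure on the circle is realised through the parametrisation
  theta \<mapsto> cis theta, theta in [0, 2 pi).\<close>

definition circle_measure :: "real measure" where
  "circle_measure = restrict_space lborel {0..<2*pi}"

definition circ :: "(complex \<Rightarrow> complex) \<Rightarrow> real \<Rightarrow> complex" where
  "circ f = (\<lambda>\<theta>. f (cis \<theta>))"

definition ae_eq :: "(complex \<Rightarrow> complex) \<Rightarrow> (complex \<Rightarrow> complex) \<Rightarrow> bool" where
  "ae_eq f g \<longleftrightarrow> (AE \<theta> in circle_measure. f (cis \<theta>) = g (cis \<theta>))"

definition inLp :: "real \<Rightarrow> (complex \<Rightarrow> complex) \<Rightarrow> bool" where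
  "inLp p f \<longleftrightarrow> circ f \<in> borel_measurable circle_measure \<and>
     integrable circle_measure (\<lambda>\<theta>. norm (f (cis \<theta>)) powr p)"

definition Lp_norm :: "real \<Rightarrow> (complex \<Rightarrow> complex) \<Rightarrow> real" where
  "Lp_norm p f = ((\<integral>\<theta>. norm (f (cis \<theta>)) powr p \<partial>circle_measure) / (2*pi)) powr (1/p)"

definition inLinf :: "(complex \<Rightarrow> complex) \<Rightarrow> bool" where
  "inLinf a \<longleftrightarrow> circ a \<in> borel_measurable circle_measure \<and>
     (\<exists>C. AE \<theta> in circle_measure. norm (a (cis \<theta>)) \<le> C)"

definition GLinf :: "(complex \<Rightarrow> complex) \<Rightarrow> bool" where
  "GLinf a \<longleftrightarrow> inLinf a \<and> (\<exists>b. inLinf b \<and> ae_eq (\<lambda>t. a t * b t) (\<lambda>_. 1))"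

definition fourier :: "(complex \<Rightarrow> complex) \<Rightarrow> int \<Rightarrow> complex" where
  "fourier f n = (\<integral>\<theta>. f (cis \<theta>) * cis (- (of_int n * \<theta>)) \<partial>circle_measure) / of_real (2*pi)"

definition Hp :: "real \<Rightarrow> (complex \<Rightarrow> complex) \<Rightarrow> bool" where
  "Hp p f \<longleftrightarrow> inLp p f \<and> (\<forall>n<0. fourier f n = 0)"

text \<open>Riesz projection P (defined via Fourier coefficients; determined a.e.),
  Q = I - P, the flip J, Toeplitz and Hankel operators.\<close>
definition riesz :: "real \<Rightarrow> (complex \<Rightarrow> complex) \<Rightarrow> (complex \<Rightarrow> complex)" where
  "riesz p f = (SOME g. inLp p g \<and>
      (\<forall>n. fourier g n = (if n \<ge> 0 then fourier f n else 0)))"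

definition rieszQ :: "real \<Rightarrow> (complex \<Rightarrow> complex) \<Rightarrow> (complex \<Rightarrow> complex)" where
  "rieszQ p f = (\<lambda>t. f t - riesz p f t)"

definition flipJ :: "(complex \<Rightarrow> complex) \<Rightarrow> (complex \<Rightarrow> complex)" where
  "flipJ f = (\<lambda>t. inverse t * f (inverse t))"

definition toeplitz :: "real \<Rightarrow> (complex \<Rightarrow> complex) \<Rightarrow> (complex \<Rightarrow> complex) \<Rightarrow> (complex \<Rightarrow> complex)" where
  "toeplitz p a f = riesz p (\<lambda>t. a t * f t)"

definition hankel :: "real \<Rightarrow> (complex \<Rightarrow> complex) \<Rightarrow> (complex \<Rightarrow> complex) \<Rightarrow> (complex \<Rightarrow> complex)" where
  "hankel p a f = riesz p (\<lambda>t. a t * rieszQ p (flipJ f) t)"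

text \<open>dim ker A = 0 on H^p, and dim coker A = 0, i.e. the range of A is dense in H^p.\<close>
definition ker_trivial :: "real \<Rightarrow> ((complex \<Rightarrow> complex) \<Rightarrow> (complex \<Rightarrow> complex)) \<Rightarrow> bool" where
  "ker_trivial p A \<longleftrightarrow> (\<forall>f. Hp p f \<and> ae_eq (A f) (\<lambda>_. 0) \<longrightarrow> ae_eq f (\<lambda>_. 0))"

definition coker_trivial :: "real \<Rightarrow> ((complex \<Rightarrow> complex) \<Rightarrow> (complex \<Rightarrow> complex)) \<Rightarrow> bool" where
  "coker_trivial p A \<longleftrightarrow> (\<forall>g. Hp p g \<longrightarrow>
     (\<forall>\<epsilon>>0. \<exists>f. Hp p f \<and> Lp_norm p (\<lambda>t. A f t - g t) < \<epsilon>))"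

end

theory Submission
  imports Defs "HOL-Complex_Analysis.Complex_Analysis"
begin

text \<open>
  For \<open>f\<close> in \<open>H\<^sup>p\<close> each of the four operators has the form \<open>A f = P(a \<phi>)\<close> with \<open>\<phi> = f + \<chi> J f\<close> and
  \<open>\<chi> \<in> {t, - 1/t, 1, - 1}\<close>, so that \<open>\<chi> J \<phi> = \<phi>\<close>. Suppose that \<open>A f = 0\<close> with \<open>f \<noteq> 0\<close>, and that
  \<open>k\<close> annihilates the range of \<open>A\<close>; without loss of generality \<open>k\<close> has spectrum in \<open>n \<le> 0\<close>. Transposing,
  \<open>a k + t \<chi>(1/t) (a k)(1/t)\<close> has spectrum in \<open>n \<ge> 1\<close>, and its symmetry forces it to vanish. Hence the
  integrable function \<open>\<phi> \<cdot> a k = a \<phi> \<cdot> k\<close> is odd under \<open>t \<mapsto> 1/t\<close>, while both \<open>a \<phi>\<close> (spectrum in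
  \<open>n \<le> - 1\<close>) and \<open>k\<close> are anti-analytic; so it is zero. As \<open>a \<phi> \<noteq> 0\<close> is nonzero almost everywhere, \<open>k = 0\<close>.

  Hahn-Banach, the duality of \<open>L\<^sup>p\<close> and \<open>L\<^sup>q\<close>, the density of trigonometric polynomials and the
  nonvanishing of \<open>H\<^sup>p\<close> functions are all obtained from one principle: an \<open>L\<^sup>p\<close> function \<open>g\<close> at positive
  distance from a subspace has a best approximation from its closure, and the error \<open>u\<close> yields the functional
  \<open>|u|\<^sup>p\<^sup>-\<^sup>2 cnj u\<close> which annihilates the subspace.
\<close>

section \<open>Lebesgue spaces\<close>

text \<open>The four operators are singled out by the indices that a reflection leaves fixed. On
  coefficients, \<phi> = f + \<chi> J f couples n with m - 1 - n, where \<chi> = \<sigma> t^m, and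
  the transposed sum couples j with 1 - m - j. For f in H^p the map from f to \<phi> is injective
  because the reflection of an index n >= 0 is negative, except for n = 0 when m = 1; there \<sigma>
  = 1 doubles the coefficient. The transposed sum has no coefficients at j <= 0, and the reflection
  carries every j >= 1 to such an index, except j = 1 when m = -1; there \<sigma> = -1 makes the
  coefficient its own negative. For m = 0 no index is fixed and both signs work. The product of
  \<phi> and a k is merely integrable, so uniqueness of Fourier coefficients is proved for L^1. The
  theorem of M. Riesz is needed because \<open>riesz\<close> is a choice operator, which says
  nothing unless a projection in L^p exists; it also provides the approximation by analytic
  polynomials from which the spectrum of a product is computed.\<close>

definition Lp_space :: "'a measure \<Rightarrow> real \<Rightarrow> ('a \<Rightarrow> complex) set" where
  "Lp_space M p = {f \<in> borel_measurable M. integrable M (\<lambda>x. norm (f x) powr p)}"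

definition Lp_mass :: "'a measure \<Rightarrow> real \<Rightarrow> ('a \<Rightarrow> complex) \<Rightarrow> real" where
  "Lp_mass M p f = (\<integral>x. norm (f x) powr p \<partial>M)"

text \<open>Not normalised: on the circle it differs from the norm of the statement by the factor
  \<open>(2*pi) powr (1/p)\<close>, which \<open>Lp_norm_eq\<close> restores.\<close>

definition Lp_nrm :: "'a measure \<Rightarrow> real \<Rightarrow> ('a \<Rightarrow> complex) \<Rightarrow> real" where
  "Lp_nrm M p f = Lp_mass M p f powr (1 / p)"

lemma Lp_spaceD:
  assumes "f \<in> Lp_space M p"
  shows "f \<in> borel_measurable M" "integrable M (\<lambda>x. norm (f x) powr p)"
  using assms by (auto simp: Lp_space_def)

lemma Lp_mass_nonneg [simp]: "0 \<le> Lp_mass M p f"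
  by (simp add: Lp_mass_def)

lemma Lp_nrm_nonneg [simp]: "0 \<le> Lp_nrm M p f"
  by (simp add: Lp_nrm_def)

lemma Lp_mass_eq_nrm: "p > 0 \<Longrightarrow> Lp_mass M p f = Lp_nrm M p f powr p"
  by (simp add: Lp_nrm_def powr_powr)

text \<open>Convexity at the points x/(1-l) and y/l with weights 1-l and l. For fixed
  \<open>l\<close> the right side is linear in the p-th powers, so it survives integration; choosing
  \<open>l\<close> afterwards gives Minkowski's inequality.\<close>

lemma powr_convex_two:
  fixes p l x y :: real
  assumes "p \<ge> 1" "0 < l" "l < 1" "x \<ge> 0" "y \<ge> 0"
  shows "(x + y) powr p \<le> (1 - l) powr (1 - p) * x powr p + l powr (1 - p) * y powr p"
proof -
  have one: "a powr p \<le> c powr (1 - p) * a powr p" if "a \<ge> 0" "0 < c" "c < 1" for a c :: real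
  proof -
    have "1 \<le> c powr (1 - p)"
      using that assms(1) powr_mono'[of "1 - p" 0 c] by simp
    then show ?thesis using mult_right_mono[of 1 "c powr (1 - p)" "a powr p"] by simp
  qed
  show ?thesis
  proof (cases "x = 0 \<or> y = 0")
    case True
    then show ?thesis using assms one[of x "1 - l"] one[of y l] by auto
  next
    case False
    then have xy: "x > 0" "y > 0" using assms by auto
    have "((1 - l) * (x / (1 - l)) + l * (y / l)) powr p
          \<le> (1 - l) * (x / (1 - l)) powr p + l * (y / l) powr p"
      using convex_onD[OF powr_convex[OF assms(1)], of l "x / (1 - l)" "y / l"] assms xy by simp
    also have "(1 - l) * (x / (1 - l)) + l * (y / l) = x + y" using assms by simp
    also have "(1 - l) * (x / (1 - l)) powr p = (1 - l) powr (1 - p) * x powr p"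
      using assms xy by (simp add: powr_divide powr_diff)
    also have "l * (y / l) powr p = l powr (1 - p) * y powr p"
      using assms xy by (simp add: powr_divide powr_diff)
    finally show ?thesis .
  qed
qed

lemma norm_add_powr_le:
  fixes a b :: "'a::real_normed_vector"
  assumes "p \<ge> 1" "0 < l" "l < 1"
  shows "norm (a + b) powr p \<le> (1 - l) powr (1 - p) * norm a powr p + l powr (1 - p) * norm b powr p"
proof -
  have "norm (a + b) powr p \<le> (norm a + norm b) powr p"
    using assms by (intro powr_mono2 norm_triangle_ineq) auto
  also have "\<dots> \<le> (1 - l) powr (1 - p) * norm a powr p + l powr (1 - p) * norm b powr p"
    using assms by (intro powr_convex_two) auto
  finally show ?thesis .
qed

lemma Lp_space_bound:
  assumes "f \<in> borel_measurable M" "integrable M g" "\<And>x. norm (f x) powr p \<le> g x"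
  shows "f \<in> Lp_space M p"
proof -
  have "integrable M (\<lambda>x. norm (f x) powr p)"
    using assms(1) by (intro Bochner_Integration.integrable_bound[OF assms(2)])
      (auto intro!: AE_I2 order_trans[OF assms(3)])
  then show ?thesis using assms(1) by (simp add: Lp_space_def)
qed

lemma Lp_space_add:
  assumes "f \<in> Lp_space M p" "g \<in> Lp_space M p" "p \<ge> 1"
  shows "(\<lambda>x. f x + g x) \<in> Lp_space M p"
proof (rule Lp_space_bound)
  show "(\<lambda>x. f x + g x) \<in> borel_measurable M"
    using assms by (auto simp: Lp_space_def)
  show "integrable M (\<lambda>x. (1 - 1/2) powr (1 - p) * norm (f x) powr p + (1/2) powr (1 - p) * norm (g x) powr p)"
    using assms by (auto simp: Lp_space_def)
  show "norm (f x + g x) powr p \<le> (1 - 1/2) powr (1 - p) * norm (f x) powr p + (1/2) powr (1 - p) * norm (g x) powr p" for x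
    by (rule norm_add_powr_le) (use assms in auto)
qed

lemma Lp_space_cmult:
  assumes "f \<in> Lp_space M p"
  shows "(\<lambda>x. c * f x) \<in> Lp_space M p"
  using assms by (auto simp: Lp_space_def norm_mult powr_mult)

lemma Lp_space_zero [simp]: "(\<lambda>x. 0) \<in> Lp_space M p"
  by (simp add: Lp_space_def)

lemma Lp_space_uminus:
  "f \<in> Lp_space M p \<Longrightarrow> (\<lambda>x. - f x) \<in> Lp_space M p"
  using Lp_space_cmult[of f M p "-1"] by simp

lemma Lp_space_diff:
  assumes "f \<in> Lp_space M p" "g \<in> Lp_space M p" "p \<ge> 1"
  shows "(\<lambda>x. f x - g x) \<in> Lp_space M p"
  using Lp_space_add[OF assms(1) Lp_space_uminus[OF assms(2)] assms(3)] by simp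

lemma Lp_space_mult_bounded:
  assumes f: "f \<in> Lp_space M p" and a: "a \<in> borel_measurable M" "AE x in M. norm (a x) \<le> B" and p: "p \<ge> 1"
  shows "(\<lambda>x. a x * f x) \<in> Lp_space M p"
proof -
  note [measurable] = a(1) Lp_spaceD(1)[OF f]
  have "integrable M (\<lambda>x. norm (a x * f x) powr p)"
  proof (rule Bochner_Integration.integrable_bound)
    show "integrable M (\<lambda>x. \<bar>B\<bar> powr p * norm (f x) powr p)"
      using f by (auto simp: Lp_space_def)
    show "AE x in M. norm (norm (a x * f x) powr p) \<le> norm (\<bar>B\<bar> powr p * norm (f x) powr p)"
      using a(2)
    proof eventually_elim
      case (elim x)
      have "norm (a x) powr p \<le> \<bar>B\<bar> powr p" using elim p by (intro powr_mono2) auto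
      then show ?case by (auto simp: norm_mult powr_mult mult_right_mono)
    qed
  qed auto
  then show ?thesis by (simp add: Lp_space_def)
qed

lemma Lp_space_cong_AE:
  assumes f: "f \<in> Lp_space M p" and g: "g \<in> borel_measurable M" and e: "AE x in M. f x = g x"
  shows "g \<in> Lp_space M p"
proof -
  note [measurable] = g Lp_spaceD(1)[OF f]
  have "AE x in M. norm (f x) powr p = norm (g x) powr p" using e by eventually_elim simp
  then have "integrable M (\<lambda>x. norm (g x) powr p)"
    using Lp_spaceD(2)[OF f] by (subst (asm) integrable_cong_AE) auto
  then show ?thesis using g by (simp add: Lp_space_def)
qed

lemma Lp_mass_cong_AE:
  assumes "f \<in> borel_measurable M" "g \<in> borel_measurable M" "AE x in M. f x = g x"
  shows "Lp_mass M p f = Lp_mass M p g"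
proof -
  note [measurable] = assms(1,2)
  have "AE x in M. norm (f x) powr p = norm (g x) powr p" using assms(3) by eventually_elim simp
  then show ?thesis unfolding Lp_mass_def by (intro integral_cong_AE) auto
qed

lemma Lp_mass_eq_0_iff:
  assumes "f \<in> Lp_space M p"
  shows "Lp_mass M p f = 0 \<longleftrightarrow> (AE x in M. f x = 0)"
  unfolding Lp_mass_def
  by (subst integral_nonneg_eq_0_iff_AE) (use assms in \<open>auto simp: Lp_space_def\<close>)

lemma Lp_nrm_eq_0_iff:
  assumes "f \<in> Lp_space M p" 
  shows "Lp_nrm M p f = 0 \<longleftrightarrow> (AE x in M. f x = 0)"
  using Lp_mass_eq_0_iff[OF assms] by (simp add: Lp_nrm_def)

lemma Lp_mass_cmult: "Lp_mass M p (\<lambda>x. c * f x) = norm c powr p * Lp_mass M p f"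
  by (simp add: Lp_mass_def norm_mult powr_mult)

lemma Lp_nrm_cmult: "p > 0 \<Longrightarrow> Lp_nrm M p (\<lambda>x. c * f x) = norm c * Lp_nrm M p f"
  by (simp add: Lp_nrm_def Lp_mass_cmult powr_mult powr_powr)

lemma Lp_nrm_minus_commute: "Lp_nrm M p (\<lambda>x. f x - g x) = Lp_nrm M p (\<lambda>x. g x - f x)"
  by (simp add: Lp_nrm_def Lp_mass_def norm_minus_commute)

lemma Lp_nrm_zero [simp]: "Lp_nrm M p (\<lambda>x. 0) = 0"
  by (simp add: Lp_nrm_def Lp_mass_def)

lemma Lp_mass_add_le:
  assumes f: "f \<in> Lp_space M p" and g: "g \<in> Lp_space M p" and "p \<ge> 1" "0 < l" "l < 1"
  shows "Lp_mass M p (\<lambda>x. f x + g x) \<le> (1 - l) powr (1 - p) * Lp_mass M p f + l powr (1 - p) * Lp_mass M p g"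
proof -
  have "Lp_mass M p (\<lambda>x. f x + g x)
     \<le> (\<integral>x. (1 - l) powr (1 - p) * norm (f x) powr p + l powr (1 - p) * norm (g x) powr p \<partial>M)"
    unfolding Lp_mass_def using f g Lp_space_add[OF f g] assms
    by (intro integral_mono norm_add_powr_le) (auto simp: Lp_space_def)
  also have "\<dots> = (1 - l) powr (1 - p) * Lp_mass M p f + l powr (1 - p) * Lp_mass M p g"
    unfolding Lp_mass_def using f g
    by (subst Bochner_Integration.integral_add) (auto simp: Lp_space_def)
  finally show ?thesis .
qed

theorem Lp_nrm_triangle:
  assumes f: "f \<in> Lp_space M p" and g: "g \<in> Lp_space M p" and p: "p \<ge> 1"
  shows "Lp_nrm M p (\<lambda>x. f x + g x) \<le> Lp_nrm M p f + Lp_nrm M p g"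
proof -
  note [measurable] = Lp_spaceD(1)[OF f] Lp_spaceD(1)[OF g]
  let ?a = "Lp_nrm M p f" and ?b = "Lp_nrm M p g"
  consider "?a = 0" | "?b = 0" | "?a > 0" "?b > 0"
    using Lp_nrm_nonneg[of M p f] Lp_nrm_nonneg[of M p g] by linarith
  then show ?thesis
  proof cases
    case 1
    then have "AE x in M. f x = 0" using Lp_nrm_eq_0_iff[OF f] by simp
    then have "AE x in M. f x + g x = g x" by eventually_elim simp
    then have "Lp_mass M p (\<lambda>x. f x + g x) = Lp_mass M p g"
      by (intro Lp_mass_cong_AE) auto
    then show ?thesis by (simp add: Lp_nrm_def)
  next
    case 2
    then have "AE x in M. g x = 0" using Lp_nrm_eq_0_iff[OF g] by simp
    then have "AE x in M. f x + g x = f x" by eventually_elim simp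
    then have "Lp_mass M p (\<lambda>x. f x + g x) = Lp_mass M p f"
      by (intro Lp_mass_cong_AE) auto
    then show ?thesis by (simp add: Lp_nrm_def)
  next
    case 3
    define s where "s = ?a + ?b"
    have s: "s > 0" using 3 by (simp add: s_def)
    \<comment> \<open>The weight l = b/(a+b) minimises the bound of \<open>Lp_mass_add_le\<close>;
      with it the two terms scale to \<open>s powr (p - 1)\<close> times a and b.\<close>
    have l: "1 - ?b / s = ?a / s" using 3 s by (simp add: s_def field_simps)
    have e: "(c / s) powr (1 - p) * c powr p = s powr (p - 1) * c" if "c > 0" for c
      using that s by (simp add: powr_divide powr_diff)
    have "Lp_mass M p (\<lambda>x. f x + g x)
        \<le> (?a / s) powr (1 - p) * Lp_mass M p f + (?b / s) powr (1 - p) * Lp_mass M p g"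
      using Lp_mass_add_le[OF f g p, of "?b / s"] 3 s unfolding l by (simp add: s_def)
    also have "\<dots> = s powr (p - 1) * ?a + s powr (p - 1) * ?b"
      using p e[OF 3(1)] e[OF 3(2)] by (simp add: Lp_mass_eq_nrm[of p])
    also have "\<dots> = s powr p"
      using s by (simp add: powr_diff s_def[symmetric] flip: distrib_left add_divide_distrib)
    finally have "Lp_mass M p (\<lambda>x. f x + g x) powr (1/p) \<le> (s powr p) powr (1/p)"
      using p by (intro powr_mono2) auto
    then show ?thesis using p s by (simp add: Lp_nrm_def powr_powr s_def)
  qed
qed

lemma Lp_nrm_triangle_diff:
  assumes f: "f \<in> Lp_space M p" and g: "g \<in> Lp_space M p" and h: "h \<in> Lp_space M p" and p: "p \<ge> 1"
  shows "Lp_nrm M p (\<lambda>x. f x - h x) \<le> Lp_nrm M p (\<lambda>x. f x - g x) + Lp_nrm M p (\<lambda>x. g x - h x)"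
  using Lp_nrm_triangle[OF Lp_space_diff[OF f g p] Lp_space_diff[OF g h p] p] by simp

lemma Lp_nrm_diff_le:
  assumes f: "f \<in> Lp_space M p" and g: "g \<in> Lp_space M p" and p: "p \<ge> 1"
  shows "\<bar>Lp_nrm M p f - Lp_nrm M p g\<bar> \<le> Lp_nrm M p (\<lambda>x. f x - g x)"
  using Lp_nrm_triangle_diff[OF f g Lp_space_zero p] Lp_nrm_triangle_diff[OF g f Lp_space_zero p]
    Lp_nrm_minus_commute[of M p f g] by simp

lemma Lp_nrm_tendsto:
  assumes "\<And>n. f n \<in> Lp_space M p" "g \<in> Lp_space M p" "p \<ge> 1"
    and lim: "((\<lambda>n. Lp_nrm M p (\<lambda>x. f n x - g x)) \<longlongrightarrow> 0) F"
  shows "((\<lambda>n. Lp_nrm M p (f n)) \<longlongrightarrow> Lp_nrm M p g) F"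
proof -
  have "((\<lambda>n. Lp_nrm M p (f n) - Lp_nrm M p g) \<longlongrightarrow> 0) F"
    by (rule Lim_null_comparison[OF always_eventually lim])
      (use Lp_nrm_diff_le[OF assms(1-3)] in simp)
  then show ?thesis using Lim_null by blast
qed

subsection \<open>Duality pairing\<close>

lemma Lp_mult_integrable:
  assumes f: "f \<in> Lp_space M p" and g: "g \<in> Lp_space M q" and pq: "p > 1" "q > 1" "1/p + 1/q = 1"
  shows "integrable M (\<lambda>x. f x * g x)"
proof (rule Bochner_Integration.integrable_bound)
  note [measurable] = Lp_spaceD(1)[OF f] Lp_spaceD(1)[OF g]
  show "integrable M (\<lambda>x. norm (f x) powr p / p + norm (g x) powr q / q)"
    using f g by (auto simp: Lp_space_def)
  show "AE x in M. norm (f x * g x) \<le> norm (norm (f x) powr p / p + norm (g x) powr q / q)"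
    using Youngs_inequality[OF pq] pq by (intro AE_I2) (auto simp: norm_mult intro: order_trans)
qed (use f g in \<open>auto simp: Lp_space_def\<close>)

theorem Lp_Holder:
  assumes f: "f \<in> Lp_space M p" and g: "g \<in> Lp_space M q" and pq: "p > 1" "q > 1" "1/p + 1/q = 1"
  shows "norm (\<integral>x. f x * g x \<partial>M) \<le> Lp_nrm M p f * Lp_nrm M q g"
proof -
  note [measurable] = Lp_spaceD(1)[OF f] Lp_spaceD(1)[OF g]
  let ?a = "Lp_nrm M p f" and ?b = "Lp_nrm M q g"
  consider "?a = 0 \<or> ?b = 0" | "?a > 0" "?b > 0"
    using Lp_nrm_nonneg[of M p f] Lp_nrm_nonneg[of M q g] by linarith
  then show ?thesis
  proof cases
    case 1
    then have "(AE x in M. f x = 0) \<or> (AE x in M. g x = 0)"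
      using Lp_nrm_eq_0_iff[OF f] Lp_nrm_eq_0_iff[OF g] by blast
    then have "AE x in M. f x * g x = 0" by (auto elim: eventually_mono)
    then have "(\<integral>x. f x * g x \<partial>M) = (\<integral>x. 0 \<partial>M)" by (intro integral_cong_AE) auto
    then show ?thesis by simp
  next
    case 2
    have "norm (\<integral>x. f x * g x \<partial>M) \<le> (\<integral>x. norm (f x * g x) \<partial>M)"
      by (rule integral_norm_bound)
    also have "\<dots> \<le> (\<integral>x. ?a * ?b * (norm (f x) powr p / (p * ?a powr p) + norm (g x) powr q / (q * ?b powr q)) \<partial>M)"
    proof (rule integral_mono)
      show "integrable M (\<lambda>x. norm (f x * g x))"
        using Lp_mult_integrable[OF f g pq] by simp
      show "integrable M (\<lambda>x. ?a * ?b * (norm (f x) powr p / (p * ?a powr p) + norm (g x) powr q / (q * ?b powr q)))"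
        using f g by (auto simp: Lp_space_def)
      fix x
      have "norm (f x) / ?a * (norm (g x) / ?b) \<le> (norm (f x) / ?a) powr p / p + (norm (g x) / ?b) powr q / q"
        using 2 by (intro Youngs_inequality[OF pq]) auto
      then show "norm (f x * g x) \<le> ?a * ?b * (norm (f x) powr p / (p * ?a powr p) + norm (g x) powr q / (q * ?b powr q))"
        using 2 by (simp add: norm_mult powr_divide field_simps)
    qed
    also have "\<dots> = ?a * ?b * (Lp_mass M p f / (p * ?a powr p) + Lp_mass M q g / (q * ?b powr q))"
      unfolding Lp_mass_def using f g by (auto simp: Lp_space_def)
    also have "\<dots> = ?a * ?b"
      using 2 pq by (simp add: Lp_mass_eq_nrm)
    finally show ?thesis .
  qed
qed

lemma Lp_pairing_tendsto:
  assumes f: "\<And>n. f n \<in> Lp_space M p" and f': "f' \<in> Lp_space M p" and g: "g \<in> Lp_space M q"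
    and pq: "p > 1" "q > 1" "1/p + 1/q = 1"
    and lim: "((\<lambda>n. Lp_nrm M p (\<lambda>x. f n x - f' x)) \<longlongrightarrow> 0) F"
  shows "((\<lambda>n. \<integral>x. f n x * g x \<partial>M) \<longlongrightarrow> (\<integral>x. f' x * g x \<partial>M)) F"
proof -
  have lim': "((\<lambda>n. Lp_nrm M p (\<lambda>x. f n x - f' x) * Lp_nrm M q g) \<longlongrightarrow> 0) F"
    using tendsto_mult_right[OF lim] by simp
  have "norm ((\<integral>x. f n x * g x \<partial>M) - (\<integral>x. f' x * g x \<partial>M)) \<le> Lp_nrm M p (\<lambda>x. f n x - f' x) * Lp_nrm M q g" for n
  proof -
    have "(\<integral>x. f n x * g x \<partial>M) - (\<integral>x. f' x * g x \<partial>M) = (\<integral>x. (f n x - f' x) * g x \<partial>M)"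
      using Lp_mult_integrable[OF f g pq] Lp_mult_integrable[OF f' g pq] by (simp add: left_diff_distrib)
    then show ?thesis using Lp_Holder[OF Lp_space_diff[OF f f'] g pq] pq by simp
  qed
  then have "((\<lambda>n. (\<integral>x. f n x * g x \<partial>M) - (\<integral>x. f' x * g x \<partial>M)) \<longlongrightarrow> 0) F"
    by (intro Lim_null_comparison[OF always_eventually lim']) simp
  then show ?thesis by (rule Lim_null[THEN iffD2])
qed

subsection \<open>Completeness\<close>

lemma convergent_of_summable_increments:
  fixes s :: "nat \<Rightarrow> 'a::banach"
  assumes "summable (\<lambda>k. norm (s (Suc k) - s k))"
  shows "convergent s"
proof -
  have "summable (\<lambda>k. s (Suc k) - s k)" using assms by (rule summable_norm_cancel)
  then have "convergent (\<lambda>n. s n - s 0)"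
    by (simp add: summable_iff_convergent sum_lessThan_telescope)
  then show ?thesis using convergent_add[of "\<lambda>n. s n - s 0" "\<lambda>n. s 0"] by (simp add: convergent_const)
qed

text \<open>A fast subsequence converges pointwise almost everywhere, and Fatou's lemma bounds the
  distance of all late terms of the original sequence to that limit.\<close>

theorem Lp_complete:
  assumes f: "\<And>n. f n \<in> Lp_space M p" and p: "p \<ge> 1"
    and cauchy: "\<And>e. e > 0 \<Longrightarrow> \<exists>N. \<forall>m\<ge>N. \<forall>n\<ge>N. Lp_nrm M p (\<lambda>x. f m x - f n x) < e"
  obtains g where "g \<in> Lp_space M p" "(\<lambda>n. Lp_nrm M p (\<lambda>x. f n x - g x)) \<longlonglongrightarrow> 0"
proof -
  have [measurable]: "f n \<in> borel_measurable M" for n using f by (auto dest: Lp_spaceD)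
  have "\<forall>k. \<exists>N. \<forall>m\<ge>N. \<forall>n\<ge>N. Lp_nrm M p (\<lambda>x. f m x - f n x) < (1/4)^k"
    using cauchy by simp
  then obtain N where N: "\<And>k m n. m \<ge> N k \<Longrightarrow> n \<ge> N k \<Longrightarrow> Lp_nrm M p (\<lambda>x. f m x - f n x) < (1/4)^k"
    by metis
  \<comment> \<open>The sum dominates each \<open>N i\<close> with i <= k, so from index k on the
    subsequence stays in the k-th Cauchy tail.\<close>
  define r where "r k = k + (\<Sum>i\<le>k. N i)" for k
  have rN: "r j \<ge> N k" if "j \<ge> k" for j k
    using that member_le_sum[of k "{..j}" N] by (simp add: r_def)
  define d where "d k x = norm (f (r (Suc k)) x - f (r k) x)" for k x
  have mass: "(\<integral>\<^sup>+x. ennreal (norm (f m x - f n x) powr p) \<partial>M) \<le> ennreal (((1/4)^k) powr p)"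
    if "m \<ge> N k" "n \<ge> N k" for m n k
  proof -
    have "(\<integral>\<^sup>+x. ennreal (norm (f m x - f n x) powr p) \<partial>M) = ennreal (Lp_mass M p (\<lambda>x. f m x - f n x))"
      unfolding Lp_mass_def using Lp_space_diff[OF f f p, of m n]
      by (subst nn_integral_eq_integral) (auto simp: Lp_space_def)
    also have "Lp_mass M p (\<lambda>x. f m x - f n x) = Lp_nrm M p (\<lambda>x. f m x - f n x) powr p"
      using p by (simp add: Lp_mass_eq_nrm)
    also have "\<dots> \<le> ((1/4)^k) powr p"
      using N[OF that] p by (intro powr_mono2) auto
    finally show ?thesis by (simp add: ennreal_leI)
  qed
  \<comment> \<open>The increments have norm at most 4^-k. Weighted by 2^k their p-th powers still
    integrate to a geometric series with ratio \<open>(1/2) powr p\<close>; where the weighted sum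
    is finite, \<open>d k x\<close> is at most a constant times 2^-k. This avoids Minkowski's
    inequality for infinite sums.\<close>
  have "AE x in M. convergent (\<lambda>k. f (r k) x)"
  proof -
    have [measurable]: "d k \<in> borel_measurable M" for k unfolding d_def by measurable
    have "(\<integral>\<^sup>+x. (\<Sum>k. ennreal ((2^k * d k x) powr p)) \<partial>M) = (\<Sum>k. \<integral>\<^sup>+x. ennreal ((2^k * d k x) powr p) \<partial>M)"
      by (rule nn_integral_suminf) measurable
    also have "\<dots> \<le> (\<Sum>k. ennreal (((1/2) powr p)^k))"
    proof (rule suminf_le)
      fix k
      have "(\<integral>\<^sup>+x. ennreal ((2^k * d k x) powr p) \<partial>M) = (\<integral>\<^sup>+x. ennreal ((2^k) powr p) * ennreal (d k x powr p) \<partial>M)"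
        by (intro nn_integral_cong) (auto simp: d_def powr_mult ennreal_mult'')
      also have "\<dots> = ennreal ((2^k) powr p) * (\<integral>\<^sup>+x. ennreal (d k x powr p) \<partial>M)"
        by (rule nn_integral_cmult) measurable
      also have "\<dots> \<le> ennreal ((2^k) powr p) * ennreal (((1/4)^k) powr p)"
        unfolding d_def by (intro mult_left_mono mass rN) auto
      also have "\<dots> = ennreal ((2^k * (1/4)^k) powr p)"
        by (simp add: powr_mult ennreal_mult'')
      also have "(2::real)^k * (1/4)^k = (1/2)^k" by (simp flip: power_mult_distrib)
      also have "((1/2)^k) powr p = (((1/2::real) powr p)^k)"
        by (simp add: powr_powr mult.commute flip: powr_realpow)
      finally show "(\<integral>\<^sup>+x. ennreal ((2^k * d k x) powr p) \<partial>M) \<le> ennreal (((1/2) powr p)^k)" .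
    qed auto
    also have "\<dots> < \<infinity>"
    proof -
      have "(1/2::real) powr p < 1" using p powr_less_mono'[of "1/2" 0 p] by simp
      then have "summable (\<lambda>k. ((1/2::real) powr p)^k)" by (intro summable_geometric) simp
      then show ?thesis by (simp add: suminf_ennreal2 less_top[symmetric])
    qed
    finally have fin: "AE x in M. (\<Sum>k. ennreal ((2^k * d k x) powr p)) \<noteq> \<infinity>"
      by (intro nn_integral_PInf_AE) auto
    have term_le: "c k \<le> suminf c" for c :: "nat \<Rightarrow> ennreal" and k
      using sum_le_suminf[OF summableI, of "{k}" c] by simp
    from fin show ?thesis
    proof eventually_elim
      case (elim x)
      then obtain S where S: "(\<Sum>k. ennreal ((2^k * d k x) powr p)) = ennreal S" "S \<ge> 0"
        by (metis ennreal_cases infinity_ennreal_def)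
      have "norm (d k x) \<le> S powr (1/p) * (1/2)^k" for k
      proof -
        have "ennreal ((2^k * d k x) powr p) \<le> (\<Sum>k. ennreal ((2^k * d k x) powr p))"
          using term_le[of "\<lambda>k. ennreal ((2^k * d k x) powr p)" k] .
        then have "(2^k * d k x) powr p \<le> S" using S by simp
        then have "((2^k * d k x) powr p) powr (1/p) \<le> S powr (1/p)"
          using p by (intro powr_mono2) auto
        then have "2^k * d k x \<le> S powr (1/p)" using p by (simp add: powr_powr d_def)
        then show ?thesis by (simp add: d_def field_simps)
      qed
      then have "summable (\<lambda>k. d k x)"
        by (intro summable_comparison_test'[OF summable_mult[OF summable_geometric]]) auto
      then show ?case unfolding d_def by (rule convergent_of_summable_increments)
    qed
  qed
  define g where "g x = lim (\<lambda>k. f (r k) x)" for x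
  have [measurable]: "g \<in> borel_measurable M" unfolding g_def by measurable
  have lim: "AE x in M. (\<lambda>k. f (r k) x) \<longlonglongrightarrow> g x"
    using \<open>AE x in M. convergent (\<lambda>k. f (r k) x)\<close>
    by eventually_elim (simp add: g_def convergent_LIMSEQ_iff)
  have fatou: "(\<integral>\<^sup>+x. ennreal (norm (f n x - g x) powr p) \<partial>M) \<le> ennreal (((1/4)^k) powr p)"
    if "n \<ge> N k" for n k
  proof -
    have "(\<integral>\<^sup>+x. ennreal (norm (f n x - g x) powr p) \<partial>M)
        = (\<integral>\<^sup>+x. liminf (\<lambda>j. ennreal (norm (f n x - f (r j) x) powr p)) \<partial>M)"
    proof (rule nn_integral_cong_AE)
      show "AE x in M. ennreal (norm (f n x - g x) powr p) = liminf (\<lambda>j. ennreal (norm (f n x - f (r j) x) powr p))"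
        using lim
      proof eventually_elim
        case (elim x)
        have "(\<lambda>j. ennreal (norm (f n x - f (r j) x) powr p)) \<longlonglongrightarrow> ennreal (norm (f n x - g x) powr p)"
          using p by (intro tendsto_ennrealI tendsto_powr' tendsto_intros elim) auto
        then show ?case by (metis lim_imp_Liminf sequentially_bot)
      qed
    qed
    also have "\<dots> \<le> liminf (\<lambda>j. \<integral>\<^sup>+x. ennreal (norm (f n x - f (r j) x) powr p) \<partial>M)"
      by (rule nn_integral_liminf) measurable
    also have "\<dots> \<le> liminf (\<lambda>j. ennreal (((1/4)^k) powr p))"
      by (intro Liminf_mono eventually_sequentiallyI[of k] mass that rN)
    also have "\<dots> = ennreal (((1/4)^k) powr p)" by (simp add: Liminf_const)
    finally show ?thesis .
  qed
  have diff: "(\<lambda>x. f n x - g x) \<in> Lp_space M p" if "n \<ge> N 0" for n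
  proof -
    have "integrable M (\<lambda>x. norm (f n x - g x) powr p)"
      using fatou[OF that] by (intro integrableI_bounded) (auto simp: less_top[symmetric] top_unique)
    then show ?thesis by (simp add: Lp_space_def)
  qed
  have g: "g \<in> Lp_space M p"
    using Lp_space_diff[OF f diff[OF order_refl] p, of "N 0"] by simp
  have bound: "Lp_nrm M p (\<lambda>x. f n x - g x) \<le> (1/4)^k" if "n \<ge> N k" for n k
  proof -
    have "ennreal (Lp_mass M p (\<lambda>x. f n x - g x)) = (\<integral>\<^sup>+x. ennreal (norm (f n x - g x) powr p) \<partial>M)"
      unfolding Lp_mass_def using Lp_space_diff[OF f g p, of n]
      by (subst nn_integral_eq_integral) (auto simp: Lp_space_def)
    also note fatou[OF that]
    finally have "Lp_mass M p (\<lambda>x. f n x - g x) powr (1/p) \<le> (((1/4)^k) powr p) powr (1/p)"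
      using p by (intro powr_mono2) (auto simp: ennreal_le_iff)
    then show ?thesis using p by (simp add: Lp_nrm_def powr_powr)
  qed
  have "(\<lambda>n. Lp_nrm M p (\<lambda>x. f n x - g x)) \<longlonglongrightarrow> 0"
  proof (rule LIMSEQ_I)
    fix e :: real assume "e > 0"
    then obtain k where k: "(1/4)^k < e" using real_arch_pow_inv[of e "1/4"] by auto
    then show "\<exists>no. \<forall>n\<ge>no. norm (Lp_nrm M p (\<lambda>x. f n x - g x) - 0) < e"
      using bound by (intro exI[of _ "N k"]) (auto intro: le_less_trans)
  qed
  with g show ?thesis using that by blast
qed

subsection \<open>Best approximation\<close>

lemma powr_gt_tangent_at_one:
  fixes s p :: real
  assumes "p > 1" "s \<ge> 0" "s \<noteq> 1"
  shows "s powr p > 1 + p * (s - 1)"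
proof -
  have der: "((\<lambda>x. x powr p) has_real_derivative p * x powr (p - 1)) (at x)" if "x > 0" for x
    using that by (rule has_real_derivative_powr)
  consider "s = 0" | "0 < s" "s < 1" | "s > 1" using assms by linarith
  then show ?thesis
  proof cases
    case 1 then show ?thesis using assms by simp
  next
    case 2
    obtain z where z: "s < z" "z < 1" "1 powr p - s powr p = (1 - s) * (p * z powr (p - 1))"
      using MVT2[OF 2(2), of "\<lambda>x. x powr p" "\<lambda>x. p * x powr (p - 1)"] der 2 by auto
    have "z powr (p - 1) < 1" using z 2 assms powr_less_mono2[of "p - 1" z 1] by simp
    then have "(1 - s) * (p * z powr (p - 1)) < (1 - s) * (p * 1)" using 2 assms
      by (intro mult_strict_left_mono) auto
    then show ?thesis using z by (simp add: algebra_simps)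
  next
    case 3
    obtain z where z: "1 < z" "z < s" "s powr p - 1 powr p = (s - 1) * (p * z powr (p - 1))"
      using MVT2[OF 3, of "\<lambda>x. x powr p" "\<lambda>x. p * x powr (p - 1)"] der by auto
    have "z powr (p - 1) > 1" using z assms powr_less_mono2[of "p - 1" 1 z] by simp
    then have "(s - 1) * (p * z powr (p - 1)) > (s - 1) * (p * 1)" using 3 assms
      by (intro mult_strict_left_mono) auto
    then show ?thesis using z by (simp add: algebra_simps)
  qed
qed

text \<open>Both x and y lie strictly above the tangent at their midpoint, and the linear terms
  cancel by symmetry.\<close>

lemma powr_midpoint_less:
  fixes x y p :: real
  assumes p: "p > 1" and "x \<ge> 0" "y \<ge> 0" "x \<noteq> y"
  shows "((x + y) / 2) powr p < (x powr p + y powr p) / 2"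
proof -
  define m where "m = (x + y) / 2"
  have m: "m > 0" using assms by (auto simp: m_def)
  have t: "z powr p > m powr p * (1 + p * (z / m - 1))" if "z \<ge> 0" "z \<noteq> m" for z
  proof -
    have "(z / m) powr p > 1 + p * (z / m - 1)"
      using that m by (intro powr_gt_tangent_at_one p) auto
    then show ?thesis using m that by (simp add: powr_divide field_simps)
  qed
  have y: "y / m = 2 - x / m" using m by (simp add: m_def field_simps)
  have "m powr p * (1 + p * (x / m - 1)) + m powr p * (1 + p * (y / m - 1)) = 2 * m powr p"
    unfolding y by (simp add: algebra_simps)
  moreover have "x \<noteq> m" "y \<noteq> m" using assms by (auto simp: m_def)
  ultimately show ?thesis using t[of x] t[of y] assms by (simp add: m_def)
qed

text \<open>Strictness has two sources: for different norms the scalar inequality, for equal norms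
  the strict triangle inequality of an inner product space.\<close>

lemma norm_midpoint_powr_less:
  fixes a b :: "'a::real_inner"
  assumes p: "p > 1" and "a \<noteq> b"
  shows "norm ((a + b) /\<^sub>R 2) powr p < (norm a powr p + norm b powr p) / 2"
proof (cases "norm a = norm b")
  case True
  have "norm (a + b) \<noteq> norm a + norm b"
  proof
    assume "norm (a + b) = norm a + norm b"
    then have "norm a *\<^sub>R b = norm b *\<^sub>R a" by (simp add: norm_triangle_eq)
    with True assms(2) show False by (cases "norm a = 0") auto
  qed
  then have "norm (a + b) < norm a + norm b" using norm_triangle_ineq[of a b] by linarith
  then have "norm ((a + b) /\<^sub>R 2) < norm a" using True by simp
  then have "norm ((a + b) /\<^sub>R 2) powr p < norm a powr p" using p by (intro powr_less_mono2) auto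
  then show ?thesis using True by simp
next
  case False
  have "norm ((a + b) /\<^sub>R 2) \<le> (norm a + norm b) / 2" using norm_triangle_ineq[of a b] by simp
  then have "norm ((a + b) /\<^sub>R 2) powr p \<le> ((norm a + norm b) / 2) powr p" using p by (intro powr_mono2) auto
  also have "\<dots> < (norm a powr p + norm b powr p) / 2" using False p by (intro powr_midpoint_less) auto
  finally show ?thesis .
qed

text \<open>Compactness and homogeneity replace Clarkson's inequalities: off the set where \<open>a\<close> and \<open>b\<close>
  nearly agree, the convexity gap on the unit sphere is bounded away from zero.\<close>

lemma powr_convexity_gap:
  fixes p e :: real
  assumes p: "p > 1" and e: "e > 0"
  obtains C where "C \<ge> 0" "\<And>a b :: complex. norm (a - b) powr p \<le> e * (norm a powr p + norm b powr p)
      + C * ((norm a powr p + norm b powr p) / 2 - norm ((a + b) / 2) powr p)"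
proof -
  define gap where "gap z = (norm (fst z) powr p + norm (snd z) powr p) / 2 - norm ((fst z + snd z) / 2) powr p"
    for z :: "complex \<times> complex"
  define K where "K = {z :: complex \<times> complex. norm (fst z) powr p + norm (snd z) powr p = 1 \<and> e \<le> norm (fst z - snd z) powr p}"
  have gap_pos: "gap z > 0" if "fst z \<noteq> snd z" for z
    using norm_midpoint_powr_less[OF p that] by (simp add: gap_def scaleR_conv_of_real norm_mult norm_divide)
  have gap_nonneg: "gap z \<ge> 0" for z
    using gap_pos[of z] by (cases "fst z = snd z") (auto simp: gap_def)
  have contp: "continuous_on UNIV (\<lambda>z::complex \<times> complex. norm (f z) powr p)" if "continuous_on UNIV f" for f :: "_ \<Rightarrow> complex"
    using p by (intro continuous_on_powr' continuous_intros that) auto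
  have cont: "continuous_on UNIV gap"
    unfolding gap_def by (intro continuous_intros contp) auto
  have le1: "norm c \<le> 1" if "norm c powr p \<le> 1" for c :: complex
  proof (rule ccontr)
    assume "\<not> norm c \<le> 1"
    then have "1 powr p < norm c powr p" using p by (intro powr_less_mono2) auto
    then show False using that by simp
  qed
  have "closed K"
    unfolding K_def by (intro closed_Collect_conj closed_Collect_eq closed_Collect_le continuous_intros contp)
  moreover have "bounded K"
  proof -
    have "K \<subseteq> cball 0 1 \<times> cball 0 1"
    proof
      fix z assume "z \<in> K"
      then have "norm (fst z) powr p \<le> 1" "norm (snd z) powr p \<le> 1"
        using powr_ge_zero[of "norm (fst z)" p] powr_ge_zero[of "norm (snd z)" p] unfolding K_def mem_Collect_eq by linarith+
      then have "norm (fst z) \<le> 1" "norm (snd z) \<le> 1" using le1 by blast+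
      then show "z \<in> cball 0 1 \<times> cball 0 1" by (simp add: mem_Times_iff)
    qed
    then show ?thesis using bounded_subset[OF bounded_Times] bounded_cball by blast
  qed
  ultimately have "compact K" by (simp add: compact_eq_bounded_closed)
  obtain dl where dl: "dl > 0" "\<And>z. z \<in> K \<Longrightarrow> dl \<le> gap z"
  proof (cases "K = {}")
    case True then show ?thesis using that[of 1] by auto
  next
    case False
    obtain z0 where z0: "z0 \<in> K" "\<And>z. z \<in> K \<Longrightarrow> gap z0 \<le> gap z"
      using continuous_attains_inf[OF \<open>compact K\<close> False continuous_on_subset[OF cont]] by auto
    have "fst z0 \<noteq> snd z0" using z0(1) e by (auto simp: K_def)
    then show ?thesis using that[of "gap z0"] gap_pos z0 by auto
  qed
  \<comment> \<open>On \<open>K\<close> both norms are at most 1, so the left side is at most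
    \<open>2 powr p\<close>, while the gap is at least \<open>dl\<close>.\<close>
  define C where "C = 2 powr p / dl"
  have C: "C \<ge> 0" using dl by (simp add: C_def)
  have unit: "norm (a - b) powr p \<le> e + C * gap (a, b)" if n: "norm a powr p + norm b powr p = 1" for a b :: complex
  proof (cases "norm (a - b) powr p \<le> e")
    case True
    then show ?thesis using mult_nonneg_nonneg[OF C gap_nonneg[of "(a, b)"]] by linarith
  next
    case False
    then have K: "(a, b) \<in> K" using n by (simp add: K_def)
    have "norm a powr p \<le> 1" "norm b powr p \<le> 1"
      using n powr_ge_zero[of "norm a" p] powr_ge_zero[of "norm b" p] by linarith+
    then have "norm a \<le> 1" "norm b \<le> 1" using le1 by blast+
    then have "norm (a - b) \<le> 2" using norm_triangle_ineq4[of a b] by linarith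
    then have "norm (a - b) powr p \<le> 2 powr p" using p by (intro powr_mono2) auto
    also have "\<dots> = C * dl" using dl by (simp add: C_def)
    also have "\<dots> \<le> C * gap (a, b)" using dl(2)[OF K] C by (intro mult_left_mono)
    finally show ?thesis using e by simp
  qed
  have "norm (a - b) powr p \<le> e * (norm a powr p + norm b powr p) + C * gap (a, b)" for a b :: complex
  proof (cases "a = 0 \<and> b = 0")
    case True then show ?thesis by (simp add: gap_def)
  next
    case False
    define T where "T = norm a powr p + norm b powr p"
    have T: "T > 0" using False by (auto simp: T_def add_pos_nonneg add_nonneg_pos)
    define s where "s = T powr (1 / p)"
    have s: "s > 0" "s powr p = T" using T p by (auto simp: s_def powr_powr)
    have sc: "norm (c / of_real s) powr p = norm c powr p / T" for c :: complex
      using s by (simp add: norm_divide powr_divide)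
    have "norm (a / of_real s - b / of_real s) powr p \<le> e + C * gap (a / of_real s, b / of_real s)"
      using T by (intro unit) (simp add: sc T_def flip: add_divide_distrib)
    moreover have "gap (a / of_real s, b / of_real s) = gap (a, b) / T"
    proof -
      have "(a / of_real s + b / of_real s) / 2 = ((a + b) / 2) / of_real s"
        by (simp add: mult.commute flip: add_divide_distrib)
      then have "gap (a / of_real s, b / of_real s)
          = (norm a powr p / T + norm b powr p / T) / 2 - norm ((a + b) / 2) powr p / T"
        by (simp only: gap_def fst_conv snd_conv sc)
      then show ?thesis by (simp add: gap_def diff_divide_distrib add_divide_distrib)
    qed
    moreover have "norm (a / of_real s - b / of_real s) powr p = norm (a - b) powr p / T"
      using sc[of "a - b"] by (simp add: diff_divide_distrib)
    ultimately have "norm (a - b) powr p / T \<le> e + C * (gap (a, b) / T)" by simp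
    then have "norm (a - b) powr p \<le> e * T + C * gap (a, b)" using T by (simp add: field_simps)
    then show ?thesis by (simp add: T_def)
  qed
  then show ?thesis using that[OF C] by (simp add: gap_def)
qed

text \<open>The duality map of L^p: \<open>p * Re (pdual p w * h)\<close> is the derivative of the
  p-th power of the norm at \<open>w\<close> in direction \<open>h\<close>. At 0 its value is 0 for
  every exponent, thanks to the factor \<open>cnj z\<close>.\<close>

definition pdual :: "real \<Rightarrow> complex \<Rightarrow> complex" where
  "pdual p z = cnj z * of_real (norm z powr (p - 2))"

lemma norm_pdual: "p > 1 \<Longrightarrow> norm (pdual p z) = norm z powr (p - 1)"
  by (cases "z = 0") (auto simp: pdual_def norm_mult powr_mult_base)

lemma pdual_mult_self: "p > 1 \<Longrightarrow> pdual p z * z = of_real (norm z powr p)"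
proof (cases "z = 0")
  case False
  have "pdual p z * z = of_real ((norm z)^2 * norm z powr (p - 2))"
    unfolding pdual_def of_real_mult complex_norm_square by simp
  also have "(norm z)^2 * norm z powr (p - 2) = norm z powr p"
    using False by (simp add: powr_diff powr_numeral)
  finally show ?thesis .
qed (auto simp: pdual_def)

lemma continuous_pdual: "p > 1 \<Longrightarrow> continuous_on UNIV (pdual p)"
proof -
  assume p: "p > 1"
  have "isCont (pdual p) z" for z
  proof (cases "z = 0")
    case False
    then show ?thesis unfolding pdual_def by (intro continuous_intros) auto
  next
    case True
    have "((\<lambda>w. norm w powr (p - 1)) \<longlongrightarrow> norm (0::complex) powr (p - 1)) (at 0)"
      using p by (intro tendsto_powr' tendsto_norm tendsto_ident_at tendsto_const) (auto intro!: always_eventually tendsto_norm_zero)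
    then have "((\<lambda>w. norm (pdual p w)) \<longlongrightarrow> 0) (at 0)" using p by (simp add: norm_pdual)
    then have "(pdual p \<longlongrightarrow> 0) (at 0)" by (simp add: tendsto_norm_zero_iff)
    then show ?thesis using True by (simp add: isCont_def pdual_def)
  qed
  then show ?thesis by (simp add: continuous_on_eq_continuous_at)
qed

lemma pdual_measurable [measurable]: "p > 1 \<Longrightarrow> pdual p \<in> borel_measurable borel"
  by (rule borel_measurable_continuous_onI[OF continuous_pdual])

lemma norm_pdual_powr:
  assumes "p > 1" "1/p + 1/q = 1"
  shows "norm (pdual p z) powr q = norm z powr p"
proof -
  have "(p - 1) * q = p" using assms by (cases "q = 0") (auto simp: field_simps)
  then show ?thesis using assms by (simp add: norm_pdual powr_powr)
qed

lemma pdual_Lp_space: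
  assumes "f \<in> Lp_space M p" "p > 1" "1/p + 1/q = 1"
  shows "(\<lambda>x. pdual p (f x)) \<in> Lp_space M q"
  using assms measurable_compose[OF Lp_spaceD(1)[OF assms(1)] pdual_measurable]
  by (auto simp: Lp_space_def norm_pdual_powr)

lemma Lp_mass_pdual:
  assumes "p > 1" "1/p + 1/q = 1"
  shows "Lp_mass M q (\<lambda>x. pdual p (f x)) = Lp_mass M p f"
  using assms by (simp add: Lp_mass_def norm_pdual_powr)

lemma integral_pdual_mult_self:
  "p > 1 \<Longrightarrow> (\<integral>x. pdual p (f x) * f x \<partial>M) = of_real (Lp_mass M p f)"
  by (simp add: pdual_mult_self Lp_mass_def)

text \<open>The supporting plane of a convex function at \<open>w\<close>. Young's inequality for
  \<open>u\<close> and \<open>pdual p w\<close>, with the identity \<open>norm_pdual_powr\<close>,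
  yields it without differentiation.\<close>

lemma powr_ge_tangent:
  fixes u w :: complex
  assumes p: "p > 1"
  shows "norm u powr p \<ge> norm w powr p + p * Re (pdual p w * (u - w))"
proof -
  define q where "q = p / (p - 1)"
  have q: "q > 1" "1/p + 1/q = 1" using p by (auto simp: q_def field_simps)
  have "Re (pdual p w * u) \<le> norm u * norm (pdual p w)"
    by (metis complex_Re_le_cmod mult.commute norm_mult)
  also have "\<dots> \<le> norm u powr p / p + norm (pdual p w) powr q / q"
    by (rule Youngs_inequality) (use p q in auto)
  also have "1/q = 1 - 1/p" using q by simp
  then have "norm (pdual p w) powr q / q = norm w powr p * (1 - 1/p)"
    using norm_pdual_powr[OF p q(2), of w] by (metis divide_inverse inverse_eq_divide)
  finally have "p * Re (pdual p w * u) \<le> p * (norm u powr p / p + norm w powr p * (1 - 1/p))"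
    using p by (intro mult_left_mono) auto
  also have "\<dots> = norm u powr p + (p - 1) * norm w powr p" using p by (simp add: field_simps)
  finally have "p * Re (pdual p w * u) \<le> norm u powr p + (p - 1) * norm w powr p" .
  moreover have "Re (pdual p w * w) = norm w powr p" using pdual_mult_self[OF p, of w] by simp
  ultimately show ?thesis by (simp add: algebra_simps)
qed

text \<open>The first variation of the mass. The tangent inequality is taken at the perturbed points
  u + s h instead of at u: with the minimality of u it gives a sign for every s > 0, and s -> 0
  needs only dominated convergence. The multiples of \<open>m\<close> by 1, -1, i and -i turn the
  sign into vanishing.\<close>

lemma Lp_minimizer_orthogonal:
  assumes p: "p > 1" and u: "u \<in> Lp_space M p" and m: "m \<in> Lp_space M p"
    and min: "\<And>c. Lp_mass M p u \<le> Lp_mass M p (\<lambda>x. u x + c * m x)"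
  shows "(\<integral>x. pdual p (u x) * m x \<partial>M) = 0"
proof -
  define q where "q = p / (p - 1)"
  have q: "q > 1" "1/q + 1/p = 1" "1/p + 1/q = 1" using p by (auto simp: q_def field_simps)
  have pos: "Re (\<integral>x. pdual p (u x) * (c * m x) \<partial>M) \<ge> 0" for c
  proof -
    define h where "h x = c * m x" for x
    have h: "h \<in> Lp_space M p" unfolding h_def using m by (rule Lp_space_cmult)
    note [measurable] = Lp_spaceD(1)[OF u] Lp_spaceD(1)[OF h] pdual_measurable[OF p]
    define s where "s n = inverse (real (Suc n))" for n
    define w where "w n x = u x + of_real (s n) * h x" for n x
    have w: "w n \<in> Lp_space M p" for n unfolding w_def
      using p by (intro Lp_space_add u Lp_space_cmult h) auto
    have s: "s n > 0" "s n \<le> 1" for n by (auto simp: s_def field_simps)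
    have int: "integrable M (\<lambda>x. pdual p (w n x) * h x)" for n
      by (rule Lp_mult_integrable[OF pdual_Lp_space[OF w p q(3)] h q(1) p q(2)])
    have ge: "Re (\<integral>x. pdual p (w n x) * h x \<partial>M) \<ge> 0" for n
    proof -
      have "Lp_mass M p (w n) - p * s n * Re (\<integral>x. pdual p (w n x) * h x \<partial>M)
         = (\<integral>x. norm (w n x) powr p - p * s n * Re (pdual p (w n x) * h x) \<partial>M)"
        unfolding Lp_mass_def using w[of n] int[of n]
        by (subst Bochner_Integration.integral_diff) (auto simp: Lp_space_def simp del: times_complex.sel)
      also have "\<dots> \<le> Lp_mass M p u"
        unfolding Lp_mass_def
      proof (rule integral_mono)
        show "integrable M (\<lambda>x. norm (w n x) powr p - p * s n * Re (pdual p (w n x) * h x))"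
          using w[of n] int[of n] by (auto simp: Lp_space_def simp del: times_complex.sel)
        show "integrable M (\<lambda>x. norm (u x) powr p)" using u by (simp add: Lp_space_def)
        show "norm (w n x) powr p - p * s n * Re (pdual p (w n x) * h x) \<le> norm (u x) powr p" for x
        proof -
          have "pdual p (w n x) * (u x - w n x) = of_real (- s n) * (pdual p (w n x) * h x)"
            by (simp add: w_def algebra_simps)
          then have "Re (pdual p (w n x) * (u x - w n x)) = - s n * Re (pdual p (w n x) * h x)"
            by simp
          then have "p * Re (pdual p (w n x) * (u x - w n x)) = - (p * s n * Re (pdual p (w n x) * h x))"
            by (simp del: times_complex.sel)
          then show ?thesis using powr_ge_tangent[OF p, where w="w n x" and u="u x"] by linarith
        qed
      qed
      also have "\<dots> \<le> Lp_mass M p (w n)" using min[of "of_real (s n) * c"]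
        by (simp add: w_def[abs_def] h_def mult.assoc)
      finally have "0 \<le> (p * s n) * Re (\<integral>x. pdual p (w n x) * h x \<partial>M)" by simp
      then show ?thesis using p s[of n] by (simp add: zero_le_mult_iff mult_le_0_iff)
    qed
    have "(\<lambda>n. \<integral>x. pdual p (w n x) * h x \<partial>M) \<longlonglongrightarrow> (\<integral>x. pdual p (u x) * h x \<partial>M)"
    proof (rule integral_dominated_convergence)
      show "integrable M (\<lambda>x. (norm (u x) + norm (h x)) powr p)"
      proof -
        have "(\<lambda>x. complex_of_real (norm (u x))) \<in> Lp_space M p" "(\<lambda>x. complex_of_real (norm (h x))) \<in> Lp_space M p"
          using u h by (auto simp: Lp_space_def)
        from Lp_space_add[OF this] p
        have "(\<lambda>x. complex_of_real (norm (u x) + norm (h x))) \<in> Lp_space M p" by simp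
        from Lp_spaceD(2)[OF this] show ?thesis by (simp only: norm_of_real) simp
      qed
      show "AE x in M. norm (pdual p (w n x) * h x) \<le> (norm (u x) + norm (h x)) powr p" for n
      proof (rule AE_I2)
        fix x
        let ?S = "norm (u x) + norm (h x)"
        have "norm (w n x) \<le> norm (u x) + s n * norm (h x)"
          unfolding w_def using norm_triangle_ineq[of "u x" "of_real (s n) * h x"] s[of n] by (simp add: norm_mult)
        also have "\<dots> \<le> ?S" using s[of n] mult_right_mono[of "s n" 1 "norm (h x)"] by simp
        finally have "norm (w n x) powr (p - 1) \<le> ?S powr (p - 1)" using p by (intro powr_mono2) auto
        then have "norm (pdual p (w n x) * h x) \<le> ?S powr (p - 1) * ?S"
          using p by (auto simp: norm_mult norm_pdual intro!: mult_mono)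
        also have "\<dots> = ?S powr p" by (metis add_nonneg_nonneg norm_ge_zero powr_mult_base mult.commute add.commute diff_add_cancel)
        finally show "norm (pdual p (w n x) * h x) \<le> ?S powr p" .
      qed
      show "AE x in M. (\<lambda>n. pdual p (w n x) * h x) \<longlonglongrightarrow> pdual p (u x) * h x"
      proof (rule AE_I2)
        fix x
        have "s \<longlonglongrightarrow> 0" unfolding s_def by (rule LIMSEQ_inverse_real_of_nat)
        then have "(\<lambda>n. w n x) \<longlonglongrightarrow> u x + of_real 0 * h x"
          unfolding w_def by (intro tendsto_intros)
        then have "(\<lambda>n. pdual p (w n x)) \<longlonglongrightarrow> pdual p (u x)"
          using continuous_on_tendsto_compose[OF continuous_pdual[OF p]] by simp
        then show "(\<lambda>n. pdual p (w n x) * h x) \<longlonglongrightarrow> pdual p (u x) * h x" by (intro tendsto_intros)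
      qed
    qed (auto simp: w_def)
    then have "(\<lambda>n. Re (\<integral>x. pdual p (w n x) * h x \<partial>M)) \<longlonglongrightarrow> Re (\<integral>x. pdual p (u x) * h x \<partial>M)"
      by (rule tendsto_Re)
    then have "Re (\<integral>x. pdual p (u x) * h x \<partial>M) \<ge> 0"
      by (rule LIMSEQ_le_const) (use ge in auto)
    then show ?thesis by (simp add: h_def)
  qed
  have "(\<integral>x. pdual p (u x) * (c * m x) \<partial>M) = c * (\<integral>x. pdual p (u x) * m x \<partial>M)" for c
    by (simp add: mult.left_commute)
  then have pos': "Re (c * (\<integral>x. pdual p (u x) * m x \<partial>M)) \<ge> 0" for c
    using pos[of c] by simp
  show ?thesis using pos'[of 1] pos'[of "-1"] pos'[of \<i>] pos'[of "-\<i>"]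
    by (intro complex_eqI) auto
qed

lemma average_minus_le: "x \<le> b + i \<Longrightarrow> y \<le> b + i \<Longrightarrow> b \<le> c \<Longrightarrow> (x + y) / 2 - c \<le> i"
  for x y b c i :: real
  by argo

text \<open>\<open>V\<close> need not be closed, so the nearest point exists only as a limit.
  Besides the error \<open>u\<close> the conclusion returns elements \<open>v n\<close> of
  \<open>V\<close> with g - v n -> u; through them properties of \<open>V\<close> are carried over
  to \<open>u\<close>. A minimising sequence is Cauchy because the midpoint of two of its terms is
  again g minus an element of \<open>V\<close>: its mass is at least \<open>d\<close>, so the
  convexity gap is small.\<close>

theorem Lp_best_approximation:
  assumes p: "p > 1" and V: "V \<subseteq> Lp_space M p" "(\<lambda>x. 0) \<in> V"
    and V_add: "\<And>v w. v \<in> V \<Longrightarrow> w \<in> V \<Longrightarrow> (\<lambda>x. v x + w x) \<in> V"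
    and V_cmult: "\<And>v c. v \<in> V \<Longrightarrow> (\<lambda>x. c * v x) \<in> V"
    and g: "g \<in> Lp_space M p" and e: "e > 0" "\<And>v. v \<in> V \<Longrightarrow> Lp_nrm M p (\<lambda>x. g x - v x) \<ge> e"
  obtains u v where "u \<in> Lp_space M p" "\<forall>n. v n \<in> V"
    "(\<lambda>n. Lp_nrm M p (\<lambda>x. g x - v n x - u x)) \<longlonglongrightarrow> 0" "Lp_nrm M p u > 0"
    "\<forall>m\<in>V. (\<integral>x. pdual p (u x) * m x \<partial>M) = 0"
proof -
  have p1: "p \<ge> 1" using p by simp
  define d where "d = (INF v\<in>V. Lp_mass M p (\<lambda>x. g x - v x))"
  have bdd: "bdd_below ((\<lambda>v. Lp_mass M p (\<lambda>x. g x - v x)) ` V)"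
    by (intro bdd_belowI2[of _ 0]) auto
  have d_le: "d \<le> Lp_mass M p (\<lambda>x. g x - v x)" if "v \<in> V" for v
    unfolding d_def using bdd that by (intro cINF_lower)
  have d0: "d \<ge> 0" unfolding d_def using V by (intro cINF_greatest) auto
  have "\<exists>v\<in>V. Lp_mass M p (\<lambda>x. g x - v x) < d + inverse (real (Suc n))" for n
  proof -
    have "d < d + inverse (real (Suc n))" by simp
    then show ?thesis using cINF_less_iff[OF _ bdd, of "d + inverse (real (Suc n))"] V(2)
      unfolding d_def by blast
  qed
  then obtain v where v: "\<And>n. v n \<in> V" "\<And>n. Lp_mass M p (\<lambda>x. g x - v n x) < d + inverse (real (Suc n))"
    by metis
  define w where "w n x = g x - v n x" for n x
  have vL: "v n \<in> Lp_space M p" for n using v V by blast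
  have wL: "w n \<in> Lp_space M p" for n unfolding w_def using Lp_space_diff[OF g vL p1] .
  obtain u where u: "u \<in> Lp_space M p" "(\<lambda>n. Lp_nrm M p (\<lambda>x. w n x - u x)) \<longlonglongrightarrow> 0"
  proof (rule Lp_complete[OF wL p1])
    fix e :: real assume "e > 0"
    \<comment> \<open>The masses being at most d + 1, this \<open>eta\<close> bounds the first term
      of the gap estimate by half of \<open>e powr p\<close>; the choice of \<open>N\<close> below
      does the same for the second. The added ones keep the denominators positive.\<close>
    define eta where "eta = e powr p / (4 * (d + 1))"
    have eta: "eta > 0" using \<open>e > 0\<close> d0 by (simp add: eta_def)
    obtain C where C: "C \<ge> 0" "\<And>a b :: complex. norm (a - b) powr p \<le> eta * (norm a powr p + norm b powr p)
      + C * ((norm a powr p + norm b powr p) / 2 - norm ((a + b) / 2) powr p)"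
      using powr_convexity_gap[OF p eta] by blast
    obtain N where N: "inverse (real (Suc N)) < e powr p / (2 * (C + 1))"
      using reals_Archimedean[of "e powr p / (2 * (C + 1))"] C \<open>e > 0\<close> by auto
    have "Lp_nrm M p (\<lambda>x. w m x - w n x) < e" if mn: "m \<ge> N" "n \<ge> N" for m n
    proof -
      define z where "z x = (w m x + w n x) / 2" for x
      have zL: "z \<in> Lp_space M p"
        using Lp_space_cmult[OF Lp_space_add[OF wL[of m] wL[of n] p1], of "1/2"] by (simp add: z_def[abs_def])
      have "z = (\<lambda>x. g x - (1/2) * (v m x + v n x))"
        by (rule ext) (simp add: z_def w_def field_simps)
      then have dz: "d \<le> Lp_mass M p z" using d_le[OF V_cmult[OF V_add[OF v(1) v(1)], of "1/2" m n]] by simp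
      have wle: "Lp_mass M p (w k) \<le> d + inverse (real (Suc N))" if "k \<ge> N" for k
      proof -
        have "inverse (real (Suc k)) \<le> inverse (real (Suc N))" using that by (intro le_imp_inverse_le) auto
        then show ?thesis using v(2)[of k] unfolding w_def[abs_def] by linarith
      qed
      have "Lp_mass M p (\<lambda>x. w m x - w n x)
        \<le> (\<integral>x. eta * (norm (w m x) powr p + norm (w n x) powr p)
            + C * ((norm (w m x) powr p + norm (w n x) powr p) / 2 - norm (z x) powr p) \<partial>M)"
        unfolding Lp_mass_def z_def
      proof (rule integral_mono)
        show "integrable M (\<lambda>x. norm (w m x - w n x) powr p)"
          using Lp_space_diff[OF wL wL p1] by (simp add: Lp_space_def)
        show "integrable M (\<lambda>x. eta * (norm (w m x) powr p + norm (w n x) powr p)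
            + C * ((norm (w m x) powr p + norm (w n x) powr p) / 2 - norm ((w m x + w n x) / 2) powr p))"
          using Lp_spaceD(2)[OF wL[of m]] Lp_spaceD(2)[OF wL[of n]] Lp_spaceD(2)[OF zL]
          by (simp add: z_def)
      qed (rule C)
      also have "\<dots> = eta * (Lp_mass M p (w m) + Lp_mass M p (w n))
            + C * ((Lp_mass M p (w m) + Lp_mass M p (w n)) / 2 - Lp_mass M p z)"
        unfolding Lp_mass_def
        using Lp_spaceD(2)[OF wL[of m]] Lp_spaceD(2)[OF wL[of n]] Lp_spaceD(2)[OF zL] by simp
      also have "\<dots> \<le> eta * (2 * (d + 1)) + C * inverse (real (Suc N))"
      proof (intro add_mono mult_left_mono)
        have "d + inverse (real (Suc N)) \<le> d + 1" by (simp add: field_simps)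
        then have "Lp_mass M p (w m) \<le> d + 1" "Lp_mass M p (w n) \<le> d + 1"
          using wle[OF mn(1)] wle[OF mn(2)] by (auto intro: order_trans)
        then have "Lp_mass M p (w m) + Lp_mass M p (w n) \<le> (d + 1) + (d + 1)"
          by (rule add_mono)
        then show "Lp_mass M p (w m) + Lp_mass M p (w n) \<le> 2 * (d + 1)"
          by simp
        show "(Lp_mass M p (w m) + Lp_mass M p (w n)) / 2 - Lp_mass M p z \<le> inverse (real (Suc N))"
          by (rule average_minus_le[OF wle[OF mn(1)] wle[OF mn(2)] dz])
      qed (use C eta in auto)
      also have "eta * (2 * (d + 1)) = e powr p / 2" using d0 by (simp add: eta_def field_simps)
      also have "C * inverse (real (Suc N)) < e powr p / 2"
      proof -
        have "C * inverse (real (Suc N)) \<le> (C + 1) * inverse (real (Suc N))"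
          by (intro mult_right_mono) auto
        also have "\<dots> < (C + 1) * (e powr p / (2 * (C + 1)))" using C by (intro mult_strict_left_mono N) auto
        also have "\<dots> = e powr p / 2" using C by (simp add: field_simps)
        finally show ?thesis .
      qed
      finally have "Lp_mass M p (\<lambda>x. w m x - w n x) < e powr p" by simp
      then have "Lp_mass M p (\<lambda>x. w m x - w n x) powr (1/p) < (e powr p) powr (1/p)"
        using p by (intro powr_less_mono2) auto
      then show ?thesis using p \<open>e > 0\<close> by (simp add: Lp_nrm_def powr_powr)
    qed
    then show "\<exists>N. \<forall>m\<ge>N. \<forall>n\<ge>N. Lp_nrm M p (\<lambda>x. w m x - w n x) < e" by blast
  qed
  have mass_lim: "(\<lambda>n. Lp_mass M p (\<lambda>x. w n x + m x)) \<longlonglongrightarrow> Lp_mass M p (\<lambda>x. u x + m x)" if "m \<in> Lp_space M p" for m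
  proof -
    have "(\<lambda>n. Lp_nrm M p (\<lambda>x. w n x + m x)) \<longlonglongrightarrow> Lp_nrm M p (\<lambda>x. u x + m x)"
      by (rule Lp_nrm_tendsto) (use u wL that p1 in \<open>auto intro: Lp_space_add\<close>)
    then have "(\<lambda>n. Lp_nrm M p (\<lambda>x. w n x + m x) powr p) \<longlonglongrightarrow> Lp_nrm M p (\<lambda>x. u x + m x) powr p"
      using p by (intro tendsto_powr' tendsto_const) auto
    then show ?thesis using p by (simp add: Lp_mass_eq_nrm)
  qed
  have u_le: "Lp_mass M p u \<le> d"
  proof (rule LIMSEQ_le)
    show "(\<lambda>n. Lp_mass M p (w n)) \<longlonglongrightarrow> Lp_mass M p u" using mass_lim[OF Lp_space_zero] by simp
    show "(\<lambda>n. d + inverse (real (Suc n))) \<longlonglongrightarrow> d"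
      using tendsto_add[OF tendsto_const LIMSEQ_inverse_real_of_nat] by simp
    show "\<exists>N. \<forall>n\<ge>N. Lp_mass M p (w n) \<le> d + inverse (real (Suc n))"
      using v(2) by (auto simp: w_def[abs_def] less_imp_le)
  qed
  have u_ge: "d \<le> Lp_mass M p (\<lambda>x. u x + m x)" if "m \<in> V" for m
  proof (rule LIMSEQ_le_const)
    have "m \<in> Lp_space M p" using that V by blast
    then show "(\<lambda>n. Lp_mass M p (\<lambda>x. w n x + m x)) \<longlonglongrightarrow> Lp_mass M p (\<lambda>x. u x + m x)" by (rule mass_lim)
    have "d \<le> Lp_mass M p (\<lambda>x. w n x + m x)" for n
      using d_le[OF V_add[OF v(1)[of n] V_cmult[OF that, of "-1"]]] by (simp add: w_def algebra_simps)
    then show "\<exists>N. \<forall>n\<ge>N. d \<le> Lp_mass M p (\<lambda>x. w n x + m x)" by blast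
  qed
  have orth: "(\<integral>x. pdual p (u x) * m x \<partial>M) = 0" if "m \<in> V" for m
  proof (rule Lp_minimizer_orthogonal[OF p u(1)])
    show "m \<in> Lp_space M p" using that V by blast
    show "Lp_mass M p u \<le> Lp_mass M p (\<lambda>x. u x + c * m x)" for c
      using u_le u_ge[OF V_cmult[OF that, of c]] by simp
  qed
  have "Lp_nrm M p u \<ge> e"
  proof (rule LIMSEQ_le_const)
    show "(\<lambda>n. Lp_nrm M p (w n)) \<longlonglongrightarrow> Lp_nrm M p u"
      by (rule Lp_nrm_tendsto[OF wL u(1) p1 u(2)])
    show "\<exists>N. \<forall>n\<ge>N. e \<le> Lp_nrm M p (w n)" using e(2)[OF v(1)] by (auto simp: w_def[abs_def])
  qed
  with e have "Lp_nrm M p u > 0" by simp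
  with u v(1) orth show ?thesis using that[of u v] by (simp add: w_def)
qed

section \<open>Fourier coefficients on the circle\<close>

lemma space_circle_measure [simp]: "space circle_measure = {0..<2*pi}"
  by (simp add: circle_measure_def space_restrict_space)

lemma sets_circle_measure: "A \<in> sets circle_measure \<longleftrightarrow> A \<subseteq> {0..<2*pi} \<and> A \<in> sets borel"
  by (simp add: circle_measure_def sets_restrict_space_iff)

lemma emeasure_circle_measure: "A \<subseteq> {0..<2*pi} \<Longrightarrow> emeasure circle_measure A = emeasure lborel A"
  unfolding circle_measure_def by (intro emeasure_restrict_space) auto

interpretation circle: finite_measure circle_measure
  by standard (simp add: emeasure_circle_measure)

lemma measure_circle_space [simp]: "measure circle_measure {0..<2*pi} = 2 * pi"
  by (simp add: measure_def emeasure_circle_measure)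

lemma borel_imp_circle_measurable [measurable_dest]:
  "f \<in> borel_measurable borel \<Longrightarrow> f \<in> borel_measurable circle_measure"
  unfolding circle_measure_def by (intro measurable_restrict_space1) simp

abbreviation cm :: "real measure" where
  "cm \<equiv> circle_measure"

abbreviation LpT :: "real \<Rightarrow> (real \<Rightarrow> complex) set" where
  "LpT \<equiv> Lp_space cm"

abbreviation nrmT :: "real \<Rightarrow> (real \<Rightarrow> complex) \<Rightarrow> real" where
  "nrmT \<equiv> Lp_nrm cm"

definition ee :: "int \<Rightarrow> real \<Rightarrow> complex" where
  "ee n \<theta> = cis (of_int n * \<theta>)"

lemma continuous_on_ee [continuous_intros]: "continuous_on S (ee n)"
  unfolding ee_def by (intro continuous_intros)

lemma ee_measurable [measurable]: "ee n \<in> borel_measurable cm"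
  by (intro borel_imp_circle_measurable borel_measurable_continuous_onI continuous_on_ee)

lemma norm_ee [simp]: "norm (ee n \<theta>) = 1"
  by (simp add: ee_def)

lemma ee_0 [simp]: "ee 0 \<theta> = 1"
  by (simp add: ee_def)

lemma ee_mult: "ee m \<theta> * ee n \<theta> = ee (m + n) \<theta>"
  by (simp add: ee_def cis_mult algebra_simps)

lemma cnj_ee: "cnj (ee n \<theta>) = ee (- n) \<theta>"
  by (simp add: ee_def cis_cnj)

lemma circle_integral_eq:
  fixes f :: "real \<Rightarrow> complex"
  assumes "continuous_on {0..2*pi} f"
  shows "(\<integral>x. f x \<partial>cm) = integral {0..2*pi} f"
proof -
  have "(\<integral>x. f x \<partial>cm) = (\<integral>x. indicator {0..<2*pi} x *\<^sub>R f x \<partial>lborel)"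
    unfolding circle_measure_def by (rule integral_restrict_space) simp
  also have "\<dots> = (LINT x:{0..2*pi}|lborel. f x)"
    unfolding set_lebesgue_integral_def
  proof (rule integral_cong_AE)
    show "(\<lambda>x. indicator {0..2*pi} x *\<^sub>R f x) \<in> borel_measurable lborel"
      using borel_measurable_continuous_on_indicator[OF _ assms] by simp
    have "continuous_on {0..<2*pi} f" by (rule continuous_on_subset[OF assms]) auto
    then show "(\<lambda>x. indicator {0..<2*pi} x *\<^sub>R f x) \<in> borel_measurable lborel"
      using borel_measurable_continuous_on_indicator[of "{0..<2*pi}" f] by simp
    show "AE x in lborel. indicator {0..<2*pi} x *\<^sub>R f x = indicator {0..2*pi} x *\<^sub>R f x"
      using AE_lborel_singleton[of "2*pi"] by eventually_elim (auto simp: indicator_def)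
  qed
  also have "\<dots> = integral {0..2*pi} f"
    by (intro set_borel_integral_eq_integral borel_integrable_atLeastAtMost' assms)
  finally show ?thesis .
qed

lemma integral_ee: "(\<integral>x. ee n x \<partial>cm) = (if n = 0 then of_real (2*pi) else 0)"
proof (cases "n = 0")
  case True
  then show ?thesis by (simp add: ee_0[abs_def] scaleR_conv_of_real)
next
  case False
  have "(ee n has_integral ee n (2*pi) / (\<i> * of_int n) - ee n 0 / (\<i> * of_int n)) {0..2*pi}"
  proof (rule fundamental_theorem_of_calculus)
    fix x assume "x \<in> {0..2*pi}"
    show "((\<lambda>x. ee n x / (\<i> * of_int n)) has_vector_derivative ee n x) (at x within {0..2*pi})"
    proof -
      have "((\<lambda>z. exp (\<i> * of_int n * z) / (\<i> * of_int n)) has_field_derivative exp (\<i> * of_int n * of_real x)) (at (of_real x))"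
        using False by (auto intro!: derivative_eq_intros)
      from has_vector_derivative_real_field[OF this]
      show ?thesis by (simp add: ee_def cis_conv_exp mult.assoc)
    qed
  qed simp
  moreover have "ee n (2*pi) = 1" "ee n 0 = 1"
    using cis_multiple_2pi[of "of_int n"] by (auto simp: ee_def mult.commute mult.left_commute)
  ultimately show ?thesis using False circle_integral_eq[OF continuous_on_ee, of n]
    by (simp add: integral_unique)
qed

text \<open>The division by \<open>2*pi\<close> is left out so that a coefficient is a plain pairing
  with \<open>ee (- n)\<close>, to which the duality lemmas apply.\<close>

definition fc :: "(real \<Rightarrow> complex) \<Rightarrow> int \<Rightarrow> complex" where
  "fc f n = (\<integral>x. f x * ee (- n) x \<partial>cm)"

lemma fourier_eq_fc: "fourier f n = fc (circ f) n / of_real (2*pi)"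
  by (simp add: fourier_def fc_def circ_def ee_def)

lemma integrable_ee_mult:
  assumes "integrable cm f"
  shows "integrable cm (\<lambda>x. f x * ee n x)"
  using assms by (rule Bochner_Integration.integrable_bound)
    (use assms in \<open>auto simp: norm_mult intro!: borel_measurable_times borel_measurable_integrable\<close>)

lemma integrable_ee [simp]: "integrable cm (ee n)"
  using integrable_ee_mult[of "\<lambda>x. 1" n] by simp

lemma fc_ee: "fc (ee m) n = (if m = n then of_real (2*pi) else 0)"
  by (simp add: fc_def ee_mult integral_ee)

lemma fc_add:
  assumes "integrable cm f" "integrable cm g"
  shows "fc (\<lambda>x. f x + g x) n = fc f n + fc g n"
  using integrable_ee_mult[OF assms(1)] integrable_ee_mult[OF assms(2)] by (simp add: fc_def distrib_right)

lemma fc_diff: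
  assumes "integrable cm f" "integrable cm g"
  shows "fc (\<lambda>x. f x - g x) n = fc f n - fc g n"
  using integrable_ee_mult[OF assms(1)] integrable_ee_mult[OF assms(2)] by (simp add: fc_def left_diff_distrib)

lemma fc_cmult: "fc (\<lambda>x. c * f x) n = c * fc f n"
  by (simp add: fc_def mult.assoc)

lemma fc_zero [simp]: "fc (\<lambda>x. 0) n = 0"
  by (simp add: fc_def)

lemma fc_ee_mult: "fc (\<lambda>x. ee m x * f x) n = fc f (n - m)"
proof -
  have "ee m x * f x * ee (- n) x = f x * ee (- (n - m)) x" for x
  proof -
    have "ee m x * f x * ee (- n) x = f x * (ee m x * ee (- n) x)" by (simp only: ac_simps)
    then show ?thesis by (simp add: ee_mult)
  qed
  then show ?thesis unfolding fc_def by presburger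
qed

lemma fc_cnj: "fc (\<lambda>x. cnj (f x)) n = cnj (fc f (- n))"
proof -
  have "cnj (f x) * ee (- n) x = cnj (f x * ee n x)" for x by (simp add: cnj_ee)
  then show ?thesis by (simp add: fc_def integral_cnj del: complex_cnj_mult)
qed

lemma fc_cong_AE:
  assumes "f \<in> borel_measurable cm" "g \<in> borel_measurable cm"
    "AE x in cm. f x = g x"
  shows "fc f n = fc g n"
proof -
  note [measurable] = assms(1,2)
  show ?thesis unfolding fc_def
    by (rule integral_cong_AE) (use assms(3) in auto)
qed

lemma Lp_integrable_circle:
  assumes f: "f \<in> LpT p" and p: "p \<ge> 1"
  shows "integrable cm f"
proof (rule Bochner_Integration.integrable_bound)
  show "integrable cm (\<lambda>x. 1 + norm (f x) powr p)"
    using Lp_spaceD(2)[OF f] by simp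
  have "norm (f x) \<le> 1 + norm (f x) powr p" for x
  proof (cases "norm (f x) \<le> 1")
    case True then show ?thesis by (smt (verit) powr_ge_zero)
  next
    case False
    then have "norm (f x) powr 1 \<le> norm (f x) powr p" using p by (intro powr_mono) auto
    then show ?thesis using False by simp
  qed
  then show "AE x in cm. norm (f x) \<le> norm (1 + norm (f x) powr p)"
    by (intro AE_I2) (simp add: add_nonneg_nonneg)
qed (use Lp_spaceD[OF f] in auto)

lemma bounded_Lp_space:
  assumes "f \<in> borel_measurable cm" "\<And>x. norm (f x) \<le> B" "p > 0"
  shows "f \<in> LpT p"
proof (rule Lp_space_bound[OF assms(1)])
  show "integrable cm (\<lambda>x. B powr p)" by simp
  show "norm (f x) powr p \<le> B powr p" for x using assms by (intro powr_mono2) auto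
qed

lemma ee_Lp_space [simp]: "p > 0 \<Longrightarrow> ee n \<in> LpT p"
  by (rule bounded_Lp_space[where B = 1]) auto

lemma Lp_ee_mult:
  "f \<in> LpT p \<Longrightarrow> p \<ge> 1 \<Longrightarrow> (\<lambda>x. ee n x * f x) \<in> LpT p"
  by (rule Lp_space_mult_bounded[where B = 1]) auto

lemma fc_tendsto:
  assumes "\<And>n. f n \<in> LpT p" "g \<in> LpT p" and p: "p > 1"
    and "((\<lambda>n. nrmT p (\<lambda>x. f n x - g x)) \<longlongrightarrow> 0) F"
  shows "((\<lambda>n. fc (f n) k) \<longlongrightarrow> fc g k) F"
  unfolding fc_def
  by (rule Lp_pairing_tendsto[OF assms(1,2) ee_Lp_space[of "p / (p - 1)"] p _ _ assms(4)])
    (use p in \<open>auto simp: field_simps\<close>)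

subsection \<open>The reflection of the circle\<close>

text \<open>The map \<open>t \<mapsto> 1/t\<close> in the parameter interval \<open>[0, 2\<pi>)\<close>.\<close>

definition crev :: "real \<Rightarrow> real" where
  "crev \<theta> = (if \<theta> = 0 then 0 else 2*pi - \<theta>)"

lemma cis_crev: "cis (crev \<theta>) = cis (- \<theta>)"
  by (auto simp: crev_def complex_eq_iff cos_diff sin_diff)

lemma ee_crev: "ee n (crev \<theta>) = ee (- n) \<theta>"
proof -
  have "cis (of_int n * (2*pi - \<theta>)) = cis (2*pi * of_int n) * cis (- (of_int n * \<theta>))"
    by (simp add: cis_mult algebra_simps)
  also have "cis (2*pi * of_int n) = 1" by (rule cis_multiple_2pi) simp
  finally show ?thesis by (auto simp: crev_def ee_def)
qed

lemma crev_crev: "\<theta> \<in> {0..<2*pi} \<Longrightarrow> crev (crev \<theta>) = \<theta>"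
  by (auto simp: crev_def)

lemma crev_measurable [measurable]: "crev \<in> measurable cm cm"
proof -
  have "crev \<in> measurable borel borel" unfolding crev_def by measurable
  then have "crev \<in> measurable cm lborel"
    unfolding circle_measure_def by (simp add: measurable_restrict_space1)
  then have "crev \<in> measurable cm (restrict_space lborel {0..<2*pi})"
    by (intro measurable_restrict_space2) (auto simp: crev_def)
  then show ?thesis by (simp add: circle_measure_def)
qed

text \<open>Off the null set of the two endpoints \<open>crev\<close> is the affine map x -> 2 pi -
  x, which preserves \<open>lborel\<close>.\<close>

lemma distr_crev: "distr cm cm crev = cm"
proof (rule measure_eqI)
  fix A assume "A \<in> sets (distr cm cm crev)"
  then have "A \<in> sets cm" by simp
  then have A: "A \<subseteq> {0..<2*pi}" "A \<in> sets borel" by (auto simp: sets_circle_measure)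
  have [measurable]: "crev \<in> measurable borel borel" unfolding crev_def by measurable
  let ?B = "crev -` A \<inter> {0..<2*pi}"
  have B: "?B \<in> sets borel" using A measurable_sets[OF \<open>crev \<in> measurable borel borel\<close> A(2)] by auto
  have "emeasure (distr cm cm crev) A = emeasure lborel ?B"
    using \<open>A \<in> sets cm\<close> by (simp add: emeasure_distr emeasure_circle_measure)
  also have "\<dots> = emeasure lborel ((\<lambda>x. 2*pi + (-1) * x) -` A)"
  proof (rule emeasure_eq_AE)
    show "AE x in lborel. x \<in> ?B \<longleftrightarrow> x \<in> (\<lambda>x. 2*pi + (-1) * x) -` A"
      using AE_lborel_singleton[of 0] AE_lborel_singleton[of "2*pi"]
      by eventually_elim (use A(1) in \<open>auto simp: crev_def subset_eq\<close>)
    show "(\<lambda>x. 2*pi + (-1) * x) -` A \<in> sets lborel"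
      using measurable_sets[of "\<lambda>x. 2*pi + (-1) * x" borel borel A] A by simp
  qed (use B in simp)
  also have "\<dots> = emeasure (distr lborel borel (\<lambda>x. 2*pi + (-1) * x)) A"
    using A by (simp add: emeasure_distr)
  also have "\<dots> = emeasure lborel A"
  proof -
    have "lborel = density (distr lborel borel (\<lambda>x. 2*pi + (-1) * x)) (\<lambda>_. ennreal (abs (-1)))"
      by (rule lborel_real_affine) simp
    also have "\<dots> = distr lborel borel (\<lambda>x. 2*pi + (-1) * x)" by (simp add: density_1)
    finally show ?thesis by simp
  qed
  also have "\<dots> = emeasure cm A" using A by (simp add: emeasure_circle_measure)
  finally show "emeasure (distr cm cm crev) A = emeasure cm A" .
qed simp

lemma integral_crev:
  fixes f :: "real \<Rightarrow> 'a::{banach, second_countable_topology}"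
  assumes "f \<in> borel_measurable cm"
  shows "(\<integral>x. f (crev x) \<partial>cm) = (\<integral>x. f x \<partial>cm)"
  using integral_distr[OF crev_measurable assms] by (simp add: distr_crev)

lemma integrable_crev:
  fixes f :: "real \<Rightarrow> 'a::{banach, second_countable_topology}"
  assumes "integrable cm f"
  shows "integrable cm (\<lambda>x. f (crev x))"
  using integrable_distr[OF crev_measurable, of f] assms by (simp add: distr_crev)

lemma AE_crev:
  assumes "AE x in cm. P x"
  shows "AE x in cm. P (crev x)"
  by (rule AE_distrD[OF crev_measurable]) (simp only: distr_crev assms)

lemma Lp_space_crev:
  assumes "f \<in> LpT p"
  shows "(\<lambda>x. f (crev x)) \<in> LpT p"
  using assms integrable_crev[of "\<lambda>x. norm (f x) powr p"]
  by (auto simp: Lp_space_def intro: measurable_compose[OF crev_measurable])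

lemma Lp_mass_crev:
  assumes "f \<in> borel_measurable cm"
  shows "Lp_mass cm p (\<lambda>x. f (crev x)) = Lp_mass cm p f"
  using assms unfolding Lp_mass_def by (intro integral_crev) auto

lemma fc_crev:
  assumes [measurable]: "f \<in> borel_measurable cm"
  shows "fc (\<lambda>x. f (crev x)) n = fc f (- n)"
proof -
  have "fc f (- n) = (\<integral>x. f (crev x) * ee (- (- n)) (crev x) \<partial>cm)"
    unfolding fc_def by (rule integral_crev[symmetric]) measurable
  then show ?thesis by (simp add: fc_def ee_crev)
qed

subsection \<open>Uniqueness of Fourier coefficients\<close>

text \<open>The sets where s g is positive, for s = 1 and s = -1, are enough.\<close>

lemma AE_zero_if_set_integrals_zero:
  fixes g :: "'a \<Rightarrow> real"
  assumes g: "integrable M g" and z: "\<And>A. A \<in> sets M \<Longrightarrow> (\<integral>x. indicator A x * g x \<partial>M) = 0"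
  shows "AE x in M. g x = 0"
proof -
  have nonpos: "AE x in M. s * g x \<le> 0" for s :: real
  proof -
    define A where "A = {x \<in> space M. s * g x > 0}"
    have A: "A \<in> sets M" unfolding A_def using g by measurable
    have "integrable M (\<lambda>x. s * (indicator A x * g x))"
      using integrable_mult_indicator[OF A g] by simp
    moreover have "(\<integral>x. s * (indicator A x * g x) \<partial>M) = 0" using z[OF A] by simp
    moreover have "AE x in M. 0 \<le> s * (indicator A x * g x)"
      by (rule AE_I2) (auto simp: A_def indicator_def)
    ultimately have "AE x in M. s * (indicator A x * g x) = 0"
      using integral_nonneg_eq_0_iff_AE by blast
    then show ?thesis
      by (rule AE_mp) (rule AE_I2, auto simp: A_def indicator_def)
  qed
  from nonpos[of 1] nonpos[of "-1"] show ?thesis by eventually_elim simp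
qed

text \<open>Induction over the Stone-Weierstrass class. \<open>f\<close> stays arbitrary because the
  product case applies the hypothesis for \<open>h2\<close> to f times \<open>h1\<close>.\<close>

lemma fc_zero_mult_real_polynomial:
  assumes "real_polynomial_function (h :: complex \<Rightarrow> real)" "integrable cm f" "\<And>n. fc f n = 0"
  shows "integrable cm (\<lambda>x. f x * of_real (h (cis x)))
    \<and> (\<forall>n. fc (\<lambda>x. f x * of_real (h (cis x))) n = 0)"
  using assms
proof (induction arbitrary: f rule: real_polynomial_function.induct)
  case (linear h)
  \<comment> \<open>On the circle a real-linear function is a combination of cos and sin, hence of
    \<open>ee 1\<close> and \<open>ee (-1)\<close>, and multiplication by these only shifts
    coefficients.\<close>
  have eq: "f x * of_real (h (cis x)) = (of_real (h 1) / 2 + of_real (h \<i>) / (2 * \<i>)) * (ee 1 x * f x)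
      + (of_real (h 1) / 2 - of_real (h \<i>) / (2 * \<i>)) * (ee (-1) x * f x)" for x
  proof -
    have "cis x = cos x *\<^sub>R 1 + sin x *\<^sub>R \<i>" by (simp add: complex_eq_iff)
    then have "h (cis x) = cos x * h 1 + sin x * h \<i>"
      by (simp only: bounded_linear.axioms(1)[OF linear(1), THEN linear_add]
          bounded_linear.axioms(1)[OF linear(1), THEN linear_scale] real_scaleR_def)
    then have hc: "complex_of_real (h (cis x)) = of_real (cos x) * of_real (h 1) + of_real (sin x) * of_real (h \<i>)"
      by simp
    have cs: "complex_of_real (cos x) = (ee 1 x + ee (-1) x) / 2" "complex_of_real (sin x) = (ee 1 x - ee (-1) x) / (2 * \<i>)"
      by (auto simp: ee_def complex_eq_iff Re_divide Im_divide)
    have "of_real (h (cis x)) = (of_real (h 1) / 2 + of_real (h \<i>) / (2 * \<i>)) * ee 1 x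
      + (of_real (h 1) / 2 - of_real (h \<i>) / (2 * \<i>)) * ee (-1) x"
      unfolding hc cs by (simp add: algebra_simps add_divide_distrib diff_divide_distrib)
    then show ?thesis by (simp only:) (simp only: algebra_simps)
  qed
  have i: "integrable cm (\<lambda>x. c * (ee k x * f x))" for c k
    using integrable_ee_mult[OF linear(2), of k] by (simp add: mult.commute)
  show ?case unfolding eq
    using linear(3) i by (auto simp: fc_add fc_cmult fc_ee_mult)
next
  case (const c)
  then show ?case using fc_cmult[of "of_real c" f] by (auto simp: mult.commute)
next
  case (add h1 h2)
  then show ?case using add.IH(1)[OF add.prems] add.IH(2)[OF add.prems]
    by (auto simp: distrib_left fc_add)
next
  case (mult h1 h2)
  show ?case using mult.IH(2)[of "\<lambda>x. f x * of_real (h1 (cis x))"] mult.IH(1)[OF mult.prems]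
    by (simp add: mult.assoc)
qed

text \<open>Weierstrass approximation on the unit circle by polynomials of the preceding lemma; the
  error is at most \<open>d\<close> times the L^1 norm of \<open>f\<close>.\<close>

lemma integral_zero_continuous:
  assumes f: "integrable cm f" "\<And>n. fc f n = 0" and h: "continuous_on UNIV (h :: complex \<Rightarrow> real)"
  shows "(\<integral>x. f x * of_real (h (cis x)) \<partial>cm) = 0"
proof -
  have hb: "(\<lambda>x. h (cis x)) \<in> borel_measurable borel"
    by (intro borel_measurable_continuous_onI continuous_on_compose2[OF h] continuous_intros) auto
  have [measurable]: "(\<lambda>x. h (cis x)) \<in> borel_measurable cm" "f \<in> borel_measurable cm"
    using hb f by auto
  define I where "I = (\<integral>x. norm (f x) \<partial>cm)"
  have I0: "I \<ge> 0" by (simp add: I_def)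
  have "norm (\<integral>x. f x * of_real (h (cis x)) \<partial>cm) \<le> e" if "e > 0" for e
  proof -
    define d where "d = e / (I + 1)"
    have d: "d > 0" using that I0 by (simp add: d_def)
    obtain g where g: "real_polynomial_function g" "\<And>z. z \<in> sphere 0 1 \<Longrightarrow> \<bar>h z - g z\<bar> < d"
      using Stone_Weierstrass_real_polynomial_function[OF compact_sphere continuous_on_subset[OF h] d, of 0 1]
      by blast
    note gi = fc_zero_mult_real_polynomial[OF g(1) f]
    have bd: "norm (f x * of_real (h (cis x) - g (cis x))) \<le> d * norm (f x)" for x
      using mult_right_mono[OF less_imp_le[OF g(2)[of "cis x"]], of "norm (f x)"]
      by (simp add: norm_mult mult.commute flip: of_real_diff)
    have dfm: "(\<lambda>x. f x * of_real (h (cis x) - g (cis x))) \<in> borel_measurable cm"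
    proof -
      have "(\<lambda>x. f x * of_real (h (cis x)) - f x * of_real (g (cis x))) \<in> borel_measurable cm"
        using gi by (intro borel_measurable_diff) auto
      then show ?thesis by (simp add: right_diff_distrib)
    qed
    have idf: "integrable cm (\<lambda>x. f x * of_real (h (cis x) - g (cis x)))"
      by (rule Bochner_Integration.integrable_bound[OF integrable_mult_right[OF integrable_norm[OF f(1)], of d] dfm])
        (use bd d in auto)
    have "fc (\<lambda>x. f x * of_real (g (cis x))) 0 = 0" using gi by blast
    then have g0: "(\<integral>x. f x * of_real (g (cis x)) \<partial>cm) = 0" by (simp add: fc_def)
    have "(\<integral>x. f x * of_real (h (cis x)) \<partial>cm)
      = (\<integral>x. f x * of_real (h (cis x) - g (cis x)) + f x * of_real (g (cis x)) \<partial>cm)"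
      by (simp add: algebra_simps)
    also have "\<dots> = (\<integral>x. f x * of_real (h (cis x) - g (cis x)) \<partial>cm)"
      using idf gi g0 by (subst Bochner_Integration.integral_add) auto
    also have "norm \<dots> \<le> (\<integral>x. norm (f x * of_real (h (cis x) - g (cis x))) \<partial>cm)"
      by (rule integral_norm_bound)
    also have "\<dots> \<le> (\<integral>x. d * norm (f x) \<partial>cm)"
      using idf f(1) bd by (intro integral_mono) auto
    also have "\<dots> = d * I" by (simp add: I_def)
    also have "\<dots> \<le> d * (I + 1)" using d by simp
    also have "\<dots> = e" using I0 by (simp add: d_def)
    finally show ?thesis .
  qed
  then have "norm (\<integral>x. f x * of_real (h (cis x)) \<partial>cm) \<le> 0"
    by (rule field_le_epsilon) simp
  then show ?thesis by simp
qed

lemma integral_zero_open: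
  assumes f: "integrable cm f" "\<And>n. fc f n = 0" and U: "open (U :: complex set)"
  shows "(\<integral>x. f x * of_real (indicator U (cis x)) \<partial>cm) = 0"
\<comment> \<open>The distance \<open>infdist\<close> to the empty set is 0 by convention, so the
  approximants below would vanish when \<open>U\<close> is the whole plane.\<close>
proof (cases "U = UNIV")
  case True
  then show ?thesis using f(2)[of 0] by (simp add: fc_def)
next
  case False
  \<comment> \<open>Continuous functions that increase to the indicator of the open set
    \<open>U\<close>.\<close>
  define g where "g n z = min 1 (real n * infdist z (- U))" for n and z :: complex
  have gc: "continuous_on UNIV (g n)" for n unfolding g_def by (intro continuous_intros)
  have cb: "(cis :: real \<Rightarrow> complex) \<in> borel_measurable borel"
    by (intro borel_measurable_continuous_onI continuous_intros)
  have [measurable]: "f \<in> borel_measurable cm" using f by auto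
  have m1: "(\<lambda>x. g n (cis x)) \<in> borel_measurable cm" for n
    by (intro borel_imp_circle_measurable borel_measurable_continuous_onI continuous_on_compose2[OF gc] continuous_intros) auto
  have m2: "(\<lambda>x. indicator U (cis x) :: real) \<in> borel_measurable cm"
    by (intro borel_imp_circle_measurable measurable_compose[OF cb] borel_measurable_indicator) (use U in auto)
  note [measurable] = m1 m2
  have lim: "(\<lambda>n. g n z) \<longlonglongrightarrow> indicator U z" for z
  proof (cases "z \<in> U")
    case True
    have "infdist z (- U) > 0"
      using True U False in_closed_iff_infdist_zero[of "- U" z] infdist_nonneg[of z "- U"] by fastforce
    then obtain N where N: "1 < real N * infdist z (- U)"
      using reals_Archimedean3 by blast
    have "g n z = 1" if "n \<ge> N" for n
    proof -
      have "real N * infdist z (- U) \<le> real n * infdist z (- U)" using that by (intro mult_right_mono infdist_nonneg) auto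
      then show ?thesis using N by (simp add: g_def)
    qed
    then have "\<forall>\<^sub>F n in sequentially. g n z = 1" by (auto simp: eventually_sequentially)
    then show ?thesis using True by (simp add: tendsto_eventually)
  next
    case False
    then have "g n z = 0" for n by (simp add: g_def)
    then show ?thesis using False by simp
  qed
  have "(\<lambda>n. \<integral>x. f x * of_real (g n (cis x)) \<partial>cm) \<longlonglongrightarrow> (\<integral>x. f x * of_real (indicator U (cis x)) \<partial>cm)"
  proof (rule integral_dominated_convergence)
    show "integrable cm (\<lambda>x. norm (f x))" using f by simp
    show "AE x in cm. (\<lambda>n. f x * of_real (g n (cis x))) \<longlonglongrightarrow> f x * of_real (indicator U (cis x))"
      by (intro AE_I2 tendsto_intros lim)
    show "AE x in cm. norm (f x * of_real (g n (cis x))) \<le> norm (f x)" for n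
    proof (rule AE_I2)
      fix x
      have "\<bar>g n (cis x)\<bar> \<le> 1" by (simp add: g_def infdist_nonneg)
      then show "norm (f x * of_real (g n (cis x))) \<le> norm (f x)"
        by (simp add: norm_mult mult_left_le)
    qed
  qed measurable
  moreover have "(\<integral>x. f x * of_real (g n (cis x)) \<partial>cm) = 0" for n
    by (rule integral_zero_continuous[OF f gc])
  ultimately show ?thesis by (simp add: LIMSEQ_const_iff)
qed

lemma Arg2pi_cis: "0 \<le> x \<Longrightarrow> x < 2*pi \<Longrightarrow> Arg2pi (cis x) = x"
  by (rule Arg2pi_unique[of 1]) (auto simp: cis_conv_exp)

text \<open>The integral of \<open>f\<close> vanishes over preimages of open sets, hence over
  intervals, hence by the pi-lambda theorem over all Borel sets. Plain integrability suffices, which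
  matters for the product formed in \<open>annihilator_of_range\<close>.\<close>

theorem fourier_uniqueness:
  assumes f: "integrable cm f" "\<And>n. fc f n = 0"
  shows "AE x in cm. f x = 0"
proof -
  have fm[measurable]: "f \<in> borel_measurable cm" using f by auto
  have box: "(\<integral>x. indicator {a<..<b} x *\<^sub>R f x \<partial>cm) = 0" for a b
  proof -
    \<comment> \<open>\<open>Arg2pi\<close> is continuous only off the nonnegative real axis; the
      single parameter 0 lost through this slit is a null set.\<close>
    define U where "U = {z \<in> - \<real>\<^sub>\<ge>\<^sub>0. Arg2pi z \<in> {a<..<b}}"
    have "continuous_on (- \<real>\<^sub>\<ge>\<^sub>0) Arg2pi"
      using continuous_at_Arg2pi by (intro continuous_at_imp_continuous_on) auto
    moreover have "open (- \<real>\<^sub>\<ge>\<^sub>0 :: complex set)" using closed_nonneg_Reals_complex by auto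
    ultimately have U: "open U"
      using continuous_open_preimage[of "- \<real>\<^sub>\<ge>\<^sub>0" Arg2pi "{a<..<b}"]
      by (simp add: U_def vimage_def Int_def conj_commute)
    have cb: "(cis :: real \<Rightarrow> complex) \<in> borel_measurable borel"
      by (intro borel_measurable_continuous_onI continuous_intros)
    have [measurable]: "(\<lambda>x. indicator U (cis x) :: real) \<in> borel_measurable cm"
      by (intro borel_imp_circle_measurable measurable_compose[OF cb] borel_measurable_indicator) (use U in auto)
    have "(\<integral>x. indicator {a<..<b} x *\<^sub>R f x \<partial>cm) = (\<integral>x. f x * of_real (indicator U (cis x)) \<partial>cm)"
    proof (rule integral_cong_AE)
      show "(\<lambda>x. indicator {a<..<b} x *\<^sub>R f x) \<in> borel_measurable cm"
        by (intro borel_measurable_scaleR fm borel_imp_circle_measurable borel_measurable_indicator) auto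
      have "AE x in cm. x \<noteq> 0"
        unfolding circle_measure_def by (subst AE_restrict_space_iff) (use AE_lborel_singleton[of "0::real"] in auto)
      moreover have "AE x in cm. x \<in> {0..<2*pi}" by (rule AE_I2) simp
      ultimately show "AE x in cm. indicator {a<..<b} x *\<^sub>R f x = f x * of_real (indicator U (cis x))"
      proof eventually_elim
        case (elim x)
        then have A: "Arg2pi (cis x) = x" by (intro Arg2pi_cis) auto
        then have "cis x \<notin> \<real>\<^sub>\<ge>\<^sub>0" using elim Arg2pi_eq_0[of "cis x"]
          by (auto simp: complex_nonneg_Reals_iff complex_is_Real_iff)
        then show ?case using A by (auto simp: U_def indicator_def)
      qed
    qed measurable
    also have "\<dots> = 0" by (rule integral_zero_open[OF f U])
    finally show ?thesis .
  qed
  have borel: "(\<integral>x. indicator B x *\<^sub>R f x \<partial>cm) = 0" if "B \<in> sets borel" for B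
  proof -
    have G: "Int_stable (range (\<lambda>(a, b). {a<..<b :: real}))"
    proof (rule Int_stableI)
      fix X Y assume "X \<in> range (\<lambda>(a, b). {a<..<b :: real})" "Y \<in> range (\<lambda>(a, b). {a<..<b :: real})"
      then obtain a b c d where "X = {a<..<b}" "Y = {c<..<d}" by auto
      then have "X \<inter> Y = {max a c<..<min b d}" by auto
      then show "X \<inter> Y \<in> range (\<lambda>(a, b). {a<..<b :: real})" by auto
    qed
    have im: "integrable cm (\<lambda>x. indicator A x *\<^sub>R f x)" if "A \<in> sets borel" for A
    proof (rule Bochner_Integration.integrable_bound[OF f(1)])
      show "(\<lambda>x. indicator A x *\<^sub>R f x) \<in> borel_measurable cm"
        using that by (intro borel_measurable_scaleR fm borel_imp_circle_measurable borel_measurable_indicator)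
    qed (auto simp: indicator_def)
    have sb: "sets borel = sigma_sets UNIV (range (\<lambda>(a, b). {a<..<b :: real}))"
    proof -
      have e: "(\<lambda>(a, b). {a<..<b :: real}) = (\<lambda>(a, b). box a b)" by (auto simp: box_real)
      show ?thesis unfolding e using arg_cong[OF borel_eq_box, of sets] by simp
    qed
    have cl: "range (\<lambda>(a, b). {a<..<b :: real}) \<subseteq> Pow UNIV" by simp
    have "B \<in> sigma_sets UNIV (range (\<lambda>(a, b). {a<..<b :: real}))" using that by (simp add: sb)
    from G cl this show ?thesis
    proof (induction rule: sigma_sets_induct_disjoint)
      case (basic A) then show ?case using box by auto
    next
      case empty then show ?case by simp
    next
      case (compl A)
      then have "A \<in> sets borel" by (simp add: sb)
      have "(\<integral>x. indicator (UNIV - A) x *\<^sub>R f x \<partial>cm) = (\<integral>x. f x - indicator A x *\<^sub>R f x \<partial>cm)"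
        by (intro Bochner_Integration.integral_cong) (auto simp: indicator_def)
      also have "\<dots> = (\<integral>x. f x \<partial>cm) - 0"
        using im[OF \<open>A \<in> sets borel\<close>] f compl by (subst Bochner_Integration.integral_diff) auto
      finally show ?case using f(2)[of 0] by (simp add: fc_def)
    next
      case (union A)
      have Ab: "A i \<in> sets borel" for i using union(2) by (auto simp: sb)
      have ind: "indicator (A i \<inter> {0..<2*pi}) x = (indicator (A i) x :: real)"
        if "x \<in> {0..<2*pi}" for x i using that by (auto simp: indicator_def)
      have "(LINT x:(\<Union>i. A i \<inter> {0..<2*pi})|cm. f x) = (\<Sum>i. (LINT x:(A i \<inter> {0..<2*pi})|cm. f x))"
      proof (rule lebesgue_integral_countable_add)
        show S: "A i \<inter> {0..<2*pi} \<in> sets cm" for i using Ab by (auto simp: sets_circle_measure)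
        show "A i \<inter> {0..<2*pi} \<inter> (A j \<inter> {0..<2*pi}) = {}" if "i \<noteq> j" for i j
          using union(1) that by (auto simp: disjoint_family_on_def)
        show "set_integrable cm (\<Union>i. A i \<inter> {0..<2*pi}) f"
          unfolding set_integrable_def using S by (intro integrable_mult_indicator f sets.countable_UN) auto
      qed
      also have "\<dots> = (\<Sum>i. \<integral>x. indicator (A i) x *\<^sub>R f x \<partial>cm)"
        unfolding set_lebesgue_integral_def
        by (intro suminf_cong Bochner_Integration.integral_cong) (auto simp: ind)
      also have "\<dots> = 0" using union(3) by simp
      also have "(LINT x:(\<Union>i. A i \<inter> {0..<2*pi})|cm. f x) = (\<integral>x. indicator (\<Union>i. A i) x *\<^sub>R f x \<partial>cm)"
        unfolding set_lebesgue_integral_def by (intro Bochner_Integration.integral_cong) (auto simp: indicator_def)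
      finally show ?case .
    qed
  qed
  have si: "integrable cm (\<lambda>x. indicator A x *\<^sub>R f x)" "(\<integral>x. indicator A x *\<^sub>R f x \<partial>cm) = 0"
    if "A \<in> sets cm" for A
    using that integrable_mult_indicator[OF that f(1)] borel[of A] by (auto simp: sets_circle_measure)
  have "AE x in cm. Re (f x) = 0"
  proof (rule AE_zero_if_set_integrals_zero)
    fix A assume A: "A \<in> sets cm"
    show "(\<integral>x. indicator A x * Re (f x) \<partial>cm) = 0"
      using integral_Re[OF si(1)[OF A]] si(2)[OF A] by simp
  qed (use f in auto)
  moreover have "AE x in cm. Im (f x) = 0"
  proof (rule AE_zero_if_set_integrals_zero)
    fix A assume A: "A \<in> sets cm"
    show "(\<integral>x. indicator A x * Im (f x) \<partial>cm) = 0"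
      using integral_Im[OF si(1)[OF A]] si(2)[OF A] by simp
  qed (use f in auto)
  ultimately show ?thesis by eventually_elim (simp add: complex_eq_iff)
qed

corollary fourier_uniqueness_eq:
  assumes "integrable cm f" "integrable cm g" "\<And>n. fc f n = fc g n"
  shows "AE x in cm. f x = g x"
  using fourier_uniqueness[of "\<lambda>x. f x - g x"] assms by (simp add: fc_diff)

section \<open>Trigonometric polynomials\<close>

text \<open>The inductive form gives closure under products, conjugation and reflection without
  index bookkeeping; \<open>trig_expansion\<close> recovers the finite sum.\<close>

inductive_set trig :: "(real \<Rightarrow> complex) set" where
  ee: "ee n \<in> trig"
| cmult: "f \<in> trig \<Longrightarrow> (\<lambda>x. c * f x) \<in> trig"
| add: "f \<in> trig \<Longrightarrow> g \<in> trig \<Longrightarrow> (\<lambda>x. f x + g x) \<in> trig"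

lemma trig_const: "(\<lambda>x. c) \<in> trig"
  using trig.cmult[OF trig.ee[of 0], of c] by simp

lemma trig_diff: "f \<in> trig \<Longrightarrow> g \<in> trig \<Longrightarrow> (\<lambda>x. f x - g x) \<in> trig"
  using trig.add[OF _ trig.cmult[of g "-1"]] by simp

lemma trig_mult:
  assumes "f \<in> trig" "g \<in> trig"
  shows "(\<lambda>x. f x * g x) \<in> trig"
  using assms(1)
proof (induction rule: trig.induct)
  case (ee n)
  show ?case using assms(2)
  proof (induction rule: trig.induct)
    case (ee m) then show ?case by (simp add: ee_mult trig.ee)
  next
    case (cmult g c) then show ?case using trig.cmult[OF cmult.IH, of c] by (simp add: mult.left_commute)
  next
    case (add g h) then show ?case using trig.add[OF add.IH] by (simp add: distrib_left)
  qed
next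
  case (cmult f c) then show ?case using trig.cmult[OF cmult.IH, of c] by (simp add: mult.assoc)
next
  case (add f h) then show ?case using trig.add[OF add.IH] by (simp add: distrib_right)
qed

lemma trig_cnj: "f \<in> trig \<Longrightarrow> (\<lambda>x. cnj (f x)) \<in> trig"
  by (induction rule: trig.induct) (auto simp: cnj_ee intro: trig.intros)

lemma trig_crev: "f \<in> trig \<Longrightarrow> (\<lambda>x. f (crev x)) \<in> trig"
  by (induction rule: trig.induct) (auto simp: ee_crev intro: trig.intros)

lemma trig_Lp_space: "f \<in> trig \<Longrightarrow> p \<ge> 1 \<Longrightarrow> f \<in> LpT p"
  by (induction rule: trig.induct) (auto intro: Lp_space_add Lp_space_cmult)

lemma trig_integrable: "f \<in> trig \<Longrightarrow> integrable cm f"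
  using Lp_integrable_circle[OF trig_Lp_space[of f 1]] by simp

lemma trig_measurable: "f \<in> trig \<Longrightarrow> f \<in> borel_measurable cm"
  by (intro borel_measurable_integrable trig_integrable)

lemma trig_expansion:
  assumes "f \<in> trig"
  shows "\<exists>S. finite S \<and> (\<forall>x. f x = (\<Sum>n\<in>S. fc f n / of_real (2*pi) * ee n x)) \<and> (\<forall>n. n \<notin> S \<longrightarrow> fc f n = 0)"
  using assms
proof (induction rule: trig.induct)
  case (ee n)
  show ?case by (rule exI[of _ "{n}"]) (auto simp: fc_ee)
next
  case (cmult f c)
  then obtain S where S: "finite S" "\<forall>x. f x = (\<Sum>n\<in>S. fc f n / of_real (2*pi) * ee n x)" "\<forall>n. n \<notin> S \<longrightarrow> fc f n = 0"
    by blast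
  have "c * f x = (\<Sum>n\<in>S. c * fc f n / of_real (2*pi) * ee n x)" for x
    by (subst S(2)[rule_format]) (simp add: sum_distrib_left mult.assoc)
  then show ?case unfolding fc_cmult using S(1,3) by (intro exI[of _ S]) auto
next
  case (add f g)
  then obtain S T where S: "finite S" "\<forall>x. f x = (\<Sum>n\<in>S. fc f n / of_real (2*pi) * ee n x)" "\<forall>n. n \<notin> S \<longrightarrow> fc f n = 0"
    and T: "finite T" "\<forall>x. g x = (\<Sum>n\<in>T. fc g n / of_real (2*pi) * ee n x)" "\<forall>n. n \<notin> T \<longrightarrow> fc g n = 0"
    by blast
  have f: "f x = (\<Sum>n\<in>S\<union>T. fc f n / of_real (2*pi) * ee n x)" for x
    by (rule trans[OF S(2)[rule_format] sum.mono_neutral_left]) (use S T in auto)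
  have g: "g x = (\<Sum>n\<in>S\<union>T. fc g n / of_real (2*pi) * ee n x)" for x
    by (rule trans[OF T(2)[rule_format] sum.mono_neutral_left]) (use S T in auto)
  have fg: "fc (\<lambda>x. f x + g x) n = fc f n + fc g n" for n
    using add by (intro fc_add trig_integrable)
  have "f x + g x = (\<Sum>n\<in>S\<union>T. (fc f n + fc g n) / of_real (2*pi) * ee n x)" for x
    by (subst f, subst g) (simp add: add_divide_distrib distrib_right sum.distrib)
  then show ?case unfolding fg using S(1,3) T(1,3) by (intro exI[of _ "S \<union> T"]) auto
qed

text \<open>Parseval's identity with a polynomial factor. \<open>S\<close> may be any finite set
  outside which the coefficients of \<open>f\<close> vanish, so one index set can be kept while
  \<open>h\<close> varies.\<close>

lemma trig_pairing:
  assumes f: "f \<in> trig" and h: "integrable cm h" and S: "finite S" "\<And>n. n \<notin> S \<Longrightarrow> fc f n = 0"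
  shows "(\<integral>x. f x * h x \<partial>cm) = (\<Sum>n\<in>S. fc f n * fc h (- n) / of_real (2*pi))"
proof -
  obtain T where T: "finite T" "\<And>x. f x = (\<Sum>n\<in>T. fc f n / of_real (2*pi) * ee n x)" "\<And>n. n \<notin> T \<Longrightarrow> fc f n = 0"
    using trig_expansion[OF f] by blast
  have "f x * h x = (\<Sum>n\<in>T. fc f n / of_real (2*pi) * (h x * ee n x))" for x
    by (subst T(2)) (simp add: sum_distrib_left sum_distrib_right ac_simps)
  then have "(\<integral>x. f x * h x \<partial>cm) = (\<Sum>n\<in>T. fc f n / of_real (2*pi) * (\<integral>x. h x * ee n x \<partial>cm))"
    using integrable_ee_mult[OF h] by simp
  also have "\<dots> = (\<Sum>n\<in>T. fc f n * fc h (- n) / of_real (2*pi))" by (simp add: fc_def)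
  also have "\<dots> = (\<Sum>n\<in>S. fc f n * fc h (- n) / of_real (2*pi))"
    using S T by (intro sum.mono_neutral_cong) auto
  finally show ?thesis .
qed

lemma trig_pairing_zero:
  assumes f: "f \<in> trig" and h: "integrable cm h" and z: "\<And>n. fc f n = 0 \<or> fc h (- n) = 0"
  shows "(\<integral>x. f x * h x \<partial>cm) = 0"
proof -
  obtain T where T: "finite T" "\<And>n. n \<notin> T \<Longrightarrow> fc f n = 0"
    using trig_expansion[OF f] by blast
  have "fc f n * fc h (- n) = 0" for n using z[of n] by auto
  then have "(\<Sum>n\<in>T. fc f n * fc h (- n) / of_real (2*pi)) = 0" by (intro sum.neutral) simp
  with trig_pairing[OF f h T] show ?thesis by (rule trans)
qed

text \<open>A relation between coefficients: it determines an integrable \<open>g\<close> up to null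
  sets and is usable before any projection in L^p is known to exist.\<close>

definition is_riesz :: "(real \<Rightarrow> complex) \<Rightarrow> (real \<Rightarrow> complex) \<Rightarrow> bool" where
  "is_riesz f g \<longleftrightarrow> (\<forall>n. fc g n = (if 0 \<le> n then fc f n else 0))"

lemma trig_riesz:
  assumes "f \<in> trig"
  obtains g where "g \<in> trig" "is_riesz f g"
proof -
  have "\<exists>g\<in>trig. is_riesz f g" using assms
  proof (induction rule: trig.induct)
    case (ee n)
    show ?case
    proof (cases "n \<ge> 0")
      case True
      then show ?thesis by (intro bexI[of _ "ee n"] trig.ee) (auto simp: is_riesz_def fc_ee)
    next
      case False
      then show ?thesis by (intro bexI[of _ "\<lambda>x. 0"] trig_const) (auto simp: is_riesz_def fc_ee)
    qed
  next
    case (cmult f c)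
    then obtain g where "g \<in> trig" "is_riesz f g" by blast
    then show ?case by (intro bexI[of _ "\<lambda>x. c * g x"] trig.cmult) (auto simp: is_riesz_def fc_cmult)
  next
    case (add f1 f2)
    then obtain g1 g2 where "g1 \<in> trig" "is_riesz f1 g1" "g2 \<in> trig" "is_riesz f2 g2" by blast
    then show ?case using add
      by (intro bexI[of _ "\<lambda>x. g1 x + g2 x"] trig.add) (auto simp: is_riesz_def fc_add trig_integrable)
  qed
  then show ?thesis using that by blast
qed

text \<open>If density failed, the dual function of the approximation error would be orthogonal to
  every \<open>ee n\<close>, and Fourier uniqueness would make the error zero.\<close>

theorem trig_dense:
  assumes p: "p > 1" and g: "g \<in> LpT p"
  obtains h where "\<And>n::nat. h n \<in> trig" "(\<lambda>n. nrmT p (\<lambda>x. h n x - g x)) \<longlonglongrightarrow> 0"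
proof -
  define q where "q = p / (p - 1)"
  have q: "q > 1" "1/p + 1/q = 1" using p by (auto simp: q_def field_simps)
  have close: "\<exists>v\<in>trig. nrmT p (\<lambda>x. g x - v x) < e" if e: "e > 0" for e
  proof (rule ccontr)
    assume "\<not> ?thesis"
    then have far: "nrmT p (\<lambda>x. g x - v x) \<ge> e" if "v \<in> trig" for v using that by force
    have sub: "trig \<subseteq> LpT p" using trig_Lp_space p by auto
    obtain u v where uv: "u \<in> LpT p" "\<forall>n. v n \<in> trig"
        "(\<lambda>n. nrmT p (\<lambda>x. g x - v n x - u x)) \<longlonglongrightarrow> 0" "nrmT p u > 0"
        "\<forall>m\<in>trig. (\<integral>x. pdual p (u x) * m x \<partial>cm) = 0"
      by (rule Lp_best_approximation[OF p sub trig_const trig.add trig.cmult g e far])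
    note u = uv(1,4,5)
    have "(\<lambda>x. pdual p (u x)) \<in> LpT q" by (rule pdual_Lp_space[OF u(1) p q(2)])
    then have "integrable cm (\<lambda>x. pdual p (u x))" using q by (intro Lp_integrable_circle) auto
    then have "AE x in cm. pdual p (u x) = 0"
      using u(3) trig.ee by (intro fourier_uniqueness) (auto simp: fc_def)
    then have "AE x in cm. u x = 0"
      by eventually_elim (auto simp: pdual_def)
    then show False using u Lp_nrm_eq_0_iff by force
  qed
  have "\<forall>n. \<exists>v\<in>trig. nrmT p (\<lambda>x. g x - v x) < inverse (real (Suc n))" using close by simp
  then obtain h where h: "\<And>n. h n \<in> trig" "\<And>n. nrmT p (\<lambda>x. g x - h n x) < inverse (real (Suc n))"
    by metis
  have "(\<lambda>n. nrmT p (\<lambda>x. h n x - g x)) \<longlonglongrightarrow> 0"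
  proof (rule Lim_null_comparison[OF always_eventually LIMSEQ_inverse_real_of_nat])
    show "\<forall>n. norm (nrmT p (\<lambda>x. h n x - g x)) \<le> inverse (real (Suc n))"
      using h(2) by (auto simp: Lp_nrm_minus_commute[of _ _ "h _"] less_imp_le)
  qed
  with h(1) show ?thesis using that by blast
qed

section \<open>The theorem of M. Riesz\<close>

text \<open>In polar coordinates the claim reads 1 <= \<alpha> cos^p t - \<beta> cos (p t) for |t| <
  pi/2. Away from the imaginary axis cos t is bounded below; near it cos (p t) is negative, since
  pi/2 < p pi/2 <= pi. This is where p <= 2 enters; larger exponents follow by duality.\<close>

lemma powr_real_part_bound:
  fixes p :: real
  assumes p: "1 < p" "p \<le> 2"
  obtains \<alpha> \<beta> where "\<alpha> \<ge> 0" "\<beta> \<ge> 0"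
    "\<And>z::complex. Re z > 0 \<Longrightarrow> norm z powr p \<le> \<alpha> * Re z powr p - \<beta> * Re (z powr of_real p)"
proof -
  \<comment> \<open>Makes \<open>p * t0\<close> the midpoint of pi/2 and p pi/2, so that cos (p t)
    <= -c < 0 for t from \<open>t0\<close> up to pi/2.\<close>
  define t0 where "t0 = pi / 4 * (1 / p + 1)"
  have "1 / p < 1" "1 / p > 0" using p by auto
  then have "pi / 4 * (1 / p + 1) < pi / 4 * 2" "pi / 4 * (1 / p + 1) > 0"
    by (intro mult_strict_left_mono mult_pos_pos add_pos_pos; simp)+
  then have t0: "0 < t0" "t0 < pi / 2" "p * t0 = pi / 4 * (1 + p)"
    using p by (auto simp: t0_def field_simps)
  define c where "c = - cos (p * t0)"
  have "pi / 2 < p * t0" "p * t0 < pi" using p unfolding t0(3) by (simp_all add: field_simps)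
  then have c: "c > 0" using cos_lt_zero_pi by (simp add: c_def)
  define s where "s = cos t0"
  have s: "s > 0" unfolding s_def using t0 by (intro cos_gt_zero) auto
  \<comment> \<open>Gives \<alpha> cos^p t >= 1 + 1/c below \<open>t0\<close>, enough to absorb
    (1/c) cos (p t); the constant \<beta> will be 1/c.\<close>
  define \<alpha> where "\<alpha> = (1 + 1 / c) / s powr p"
  have \<alpha>: "\<alpha> \<ge> 0" using c by (simp add: \<alpha>_def)
  have ang: "1 \<le> \<alpha> * cos t powr p - 1 / c * cos (p * t)" if t: "0 \<le> t" "t < pi / 2" for t
  proof (cases "t < t0")
    case True
    have "s \<le> cos t" unfolding s_def using True t t0 by (intro cos_monotone_0_pi_le) auto
    then have "s powr p \<le> cos t powr p" using s p by (intro powr_mono2) auto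
    then have "\<alpha> * cos t powr p \<ge> \<alpha> * s powr p" using \<alpha> by (intro mult_left_mono)
    also have "\<alpha> * s powr p = 1 + 1 / c" using s by (simp add: \<alpha>_def)
    finally have "\<alpha> * cos t powr p \<ge> 1 + 1 / c" .
    moreover have "1 / c * cos (p * t) \<le> 1 / c * 1" using c by (intro mult_left_mono) auto
    ultimately show ?thesis by simp
  next
    case False
    have "p * t \<le> 2 * (pi / 2)" using p t by (intro mult_mono) auto
    then have "cos (p * t) \<le> cos (p * t0)"
      using False p t0 by (intro cos_monotone_0_pi_le) auto
    then have "cos (p * t) \<le> - c" by (simp add: c_def)
    then have "1 / c * cos (p * t) \<le> 1 / c * (- c)" using c by (intro mult_left_mono) auto
    moreover have "\<alpha> * cos t powr p \<ge> 0" using \<alpha> by simp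
    ultimately show ?thesis using c by simp
  qed
  have "norm z powr p \<le> \<alpha> * Re z powr p - 1 / c * Re (z powr of_real p)" if z: "Re z > 0" for z :: complex
  proof -
    have z0: "z \<noteq> 0" using z by auto
    define t where "t = \<bar>Arg z\<bar>"
    have cp: "cos (p * Arg z) = cos (p * t)" and ct: "cos (Arg z) = cos t"
      by (auto simp: t_def abs_if)
    have t: "0 \<le> t" "t < pi / 2" using z Arg_Re_pos[of z] by (auto simp: t_def)
    have ct0: "cos t \<ge> 0" using t by (intro cos_ge_zero) auto
    have Rez: "Re z = norm z * cos t"
      using z0 ct by (metis Re_rcis rcis_cmod_Arg)
    have "Re (z powr of_real p) = norm z powr p * cos (p * t)"
    proof -
      have L: "Ln z = Complex (ln (norm z)) (Arg z)" using z0 by (simp add: complex_eq_iff Arg_eq_Im_Ln)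
      have "z powr of_real p = exp (of_real p * Ln z)" using z0 by (simp add: powr_def)
      then have "Re (z powr of_real p) = exp (p * ln (norm z)) * cos (p * Arg z)"
        by (simp add: L Re_exp)
      then show ?thesis using z0 cp by (simp add: powr_def)
    qed
    then have "\<alpha> * Re z powr p - 1 / c * Re (z powr of_real p)
        = norm z powr p * (\<alpha> * cos t powr p - 1 / c * cos (p * t))"
      using ct0 by (simp add: Rez powr_mult algebra_simps)
    also have "\<dots> \<ge> norm z powr p * 1" by (intro mult_left_mono ang t) auto
    finally show ?thesis by simp
  qed
  then show ?thesis using that[OF \<alpha>, of "1 / c"] c by simp
qed

lemma circle_mean_value:
  assumes "f holomorphic_on ball 0 1" "continuous_on (cball 0 1) f"
  shows "(\<integral>x. f (cis x) \<partial>cm) = of_real (2*pi) * f 0"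
proof -
  have "((\<lambda>u. f u / (u - 0)) has_contour_integral (2 * of_real pi * \<i> * f 0)) (circlepath 0 1)"
    using assms by (intro Cauchy_integral_circlepath) auto
  then have "((\<lambda>t. f (0 + of_real 1 * cis t) / (0 + of_real 1 * cis t - 0) * of_real 1 * \<i> * cis t)
      has_integral (2 * of_real pi * \<i> * f 0)) {0..2*pi}"
    unfolding circlepath_def by (subst (asm) has_contour_integral_part_circlepath_iff) auto
  then have "((\<lambda>t. f (cis t) * \<i>) has_integral (2 * of_real pi * \<i> * f 0)) {0..2*pi}" by simp
  then have "((\<lambda>t. f (cis t) * \<i> * (- \<i>)) has_integral (2 * of_real pi * \<i> * f 0 * (- \<i>))) {0..2*pi}"
    by (rule has_integral_mult_left)
  moreover have "f (cis t) * \<i> * (- \<i>) = f (cis t)" for t by (simp add: mult.assoc)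
  moreover have "2 * of_real pi * \<i> * f 0 * (- \<i>) = of_real (2*pi) * f 0"
    by (simp add: complex_eq_iff)
  ultimately have "((\<lambda>t. f (cis t)) has_integral (of_real (2*pi) * f 0)) {0..2*pi}" by (simp only:)
  then have "integral {0..2*pi} (\<lambda>t. f (cis t)) = of_real (2*pi) * f 0" by (rule integral_unique)
  moreover have "continuous_on {0..2*pi} (\<lambda>t. f (cis t))"
    by (intro continuous_on_compose2[OF assms(2)] continuous_intros) auto
  ultimately show ?thesis by (simp add: circle_integral_eq)
qed

text \<open>Nonnegative powers of t go into \<open>G\<close>, conjugates of negative powers into
  \<open>H\<close>. Both are polynomials in t and so extend to entire functions. The constant term
  belongs to \<open>G\<close> alone, to match \<open>is_riesz\<close>.\<close>

lemma trig_analytic_splitting: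
  assumes "f \<in> trig"
  shows "\<exists>G H. G holomorphic_on UNIV \<and> H holomorphic_on UNIV
    \<and> (\<forall>x. f x = G (cis x) + cnj (H (cis x)))
    \<and> (\<lambda>x. G (cis x)) \<in> trig \<and> (\<lambda>x. H (cis x)) \<in> trig
    \<and> is_riesz f (\<lambda>x. G (cis x))
    \<and> (\<forall>n. fc (\<lambda>x. H (cis x)) n = (if n > 0 then cnj (fc f (- n)) else 0))"
  using assms
proof (induction rule: trig.induct)
  case (ee n)
  have cp: "cis x ^ k = ee (int k) x" for k x using Complex.DeMoivre[of x k] by (simp add: ee_def)
  show ?case
  proof (cases "n \<ge> 0")
    case True
    then have "(\<lambda>x. cis x ^ nat n) = ee n" by (simp add: cp fun_eq_iff)
    with True show ?thesis
      by (intro exI[of _ "\<lambda>z. z ^ nat n"] exI[of _ "\<lambda>z. 0"])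
        (auto simp: is_riesz_def fc_ee fun_eq_iff trig.ee trig_const intro!: holomorphic_intros)
  next
    case False
    then have "(\<lambda>x. cis x ^ nat (- n)) = ee (- n)" by (simp add: cp fun_eq_iff)
    with False show ?thesis
      by (intro exI[of _ "\<lambda>z. 0"] exI[of _ "\<lambda>z. z ^ nat (- n)"])
        (auto simp: is_riesz_def fc_ee fun_eq_iff cnj_ee trig.ee trig_const intro!: holomorphic_intros)
  qed
next
  case (cmult f c)
  then obtain G H where 1: "G holomorphic_on UNIV" "H holomorphic_on UNIV"
    "\<forall>x. f x = G (cis x) + cnj (H (cis x))"
    "(\<lambda>x. G (cis x)) \<in> trig" "(\<lambda>x. H (cis x)) \<in> trig" "is_riesz f (\<lambda>x. G (cis x))"
    "\<forall>n. fc (\<lambda>x. H (cis x)) n = (if n > 0 then cnj (fc f (- n)) else 0)" by blast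
  show ?case
  proof (rule exI[of _ "\<lambda>z. c * G z"], rule exI[of _ "\<lambda>z. cnj c * H z"], intro conjI)
    show "\<forall>x. c * f x = c * G (cis x) + cnj (cnj c * H (cis x))"
      using 1(3) by (metis complex_cnj_cnj complex_cnj_mult distrib_left)
    show "is_riesz (\<lambda>x. c * f x) (\<lambda>x. c * G (cis x))"
      using 1(6) by (simp add: is_riesz_def fc_cmult)
    show "\<forall>n. fc (\<lambda>x. cnj c * H (cis x)) n = (if 0 < n then cnj (fc (\<lambda>x. c * f x) (- n)) else 0)"
      unfolding fc_cmult using 1(7) by simp
  qed (use 1 in \<open>auto intro: holomorphic_intros trig.cmult\<close>)
next
  case (add f1 f2)
  then obtain G1 H1 G2 H2 where 1: "G1 holomorphic_on UNIV" "H1 holomorphic_on UNIV"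
    "\<forall>x. f1 x = G1 (cis x) + cnj (H1 (cis x))"
    "(\<lambda>x. G1 (cis x)) \<in> trig" "(\<lambda>x. H1 (cis x)) \<in> trig" "is_riesz f1 (\<lambda>x. G1 (cis x))"
    "\<forall>n. fc (\<lambda>x. H1 (cis x)) n = (if n > 0 then cnj (fc f1 (- n)) else 0)"
    and 2: "G2 holomorphic_on UNIV" "H2 holomorphic_on UNIV"
    "\<forall>x. f2 x = G2 (cis x) + cnj (H2 (cis x))"
    "(\<lambda>x. G2 (cis x)) \<in> trig" "(\<lambda>x. H2 (cis x)) \<in> trig" "is_riesz f2 (\<lambda>x. G2 (cis x))"
    "\<forall>n. fc (\<lambda>x. H2 (cis x)) n = (if n > 0 then cnj (fc f2 (- n)) else 0)" by blast
  have fcs: "fc (\<lambda>x. f1 x + f2 x) n = fc f1 n + fc f2 n"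
    "fc (\<lambda>x. G1 (cis x) + G2 (cis x)) n = fc (\<lambda>x. G1 (cis x)) n + fc (\<lambda>x. G2 (cis x)) n"
    "fc (\<lambda>x. H1 (cis x) + H2 (cis x)) n = fc (\<lambda>x. H1 (cis x)) n + fc (\<lambda>x. H2 (cis x)) n" for n
    by (intro fc_add trig_integrable add.hyps 1(4,5) 2(4,5))+
  show ?case
  proof (rule exI[of _ "\<lambda>z. G1 z + G2 z"], rule exI[of _ "\<lambda>z. H1 z + H2 z"], intro conjI)
    show "is_riesz (\<lambda>x. f1 x + f2 x) (\<lambda>x. G1 (cis x) + G2 (cis x))"
      using 1(6) 2(6) by (simp add: is_riesz_def fcs)
    show "\<forall>n. fc (\<lambda>x. H1 (cis x) + H2 (cis x)) n = (if 0 < n then cnj (fc (\<lambda>x. f1 x + f2 x) (- n)) else 0)"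
      using 1(7) 2(7) by (simp add: fcs)
    show "\<forall>x. f1 x + f2 x = G1 (cis x) + G2 (cis x) + cnj (H1 (cis x) + H2 (cis x))"
    proof
      fix x show "f1 x + f2 x = G1 (cis x) + G2 (cis x) + cnj (H1 (cis x) + H2 (cis x))"
        by (subst 1(3)[rule_format], subst 2(3)[rule_format]) simp
    qed
  qed (use 1 2 in \<open>auto intro: holomorphic_intros trig.add\<close>)
qed

text \<open>For a positive boundary function \<open>v\<close> the completed analytic function \<open>F\<close> maps the disc into
  the right half plane, so \<open>F\<close> has an analytic \<open>p\<close>-th power, whose mean is \<open>F 0 powr p\<close>.\<close>

lemma riesz_bound_positive:
  assumes p: "1 < p" "p \<le> 2"
  obtains C where "C \<ge> 0"
    "\<And>v g. v \<in> trig \<Longrightarrow> (\<And>x. Im (v x) = 0) \<Longrightarrow> (\<And>x. Re (v x) > 0) \<Longrightarrow> g \<in> trig \<Longrightarrow> is_riesz v g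
      \<Longrightarrow> nrmT p g \<le> C * nrmT p v"
proof -
  define q where "q = p / (p - 1)"
  have q: "q > 1" "1/p + 1/q = 1" using p by (auto simp: q_def field_simps)
  have p1: "p \<ge> 1" using p by simp
  obtain \<alpha> \<beta> where ab: "\<alpha> \<ge> 0" "\<beta> \<ge> 0"
    "\<And>z::complex. Re z > 0 \<Longrightarrow> norm z powr p \<le> \<alpha> * Re z powr p - \<beta> * Re (z powr of_real p)"
    using powr_real_part_bound[OF p] by blast
  define K where "K = nrmT p (\<lambda>x. 1) * nrmT q (\<lambda>x. 1)"
  define C where "C = \<alpha> powr (1/p) + K"
  have K: "K \<ge> 0" by (simp add: K_def)
  have "nrmT p g \<le> C * nrmT p v"
    if v: "v \<in> trig" "\<And>x. Im (v x) = 0" "\<And>x. Re (v x) > 0" and g: "g \<in> trig" "is_riesz v g" for v g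
  proof -
    obtain G H where GH: "G holomorphic_on UNIV" "H holomorphic_on UNIV"
      "\<forall>x. v x = G (cis x) + cnj (H (cis x))"
      "(\<lambda>x. G (cis x)) \<in> trig" "(\<lambda>x. H (cis x)) \<in> trig" "is_riesz v (\<lambda>x. G (cis x))"
      "\<forall>n. fc (\<lambda>x. H (cis x)) n = (if n > 0 then cnj (fc v (- n)) else 0)"
      using trig_analytic_splitting[OF v(1)] by blast
    \<comment> \<open>On the circle Re F = Re v. Because \<open>v\<close> is real, \<open>F\<close>
      has there the coefficients of 2 g - c0, with \<open>c0\<close> the mean of \<open>v\<close>,
      so that a bound for \<open>F\<close> is a bound for \<open>g\<close>.\<close>
    define F where "F z = G z + H z" for z
    have Fh: "F holomorphic_on UNIV" unfolding F_def using GH by (intro holomorphic_intros)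
    have Fc: "continuous_on S F" for S using holomorphic_on_imp_continuous_on[OF Fh] continuous_on_subset by blast
    have ReF: "Re (F (cis x)) = Re (v x)" for x using GH(3)[rule_format, of x] by (simp add: F_def)
    define f where "f x = F (cis x)" for x
    have f: "f \<in> trig" unfolding f_def F_def by (intro trig.add GH)
    \<comment> \<open>Minimum principle for Re F. It keeps \<open>F\<close> off the branch cut, so
      the principal power of \<open>F\<close> is holomorphic in the disc.\<close>
    have pos: "Re (F z) > 0" if z: "z \<in> cball 0 1" for z
    proof -
      have "continuous_on (sphere 0 1) (\<lambda>z. Re (F z))" by (intro continuous_intros Fc)
      then obtain z0 where z0: "z0 \<in> sphere 0 1" "\<And>y. y \<in> sphere 0 1 \<Longrightarrow> Re (F z0) \<le> Re (F y)"
        using continuous_attains_inf[of "sphere (0::complex) 1" "\<lambda>z. Re (F z)"] by auto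
      have "z0 = cis (Arg z0)" using z0(1) by (metis dist_0_norm mem_sphere rcis_cmod_Arg rcis_def mult_1 of_real_1)
      then have p0: "Re (F z0) > 0" using ReF v(3) by metis
      have "Re (- F z) \<le> - Re (F z0)"
      proof (rule maximum_real_frontier[where S = "cball 0 1" and f = "\<lambda>z. - F z" and \<xi> = z])
        show "(\<lambda>z. - F z) holomorphic_on interior (cball 0 1)"
          using Fh by (intro holomorphic_intros) (auto intro: holomorphic_on_subset)
        show "continuous_on (closure (cball 0 1)) (\<lambda>z. - F z)" by (intro continuous_intros Fc)
        show "Re (- F y) \<le> - Re (F z0)" if "y \<in> frontier (cball 0 1)" for y
          using that z0(2)[of y] by (simp add: frontier_cball)
      qed (use z in auto)
      then show ?thesis using p0 by simp
    qed
    have nn: "F z \<notin> \<real>\<^sub>\<le>\<^sub>0" if "z \<in> cball 0 1" for z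
      using pos[OF that] complex_nonpos_Reals_iff by force
    have mean: "(\<integral>x. F (cis x) powr of_real p \<partial>cm) = of_real (2*pi) * (F 0 powr of_real p)"
    proof (rule circle_mean_value)
      show "(\<lambda>z. F z powr of_real p) holomorphic_on ball 0 1"
        using nn by (intro holomorphic_intros holomorphic_on_subset[OF Fh]) auto
      show "continuous_on (cball 0 1) (\<lambda>z. F z powr of_real p)"
        using nn pos by (intro continuous_on_powr_complex continuous_intros Fc) (use p in \<open>auto intro: less_imp_le\<close>)
    qed
    have Gi: "integrable cm (\<lambda>x. G (cis x))" and Hi: "integrable cm (\<lambda>x. H (cis x))"
      by (auto intro!: trig_integrable GH)
    have vreal: "fc v (- n) = cnj (fc v n)" for n
    proof -
      have "(\<lambda>x. cnj (v x)) = v" using v(2) by (auto simp: fun_eq_iff complex_eq_iff)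
      then show ?thesis using fc_cnj[of v "- n"] by simp
    qed
    define c0 where "c0 = fc v 0 / of_real (2*pi)"
    have F0: "of_real (2*pi) * F 0 = fc v 0"
    proof -
      have "of_real (2*pi) * F 0 = (\<integral>x. F (cis x) \<partial>cm)"
        by (rule circle_mean_value[symmetric]) (use Fh Fc in \<open>auto intro: holomorphic_on_subset\<close>)
      also have "\<dots> = fc (\<lambda>x. G (cis x) + H (cis x)) 0" by (simp add: F_def fc_def)
      also have "\<dots> = fc v 0" using GH(6,7) Gi Hi by (simp add: fc_add is_riesz_def)
      finally show ?thesis .
    qed
    have "Im (fc v 0) = 0" using vreal[of 0] by (simp add: complex_eq_iff)
    then have "Im (F 0) = 0" using arg_cong[OF F0, of Im] by simp
    then have "F 0 = of_real (Re (F 0))" by (simp add: complex_eq_iff)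
    then have "F 0 powr of_real p = of_real (Re (F 0) powr p)"
      using pos[of 0] powr_of_real[of "Re (F 0)" p] by simp
    then have mean_pos: "Re (F 0 powr of_real p) \<ge> 0" by simp
    have fm: "Lp_mass cm p f \<le> \<alpha> * Lp_mass cm p v"
    proof -
      have int1: "integrable cm (\<lambda>x. F (cis x) powr of_real p)"
      proof -
        have "compact ((\<lambda>z. F z powr of_real p) ` sphere 0 1)"
          using nn pos by (intro compact_continuous_image continuous_on_powr_complex continuous_intros Fc) (use p in \<open>auto intro: less_imp_le\<close>)
        then obtain B where B: "\<And>x. norm (F (cis x) powr of_real p) \<le> B"
          using compact_imp_bounded bounded_iff by (metis (no_types, lifting) image_eqI mem_sphere_0 norm_cis)
        have "(\<lambda>x. F (cis x) powr of_real p) \<in> borel_measurable borel"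
          using nn pos
          by (intro borel_measurable_continuous_onI continuous_on_powr_complex continuous_intros continuous_on_compose2[OF Fc[of UNIV]])
            (use p in \<open>auto intro: less_imp_le\<close>)
        then show ?thesis
          by (intro circle.integrable_const_bound[where B = B]) (use B in auto)
      qed
      have int2: "integrable cm (\<lambda>x. norm (v x) powr p)"
        using trig_Lp_space[OF v(1) p1] by (rule Lp_spaceD)
      have nv: "norm (v x) = Re (v x)" for x using v(2)[of x] v(3)[of x] by (simp add: cmod_eq_Re)
      have "Lp_mass cm p f \<le> (\<integral>x. \<alpha> * norm (v x) powr p - \<beta> * Re (F (cis x) powr of_real p) \<partial>cm)"
        unfolding Lp_mass_def
      proof (rule integral_mono)
        show "integrable cm (\<lambda>x. norm (f x) powr p)"
          using trig_Lp_space[OF f p1] by (rule Lp_spaceD)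
        show "integrable cm (\<lambda>x. \<alpha> * norm (v x) powr p - \<beta> * Re (F (cis x) powr of_real p))"
          using int1 int2 by auto
        show "norm (f x) powr p \<le> \<alpha> * norm (v x) powr p - \<beta> * Re (F (cis x) powr of_real p)" for x
          using ab(3)[of "F (cis x)"] ReF[of x] v(3)[of x] nv[of x] by (simp add: f_def)
      qed
      also have "\<dots> = \<alpha> * Lp_mass cm p v - \<beta> * Re (\<integral>x. F (cis x) powr of_real p \<partial>cm)"
        unfolding Lp_mass_def using int1 int2 by simp
      also have "\<dots> = \<alpha> * Lp_mass cm p v - \<beta> * (2 * pi * Re (F 0 powr of_real p))"
        unfolding mean by simp
      also have "\<dots> \<le> \<alpha> * Lp_mass cm p v"
        using ab(2) mean_pos by simp
      finally show ?thesis .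
    qed
    have fn: "nrmT p f \<le> \<alpha> powr (1/p) * nrmT p v"
    proof -
      have "Lp_mass cm p f powr (1/p) \<le> (\<alpha> * Lp_mass cm p v) powr (1/p)"
        using p fm by (intro powr_mono2) auto
      then show ?thesis using ab by (simp add: Lp_nrm_def powr_mult)
    qed
    have gf: "AE x in cm. g x = (1/2) * f x + (c0 / 2)"
    proof (rule fourier_uniqueness_eq)
      show "integrable cm g" "integrable cm (\<lambda>x. (1/2) * f x + c0 / 2)"
        by (intro trig_integrable g f trig.add trig.cmult trig_const)+
      fix n
      have c: "fc (\<lambda>x. c0 / 2) n = (if n = 0 then fc v 0 / 2 else 0)"
        using fc_cmult[of "c0 / 2" "ee 0" n] by (auto simp: fc_ee c0_def)
      have "fc f n = fc (\<lambda>x. G (cis x)) n + fc (\<lambda>x. H (cis x)) n"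
        unfolding f_def F_def using Gi Hi by (rule fc_add)
      also have "\<dots> = (if n \<ge> 0 then fc v n else 0) + (if n > 0 then fc v n else 0)"
        using GH(6,7) vreal[of n] by (simp add: is_riesz_def)
      finally have ff: "fc f n = (if n \<ge> 0 then fc v n else 0) + (if n > 0 then fc v n else 0)" .
      have "fc (\<lambda>x. (1/2) * f x + c0 / 2) n = (1/2) * fc f n + fc (\<lambda>x. c0 / 2) n"
        using fc_add[OF trig_integrable[OF trig.cmult[OF f, of "1/2"]] trig_integrable[OF trig_const[of "c0 / 2"]]]
        unfolding fc_cmult .
      also have "\<dots> = fc g n" using g(2) c ff by (auto simp: is_riesz_def)
      finally show "fc g n = fc (\<lambda>x. (1/2) * f x + c0 / 2) n" by simp
    qed
    have one: "(\<lambda>x. 1) \<in> LpT r" if "r \<ge> 1" for r using trig_Lp_space[OF trig_const that] .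
    have c0n: "norm c0 \<le> nrmT p v * nrmT q (\<lambda>x. 1)"
    proof -
      have "norm (fc v 0) \<le> nrmT p v * nrmT q (\<lambda>x. 1)"
        using Lp_Holder[OF trig_Lp_space[OF v(1) p1] one p(1) q] q by (simp add: fc_def)
      moreover have "norm c0 \<le> norm (fc v 0)"
      proof -
        have "norm c0 = norm (fc v 0) / (2*pi)" by (simp add: c0_def norm_divide norm_mult)
        also have "\<dots> \<le> norm (fc v 0) / 1" using pi_gt3 by (intro divide_left_mono) auto
        finally show ?thesis by simp
      qed
      ultimately show ?thesis by linarith
    qed
    have "nrmT p g = nrmT p (\<lambda>x. (1/2) * f x + (c0 / 2) * 1)"
      unfolding Lp_nrm_def
    proof (rule arg_cong[where f = "\<lambda>y. y powr (1/p)"], rule Lp_mass_cong_AE)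
      show "(\<lambda>x. (1/2) * f x + (c0 / 2) * 1) \<in> borel_measurable cm"
        by (intro trig_measurable trig.add trig.cmult trig_const f)
    qed (use gf g trig_measurable in auto)
    also have "\<dots> \<le> nrmT p (\<lambda>x. (1/2) * f x) + nrmT p (\<lambda>x. (c0 / 2) * 1)"
      by (intro Lp_nrm_triangle Lp_space_cmult one trig_Lp_space f p1)
    also have "\<dots> = (1/2) * nrmT p f + (norm c0 / 2) * nrmT p (\<lambda>x. 1)"
      using p by (subst (1 2) Lp_nrm_cmult) (auto simp: norm_divide)
    also have "\<dots> \<le> 1 * nrmT p f + norm c0 * nrmT p (\<lambda>x. 1)"
      by (intro add_mono mult_right_mono) auto
    also have "\<dots> \<le> 1 * (\<alpha> powr (1/p) * nrmT p v)
      + (nrmT p v * nrmT q (\<lambda>x. 1)) * nrmT p (\<lambda>x. 1)"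
      using fn c0n by (intro add_mono mult_right_mono) auto
    also have "\<dots> = C * nrmT p v" by (simp add: C_def K_def algebra_simps)
    finally show ?thesis .
  qed
  then show ?thesis using that[of C] K by (simp add: C_def)
qed

text \<open>Cauchy-Schwarz for the p-th powers of the norms. It turns approximation of a square root
  in exponent 2p into approximation of the function in exponent p.\<close>

lemma Lp_nrm_mult_le:
  assumes a: "a \<in> Lp_space M (2*p)" and b: "b \<in> Lp_space M (2*p)" and p: "p \<ge> 1"
  shows "(\<lambda>x. a x * b x) \<in> Lp_space M p" "Lp_nrm M p (\<lambda>x. a x * b x) \<le> Lp_nrm M (2*p) a * Lp_nrm M (2*p) b"
proof -
  note [measurable] = Lp_spaceD(1)[OF a] Lp_spaceD(1)[OF b]
  define A where "A x = complex_of_real (norm (a x) powr p)" for x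
  define B where "B x = complex_of_real (norm (b x) powr p)" for x
  have sq: "norm (A x) powr 2 = norm (a x) powr (2*p)" "norm (B x) powr 2 = norm (b x) powr (2*p)" for x
    by (auto simp: A_def B_def powr_powr mult.commute)
  have A: "A \<in> Lp_space M 2" "B \<in> Lp_space M 2"
    unfolding Lp_space_def mem_Collect_eq sq
    using Lp_spaceD(2)[OF a] Lp_spaceD(2)[OF b] by (simp_all add: A_def[abs_def] B_def[abs_def])
  have AB: "A x * B x = of_real (norm (a x * b x) powr p)" for x
    by (simp add: A_def B_def norm_mult powr_mult)
  have "integrable M (\<lambda>x. A x * B x)" by (rule Lp_mult_integrable[OF A]) auto
  then have "integrable M (\<lambda>x. norm (a x * b x) powr p)" unfolding AB complex_of_real_integrable_eq .
  then show "(\<lambda>x. a x * b x) \<in> Lp_space M p" by (simp add: Lp_space_def)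
  have nr: "Lp_nrm M 2 A = Lp_nrm M (2*p) a powr p" "Lp_nrm M 2 B = Lp_nrm M (2*p) b powr p"
    using p by (auto simp: Lp_nrm_def Lp_mass_def sq powr_powr)
  have "Lp_mass M p (\<lambda>x. a x * b x) = norm (\<integral>x. A x * B x \<partial>M)"
    unfolding AB Lp_mass_def by simp
  also have "\<dots> \<le> Lp_nrm M 2 A * Lp_nrm M 2 B" by (rule Lp_Holder[OF A]) auto
  also have "\<dots> = (Lp_nrm M (2*p) a * Lp_nrm M (2*p) b) powr p" by (simp add: nr powr_mult)
  finally have "Lp_mass M p (\<lambda>x. a x * b x) powr (1/p) \<le> ((Lp_nrm M (2*p) a * Lp_nrm M (2*p) b) powr p) powr (1/p)"
    using p by (intro powr_mono2) auto
  then show "Lp_nrm M p (\<lambda>x. a x * b x) \<le> Lp_nrm M (2*p) a * Lp_nrm M (2*p) b"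
    using p by (simp add: Lp_nrm_def[of M p] powr_powr)
qed

text \<open>A nonnegative function is approximated by the strictly positive trigonometric polynomials
  \<open>|h|\<^sup>2 + \<epsilon>\<close>, where \<open>h\<close> approximates its square root.\<close>

lemma nonneg_trig_approx:
  assumes p: "p \<ge> 1" and w: "w \<in> LpT p" "\<And>x. Im (w x) = 0" "\<And>x. Re (w x) \<ge> 0"
  obtains v where "\<forall>n::nat. v n \<in> trig" "\<forall>n x. Im (v n x) = 0" "\<forall>n x. Re (v n x) > 0"
    "(\<lambda>n. nrmT p (\<lambda>x. v n x - w x)) \<longlonglongrightarrow> 0"
proof -
  note [measurable] = Lp_spaceD(1)[OF w(1)]
  let ?N = "nrmT p" and ?N2 = "nrmT (2*p)"
  define s where "s x = complex_of_real (sqrt (Re (w x)))" for x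
  have ss: "s x * s x = w x" for x
    using w(2,3)[of x] by (simp add: s_def complex_eq_iff flip: of_real_mult)
  have cs: "cnj (s x) = s x" for x by (simp add: s_def)
  have s: "s \<in> LpT (2*p)"
  proof -
    have "norm (s x) powr (2*p) = norm (w x) powr p" for x
    proof -
      have "norm (s x) powr (2*p) = (norm (s x) powr 2) powr p" by (simp only: powr_powr)
      also have "norm (s x) powr 2 = norm (s x * s x)" by (simp add: norm_mult power2_eq_square)
      finally show ?thesis by (simp only: ss)
    qed
    then show ?thesis using Lp_spaceD(2)[OF w(1)] by (simp add: Lp_space_def) (simp add: s_def[abs_def])
  qed
  have p2: "2 * p > 1" "2 * p \<ge> 1" using p by auto
  obtain h where h: "\<And>n::nat. h n \<in> trig" "(\<lambda>n. ?N2 (\<lambda>x. h n x - s x)) \<longlonglongrightarrow> 0"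
    using trig_dense[OF p2(1) s] by blast
  have hL: "h n \<in> LpT (2*p)" for n by (rule trig_Lp_space[OF h(1) p2(2)])
  have cL: "(\<lambda>x. cnj (h n x)) \<in> LpT (2*p)" for n
    by (rule trig_Lp_space[OF trig_cnj[OF h(1)] p2(2)])
  define e where "e n = inverse (real (Suc n))" for n
  define v where "v n x = h n x * cnj (h n x) + of_real (e n)" for n x
  have vt: "v n \<in> trig" for n unfolding v_def by (intro trig.add trig_mult trig_cnj trig_const h)
  have hn: "h n x * cnj (h n x) = of_real ((norm (h n x))\<^sup>2)" for n x by (rule complex_norm_square[symmetric])
  have im: "Im (v n x) = 0" for n x unfolding v_def hn by simp
  have re: "Re (v n x) > 0" for n x unfolding v_def hn by (simp add: e_def add_nonneg_pos)
  have dL: "(\<lambda>x. h n x - s x) \<in> LpT (2*p)" for n using Lp_space_diff[OF hL s p2(2)] .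
  have dcL: "(\<lambda>x. cnj (h n x - s x)) \<in> LpT (2*p)" for n
    using Lp_space_diff[OF cL s p2(2), of n] by (simp add: cs)
  have bound: "?N (\<lambda>x. v n x - w x) \<le> ?N2 (\<lambda>x. h n x - s x) * ?N2 (h n) + ?N2 s * ?N2 (\<lambda>x. h n x - s x) + e n * ?N (\<lambda>x. 1)" for n
  proof -
    have split: "v n x - w x = ((h n x - s x) * cnj (h n x) + s x * cnj (h n x - s x)) + of_real (e n) * 1" for x
      unfolding v_def ss[symmetric] by (simp add: algebra_simps cs)
    note m1 = Lp_nrm_mult_le[OF dL[of n] cL[of n] p] and m2 = Lp_nrm_mult_le[OF s dcL[of n] p]
    have one: "(\<lambda>x. 1) \<in> LpT p" by (rule trig_Lp_space[OF trig_const p])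
    have "?N (\<lambda>x. v n x - w x) \<le> ?N (\<lambda>x. (h n x - s x) * cnj (h n x) + s x * cnj (h n x - s x)) + ?N (\<lambda>x. of_real (e n) * 1)"
      unfolding split by (intro Lp_nrm_triangle Lp_space_add m1(1) m2(1) Lp_space_cmult one p)
    also have "\<dots> \<le> (?N (\<lambda>x. (h n x - s x) * cnj (h n x)) + ?N (\<lambda>x. s x * cnj (h n x - s x))) + ?N (\<lambda>x. of_real (e n) * 1)"
      by (intro add_mono Lp_nrm_triangle m1(1) m2(1) p order_refl)
    also have "?N (\<lambda>x. of_real (e n) * 1) = norm (complex_of_real (e n)) * ?N (\<lambda>x. 1)"
      by (rule Lp_nrm_cmult) (use p in simp)
    also have "norm (complex_of_real (e n)) = e n" unfolding norm_of_real by (simp add: e_def)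
    finally have le: "?N (\<lambda>x. v n x - w x) \<le> ?N (\<lambda>x. (h n x - s x) * cnj (h n x)) + ?N (\<lambda>x. s x * cnj (h n x - s x)) + e n * ?N (\<lambda>x. 1)" .
    have c1: "?N2 (\<lambda>x. cnj (h n x)) = ?N2 (h n)" and c2: "?N2 (\<lambda>x. cnj (h n x - s x)) = ?N2 (\<lambda>x. h n x - s x)"
      unfolding Lp_nrm_def Lp_mass_def complex_mod_cnj by (rule refl)+
    show ?thesis using le m1(2) m2(2) unfolding c1 c2 by linarith
  qed
  have "(\<lambda>n. ?N2 (\<lambda>x. h n x - s x) * ?N2 (h n) + ?N2 s * ?N2 (\<lambda>x. h n x - s x) + e n * ?N (\<lambda>x. 1))
      \<longlonglongrightarrow> 0 * ?N2 s + ?N2 s * 0 + 0 * ?N (\<lambda>x. 1)"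
    by (intro tendsto_intros h(2) Lp_nrm_tendsto[OF hL s p2(2) h(2)])
      (unfold e_def, rule LIMSEQ_inverse_real_of_nat)
  then have lim0: "(\<lambda>n. ?N2 (\<lambda>x. h n x - s x) * ?N2 (h n) + ?N2 s * ?N2 (\<lambda>x. h n x - s x) + e n * ?N (\<lambda>x. 1)) \<longlonglongrightarrow> 0"
    by simp
  have "(\<lambda>n. ?N (\<lambda>x. v n x - w x)) \<longlonglongrightarrow> 0"
    by (rule Lim_null_comparison[OF always_eventually lim0]) (use bound in simp)
  then show ?thesis using that[of v] vt im re by blast
qed

text \<open>The pairing of \<open>g\<close> with the projection of \<open>w\<close>, expressed by
  coefficients of \<open>w\<close>: index k of \<open>g\<close> meets index -k of the projection,
  hence k <= 0. It makes sense for \<open>w\<close> in L^p before the projection of \<open>w\<close>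
  is available, and for finite \<open>S\<close> it is continuous in \<open>w\<close>.\<close>

definition riesz_form :: "int set \<Rightarrow> (real \<Rightarrow> complex) \<Rightarrow> (real \<Rightarrow> complex) \<Rightarrow> complex" where
  "riesz_form S g w = (\<Sum>k\<in>S. fc g k * (if k \<le> 0 then fc w (- k) else 0) / of_real (2*pi))"

lemma riesz_form_eq:
  assumes "g \<in> trig" "integrable cm u" "is_riesz w u" "finite S" "\<And>n. n \<notin> S \<Longrightarrow> fc g n = 0"
  shows "(\<integral>x. g x * u x \<partial>cm) = riesz_form S g w"
  using trig_pairing[OF assms(1,2,4,5)] assms(3) by (simp add: riesz_form_def is_riesz_def)

text \<open>Continuity of \<open>riesz_form\<close> extends the estimate from positive polynomials
  to nonnegative L^p functions. The larger class is needed because the positive part of a polynomial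
  is in general not a polynomial.\<close>

lemma riesz_form_bound_nonneg:
  assumes p: "1 < p" "p \<le> 2" and q: "q > 1" "1/p + 1/q = 1"
  obtains C where "C \<ge> 0" "\<And>w g S. w \<in> LpT p \<Longrightarrow> (\<And>x. Im (w x) = 0) \<Longrightarrow> (\<And>x. Re (w x) \<ge> 0)
    \<Longrightarrow> g \<in> trig \<Longrightarrow> finite S \<Longrightarrow> (\<And>n. n \<notin> S \<Longrightarrow> fc g n = 0)
    \<Longrightarrow> norm (riesz_form S g w) \<le> C * nrmT p w * nrmT q g"
proof -
  let ?N = "nrmT p" and ?Nq = "nrmT q"
  obtain C where C: "C \<ge> 0"
    "\<And>v g. v \<in> trig \<Longrightarrow> (\<And>x. Im (v x) = 0) \<Longrightarrow> (\<And>x. Re (v x) > 0) \<Longrightarrow> g \<in> trig \<Longrightarrow> is_riesz v g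
      \<Longrightarrow> ?N g \<le> C * ?N v"
    using riesz_bound_positive[OF p] by blast
  have p1: "p \<ge> 1" "q \<ge> 1" using p q by auto
  have "norm (riesz_form S g w) \<le> C * ?N w * ?Nq g"
    if w: "w \<in> LpT p" "\<And>x. Im (w x) = 0" "\<And>x. Re (w x) \<ge> 0"
      and g: "g \<in> trig" and S: "finite S" "\<And>n. n \<notin> S \<Longrightarrow> fc g n = 0" for w g S
  proof -
    obtain v where v: "\<forall>n::nat. v n \<in> trig" "\<forall>n x. Im (v n x) = 0" "\<forall>n x. Re (v n x) > 0"
      "(\<lambda>n. ?N (\<lambda>x. v n x - w x)) \<longlonglongrightarrow> 0"
      by (rule nonneg_trig_approx[OF p1(1) w])
    have vL: "v n \<in> LpT p" for n using trig_Lp_space v(1) p1 by blast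
    have "\<forall>n. \<exists>u. u \<in> trig \<and> is_riesz (v n) u" using trig_riesz v(1) by metis
    then obtain u where u: "\<And>n. u n \<in> trig" "\<And>n. is_riesz (v n) (u n)" by metis
    have "(\<lambda>n. riesz_form S g (v n)) \<longlonglongrightarrow> riesz_form S g w"
      unfolding riesz_form_def
    proof (intro tendsto_intros)
      show "(\<lambda>n. if k \<le> 0 then fc (v n) (- k) else 0) \<longlonglongrightarrow> (if k \<le> 0 then fc w (- k) else 0)" for k
        using fc_tendsto[OF vL w(1) p(1) v(4)] by simp
    qed simp
    then have lim: "(\<lambda>n. norm (riesz_form S g (v n))) \<longlonglongrightarrow> norm (riesz_form S g w)" by (rule tendsto_norm)
    have b: "norm (riesz_form S g (v n)) \<le> C * ?N (v n) * ?Nq g" for n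
    proof -
      have "riesz_form S g (v n) = (\<integral>x. u n x * g x \<partial>cm)"
        using riesz_form_eq[OF g trig_integrable[OF u(1)] u(2) S] by (simp add: mult.commute)
      also have "norm \<dots> \<le> ?N (u n) * ?Nq g"
        by (rule Lp_Holder[OF trig_Lp_space[OF u(1) p1(1)] trig_Lp_space[OF g p1(2)] p(1) q])
      also have "\<dots> \<le> (C * ?N (v n)) * ?Nq g"
        using C(2)[of "v n" "u n"] v u by (intro mult_right_mono) auto
      finally show ?thesis .
    qed
    have "(\<lambda>n. C * ?N (v n) * ?Nq g) \<longlonglongrightarrow> C * ?N w * ?Nq g"
      by (intro tendsto_intros Lp_nrm_tendsto[OF vL w(1) p1(1) v(4)])
    with lim show ?thesis by (rule LIMSEQ_le) (use b in blast)
  qed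
  then show ?thesis using that[OF C(1)] by blast
qed

text \<open>Boundedness tested by duality on polynomials; this bilinear form of the estimate can be
  transposed.\<close>

definition riesz_bounded :: "real \<Rightarrow> real \<Rightarrow> real \<Rightarrow> bool" where
  "riesz_bounded p q C \<longleftrightarrow> C \<ge> 0 \<and> (\<forall>f\<in>trig. \<forall>u\<in>trig. \<forall>g\<in>trig. is_riesz f u \<longrightarrow>
     norm (\<integral>x. g x * u x \<partial>cm) \<le> C * nrmT p f * nrmT q g)"

text \<open>Positive and negative parts of the real and imaginary part are four nonnegative
  functions dominated by the modulus of \<open>f\<close>, which costs the factor 4.\<close>

lemma riesz_bounded_le_2:
  assumes p: "1 < p" "p \<le> 2" and q: "q > 1" "1/p + 1/q = 1"
  shows "\<exists>C. riesz_bounded p q C"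
proof -
  let ?N = "nrmT p" and ?Nq = "nrmT q"
  obtain C where C: "C \<ge> 0" "\<And>w g S. w \<in> LpT p \<Longrightarrow> (\<And>x. Im (w x) = 0) \<Longrightarrow> (\<And>x. Re (w x) \<ge> 0)
    \<Longrightarrow> g \<in> trig \<Longrightarrow> finite S \<Longrightarrow> (\<And>n. n \<notin> S \<Longrightarrow> fc g n = 0)
    \<Longrightarrow> norm (riesz_form S g w) \<le> C * ?N w * ?Nq g"
    using riesz_form_bound_nonneg[OF p q] by blast
  have "norm (\<integral>x. g x * u x \<partial>cm) \<le> (4 * C) * ?N f * ?Nq g"
    if f: "f \<in> trig" and u: "u \<in> trig" "is_riesz f u" and g: "g \<in> trig" for f u g
  proof -
    have fL: "f \<in> LpT p" using trig_Lp_space[OF f] p by simp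
    note [measurable] = Lp_spaceD(1)[OF fL]
    obtain S where S: "finite S" "\<And>n. n \<notin> S \<Longrightarrow> fc g n = 0" using trig_expansion[OF g] by blast
    have part: "(\<lambda>x. complex_of_real (a x)) \<in> LpT p"
      "norm (riesz_form S g (\<lambda>x. of_real (a x))) \<le> C * ?N f * ?Nq g"
      if a: "a \<in> borel_measurable cm" "\<And>x. 0 \<le> a x" "\<And>x. a x \<le> norm (f x)" for a :: "real \<Rightarrow> real"
    proof -
      have le: "norm (complex_of_real (a x)) powr p \<le> norm (f x) powr p" for x
        using a(2,3)[of x] p by (intro powr_mono2) auto
      show aL: "(\<lambda>x. complex_of_real (a x)) \<in> LpT p"
        by (rule Lp_space_bound[OF _ Lp_spaceD(2)[OF fL] le]) (use a(1) in measurable)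
      have "Lp_mass cm p (\<lambda>x. of_real (a x)) \<le> Lp_mass cm p f"
        unfolding Lp_mass_def by (rule integral_mono[OF Lp_spaceD(2)[OF aL] Lp_spaceD(2)[OF fL] le])
      then have "?N (\<lambda>x. of_real (a x)) \<le> ?N f" unfolding Lp_nrm_def using p by (intro powr_mono2) auto
      then have "C * ?N (\<lambda>x. of_real (a x)) * ?Nq g \<le> C * ?N f * ?Nq g"
        using C(1) by (intro mult_right_mono mult_left_mono) auto
      moreover have "norm (riesz_form S g (\<lambda>x. of_real (a x))) \<le> C * ?N (\<lambda>x. of_real (a x)) * ?Nq g"
        using a(2) by (intro C(2) aL g S) auto
      ultimately show "norm (riesz_form S g (\<lambda>x. of_real (a x))) \<le> C * ?N f * ?Nq g" by linarith
    qed
    define a where "a = (\<lambda>j::nat. \<lambda>x. if j = 0 then max 0 (Re (f x)) else if j = 1 then max 0 (- Re (f x))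
       else if j = 2 then max 0 (Im (f x)) else max 0 (- Im (f x)))"
    define W where "W j x = complex_of_real (a j x)" for j x
    have a1: "a j \<in> borel_measurable cm" for j unfolding a_def by measurable
    have a2: "0 \<le> a j x" "a j x \<le> norm (f x)" for j x
      using abs_Re_le_cmod[of "f x"] abs_Im_le_cmod[of "f x"] by (auto simp: a_def)
    have WL: "W j \<in> LpT p" and Wb: "norm (riesz_form S g (W j)) \<le> C * ?N f * ?Nq g" for j
      unfolding W_def using part[OF a1 a2] by auto
    have Wi: "integrable cm (W j)" for j using Lp_integrable_circle[OF WL] p by simp
    have fW: "f x = (W 0 x - W 1 x) + \<i> * (W 2 x - W 3 x)" for x
      by (auto simp: W_def a_def complex_eq_iff max_def)
    have fcf: "fc f k = (fc (W 0) k - fc (W 1) k) + \<i> * (fc (W 2) k - fc (W 3) k)" for k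
    proof -
      have "fc f k = fc (\<lambda>x. (W 0 x - W 1 x) + \<i> * (W 2 x - W 3 x)) k" using fW by presburger
      also have "\<dots> = fc (\<lambda>x. W 0 x - W 1 x) k + fc (\<lambda>x. \<i> * (W 2 x - W 3 x)) k"
        using Wi by (intro fc_add) auto
      also have "\<dots> = (fc (W 0) k - fc (W 1) k) + \<i> * (fc (W 2) k - fc (W 3) k)"
        using Wi by (simp only: fc_cmult fc_diff)
      finally show ?thesis .
    qed
    have "fc g k * (if k \<le> 0 then fc f (- k) else 0) / of_real (2*pi)
       = (fc g k * (if k \<le> 0 then fc (W 0) (- k) else 0) / of_real (2*pi)
        - fc g k * (if k \<le> 0 then fc (W 1) (- k) else 0) / of_real (2*pi))
       + \<i> * (fc g k * (if k \<le> 0 then fc (W 2) (- k) else 0) / of_real (2*pi)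
        - fc g k * (if k \<le> 0 then fc (W 3) (- k) else 0) / of_real (2*pi))" for k
      unfolding fcf[of "- k"] by (simp add: algebra_simps add_divide_distrib diff_divide_distrib)
    then have "riesz_form S g f = (riesz_form S g (W 0) - riesz_form S g (W 1)) + \<i> * (riesz_form S g (W 2) - riesz_form S g (W 3))"
      unfolding riesz_form_def by (simp only: sum.distrib sum_subtractf flip: sum_distrib_left)
    then have "norm (riesz_form S g f) \<le> norm (riesz_form S g (W 0)) + norm (riesz_form S g (W 1))
       + norm (riesz_form S g (W 2)) + norm (riesz_form S g (W 3))"
      using norm_triangle_ineq[of "riesz_form S g (W 0) - riesz_form S g (W 1)" "\<i> * (riesz_form S g (W 2) - riesz_form S g (W 3))"]
        norm_triangle_ineq4[of "riesz_form S g (W 0)" "riesz_form S g (W 1)"]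
        norm_triangle_ineq4[of "riesz_form S g (W 2)" "riesz_form S g (W 3)"]
      by (simp add: norm_mult)
    also have "\<dots> \<le> (4 * C) * ?N f * ?Nq g" using Wb[of 0] Wb[of 1] Wb[of 2] Wb[of 3] by simp
    finally show ?thesis using riesz_form_eq[OF g trig_integrable[OF u(1)] u(2) S] by simp
  qed
  then show ?thesis using C(1) unfolding riesz_bounded_def by (intro exI[of _ "4 * C"]) auto
qed

text \<open>Up to the reflection of the circle, the Riesz projection is its own transpose, so the bounds for
  \<open>p\<close> and for the conjugate exponent are equivalent.\<close>

lemma riesz_bounded_commute:
  assumes "riesz_bounded p q C"
  shows "riesz_bounded q p C"
proof -
  have "norm (\<integral>x. g x * u x \<partial>cm) \<le> C * nrmT q f * nrmT p g"
    if f: "f \<in> trig" and u: "u \<in> trig" "is_riesz f u" and g: "g \<in> trig" for f u g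
  proof -
    have bd: "norm (\<integral>x. g x * u x \<partial>cm) \<le> C * nrmT p f * nrmT q g"
      if "f \<in> trig" "u \<in> trig" "g \<in> trig" "is_riesz f u" for f u g
      using assms that by (simp add: riesz_bounded_def)
    have f': "(\<lambda>x. f (crev x)) \<in> trig" and g': "(\<lambda>x. g (crev x)) \<in> trig" using f g trig_crev by blast+
    obtain h where h: "h \<in> trig" "is_riesz (\<lambda>x. g (crev x)) h" using trig_riesz[OF g'] by blast
    obtain S where S: "finite S" "\<And>n. n \<notin> S \<Longrightarrow> fc f n = 0" using trig_expansion[OF f] by blast
    have S': "finite (uminus ` S)" "\<And>n. n \<notin> uminus ` S \<Longrightarrow> fc (\<lambda>x. f (crev x)) n = 0"
      using S by (auto simp: fc_crev trig_measurable[OF f] image_iff) (metis minus_minus)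
    have uS: "fc u n = 0" if "n \<notin> S" for n using S(2)[OF that] u(2) by (simp add: is_riesz_def)
    have "(\<integral>x. g x * u x \<partial>cm) = (\<integral>x. u x * g x \<partial>cm)" by (simp add: mult.commute)
    also have "\<dots> = (\<Sum>n\<in>S. fc u n * fc g (- n) / of_real (2*pi))"
      by (rule trig_pairing[OF u(1) trig_integrable[OF g] S(1) uS])
    also have "\<dots> = (\<Sum>n\<in>S. fc f n * fc h n / of_real (2*pi))"
      using u(2) h(2) by (intro sum.cong) (auto simp: is_riesz_def fc_crev trig_measurable[OF g])
    also have "\<dots> = (\<Sum>n\<in>uminus ` S. fc (\<lambda>x. f (crev x)) n * fc h (- n) / of_real (2*pi))"
      by (simp add: sum.reindex fc_crev trig_measurable[OF f])
    also have "\<dots> = (\<integral>x. f (crev x) * h x \<partial>cm)"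
      by (rule trig_pairing[OF f' trig_integrable[OF h(1)] S', symmetric])
    also have "norm \<dots> \<le> C * nrmT p (\<lambda>x. g (crev x)) * nrmT q (\<lambda>x. f (crev x))"
      by (rule bd[OF g' h(1) f' h(2)])
    also have "\<dots> = C * nrmT q f * nrmT p g"
      by (simp add: Lp_nrm_def Lp_mass_crev trig_measurable f g)
    finally show ?thesis .
  qed
  then show ?thesis using assms unfolding riesz_bounded_def by blast
qed

text \<open>For p > 2 the conjugate exponent is below 2 and its bound is transposed. Testing with
  polynomials that converge to the dual function of \<open>u\<close> gives N^p <= C M N^(p-1), where
  N and M are the norms of \<open>u\<close> and \<open>f\<close>; a power of N cancels.\<close>

theorem riesz_trig_bound:
  assumes p: "1 < p"
  obtains C where "C \<ge> 0" "\<And>f u. f \<in> trig \<Longrightarrow> u \<in> trig \<Longrightarrow> is_riesz f u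
    \<Longrightarrow> nrmT p u \<le> C * nrmT p f"
proof -
  define q where "q = p / (p - 1)"
  have q: "q > 1" "1/p + 1/q = 1" "1/q + 1/p = 1" using p by (auto simp: q_def field_simps)
  have p1: "p \<ge> 1" "q \<ge> 1" using p q by auto
  let ?N = "nrmT p" and ?Nq = "nrmT q"
  have "\<exists>C. riesz_bounded p q C"
  proof (cases "p \<le> 2")
    case True
    then show ?thesis using riesz_bounded_le_2 p q by blast
  next
    case False
    then have "q \<le> 2" using p by (simp add: q_def field_simps)
    then show ?thesis using riesz_bounded_le_2[of q p] riesz_bounded_commute p q by blast
  qed
  then obtain C where C: "riesz_bounded p q C" by blast
  have C0: "C \<ge> 0" using C by (simp add: riesz_bounded_def)
  have "?N u \<le> C * ?N f" if f: "f \<in> trig" and u: "u \<in> trig" "is_riesz f u" for f u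
  proof -
    have uL: "u \<in> LpT p" by (rule trig_Lp_space[OF u(1) p1(1)])
    have dL: "(\<lambda>x. pdual p (u x)) \<in> LpT q" by (rule pdual_Lp_space[OF uL p q(2)])
    obtain g where g: "\<And>n::nat. g n \<in> trig" "(\<lambda>n. ?Nq (\<lambda>x. g n x - pdual p (u x))) \<longlonglongrightarrow> 0"
      using trig_dense[OF q(1) dL] by blast
    have gL: "g n \<in> LpT q" for n by (rule trig_Lp_space[OF g(1) p1(2)])
    have "(\<lambda>n. norm (\<integral>x. g n x * u x \<partial>cm)) \<longlonglongrightarrow> norm (\<integral>x. pdual p (u x) * u x \<partial>cm)"
      by (intro tendsto_norm Lp_pairing_tendsto[OF gL dL uL q(1) p q(3) g(2)])
    moreover have "(\<lambda>n. C * ?N f * ?Nq (g n)) \<longlonglongrightarrow> C * ?N f * ?Nq (\<lambda>x. pdual p (u x))"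
      by (intro tendsto_intros Lp_nrm_tendsto[OF gL dL p1(2) g(2)])
    moreover have "norm (\<integral>x. g n x * u x \<partial>cm) \<le> C * ?N f * ?Nq (g n)" for n
      using C f u g(1) unfolding riesz_bounded_def by blast
    ultimately have "norm (\<integral>x. pdual p (u x) * u x \<partial>cm) \<le> C * ?N f * ?Nq (\<lambda>x. pdual p (u x))"
      by (intro LIMSEQ_le) auto
    moreover have "norm (\<integral>x. pdual p (u x) * u x \<partial>cm) = ?N u powr p"
      using p by (simp add: integral_pdual_mult_self Lp_mass_eq_nrm[of p])
    moreover have "?Nq (\<lambda>x. pdual p (u x)) = ?N u powr (p - 1)"
    proof -
      have "p * (1/q) = p - 1" using p by (simp add: q_def)
      then have "(?N u powr p) powr (1/q) = ?N u powr (p - 1)" by (simp only: powr_powr)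
      then show ?thesis using p by (simp add: Lp_nrm_def[of _ q] Lp_mass_pdual[OF p q(2)] Lp_mass_eq_nrm[of p])
    qed
    ultimately have le: "?N u powr p \<le> C * ?N f * ?N u powr (p - 1)" by simp
    show ?thesis
    proof (cases "?N u = 0")
      case True
      then show ?thesis using C0 by simp
    next
      case False
      then have pos: "?N u > 0" using Lp_nrm_nonneg[of cm p u] by linarith
      have "?N u * ?N u powr (p - 1) = ?N u powr p" using pos by (simp add: powr_mult_base)
      with le have "?N u * ?N u powr (p - 1) \<le> C * ?N f * ?N u powr (p - 1)" by simp
      then show ?thesis using pos by simp
    qed
  qed
  then show ?thesis using that[OF C0] by blast
qed

text \<open>Extension by continuity from the polynomials. The projected polynomials \<open>h\<close>
  belong to the conclusion because they approximate the projection by analytic polynomials.\<close>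

theorem riesz_exists:
  assumes p: "1 < p" and f: "f \<in> LpT p"
  obtains g h where "g \<in> LpT p" "is_riesz f g" "\<forall>n::nat. h n \<in> trig"
    "\<forall>n. \<forall>k<0. fc (h n) k = 0" "(\<lambda>n. nrmT p (\<lambda>x. h n x - g x)) \<longlonglongrightarrow> 0"
proof -
  let ?N = "nrmT p"
  have p1: "p \<ge> 1" using p by simp
  obtain C where C: "C \<ge> 0" "\<And>f u. f \<in> trig \<Longrightarrow> u \<in> trig \<Longrightarrow> is_riesz f u \<Longrightarrow> ?N u \<le> C * ?N f"
    using riesz_trig_bound[OF p] by blast
  obtain t where t: "\<And>n::nat. t n \<in> trig" "(\<lambda>n. ?N (\<lambda>x. t n x - f x)) \<longlonglongrightarrow> 0"
    using trig_dense[OF p f] by blast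
  have tL: "t n \<in> LpT p" for n by (rule trig_Lp_space[OF t(1) p1])
  have "\<forall>n. \<exists>u. u \<in> trig \<and> is_riesz (t n) u" using trig_riesz t(1) by metis
  then obtain h where h: "\<And>n. h n \<in> trig" "\<And>n. is_riesz (t n) (h n)" by metis
  have hL: "h n \<in> LpT p" for n by (rule trig_Lp_space[OF h(1) p1])
  have diff: "?N (\<lambda>x. h m x - h n x) \<le> C * (?N (\<lambda>x. t m x - f x) + ?N (\<lambda>x. t n x - f x))" for m n
  proof -
    have "is_riesz (\<lambda>x. t m x - t n x) (\<lambda>x. h m x - h n x)"
      using h t(1) by (auto simp: is_riesz_def fc_diff trig_integrable)
    then have "?N (\<lambda>x. h m x - h n x) \<le> C * ?N (\<lambda>x. t m x - t n x)"
      by (intro C trig_diff h t)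
    also have "\<dots> \<le> C * (?N (\<lambda>x. t m x - f x) + ?N (\<lambda>x. f x - t n x))"
      by (intro mult_left_mono Lp_nrm_triangle_diff tL f p1 C)
    finally show ?thesis by (simp add: Lp_nrm_minus_commute[of _ _ f])
  qed
  obtain g where g: "g \<in> LpT p" "(\<lambda>n. ?N (\<lambda>x. h n x - g x)) \<longlonglongrightarrow> 0"
  proof (rule Lp_complete[OF hL p1])
    fix e :: real assume e: "e > 0"
    define d where "d = e / (2 * (C + 1))"
    have d: "d > 0" using e C by (simp add: d_def)
    obtain N where N: "\<And>n. n \<ge> N \<Longrightarrow> ?N (\<lambda>x. t n x - f x) < d"
      using order_tendstoD(2)[OF t(2) d] by (auto simp: eventually_sequentially)
    have "?N (\<lambda>x. h m x - h n x) < e" if "m \<ge> N" "n \<ge> N" for m n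
    proof -
      have "?N (\<lambda>x. h m x - h n x) \<le> C * (d + d)"
        using diff[of m n] N[OF that(1)] N[OF that(2)] C(1)
          mult_left_mono[of "?N (\<lambda>x. t m x - f x) + ?N (\<lambda>x. t n x - f x)" "d + d" C] by linarith
      also have "\<dots> < (C + 1) * (d + d)" using d by simp
      also have "\<dots> = (2 * (C + 1)) * d" by simp
      also have "\<dots> = e" using C(1) by (simp add: d_def)
      finally show ?thesis .
    qed
    then show "\<exists>N. \<forall>m\<ge>N. \<forall>n\<ge>N. ?N (\<lambda>x. h m x - h n x) < e" by blast
  qed
  have "is_riesz f g"
    unfolding is_riesz_def
  proof
    fix k
    have "(\<lambda>n. fc (h n) k) \<longlonglongrightarrow> fc g k" by (rule fc_tendsto[OF hL g(1) p g(2)])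
    moreover have "(\<lambda>n. if 0 \<le> k then fc (t n) k else 0) \<longlonglongrightarrow> (if 0 \<le> k then fc f k else 0)"
      using fc_tendsto[OF tL f p t(2)] by simp
    then have "(\<lambda>n. fc (h n) k) \<longlonglongrightarrow> (if 0 \<le> k then fc f k else 0)"
      using h(2) by (simp add: is_riesz_def)
    ultimately show "fc g k = (if 0 \<le> k then fc f k else 0)" by (rule LIMSEQ_unique)
  qed
  moreover have "\<forall>n. \<forall>k<0. fc (h n) k = 0" using h(2) by (auto simp: is_riesz_def)
  ultimately show ?thesis using that[of g h] g h(1) by blast
qed

section \<open>Functions with one-sided spectrum\<close>

text \<open>Such an \<open>f\<close> is its own projection, so the polynomials of
  \<open>riesz_exists\<close> converge to it.\<close>

lemma analytic_trig_approx:
  assumes p: "1 < p" and f: "f \<in> LpT p" "\<And>k. k < 0 \<Longrightarrow> fc f k = 0"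
  obtains h where "\<forall>n::nat. h n \<in> trig" "\<forall>n. \<forall>k<0. fc (h n) k = 0"
    "(\<lambda>n. nrmT p (\<lambda>x. h n x - f x)) \<longlonglongrightarrow> 0"
proof -
  have p1: "p \<ge> 1" using p by simp
  obtain g h where g: "g \<in> LpT p" "is_riesz f g" and h: "\<forall>n::nat. h n \<in> trig"
    "\<forall>n. \<forall>k<0. fc (h n) k = 0" "(\<lambda>n. nrmT p (\<lambda>x. h n x - g x)) \<longlonglongrightarrow> 0"
    by (rule riesz_exists[OF p f(1)])
  have "fc f k = fc g k" for k
    using g(2) f(2)[of k] by (simp add: is_riesz_def)
  then have eq: "AE x in cm. f x = g x"
    using Lp_integrable_circle[OF f(1) p1] Lp_integrable_circle[OF g(1) p1] by (intro fourier_uniqueness_eq)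
  have "nrmT p (\<lambda>x. h n x - f x) = nrmT p (\<lambda>x. h n x - g x)" for n
  proof -
    have [measurable]: "h n \<in> borel_measurable cm" using h(1) trig_measurable by blast
    note [measurable] = Lp_spaceD(1)[OF f(1)] Lp_spaceD(1)[OF g(1)]
    have "Lp_mass cm p (\<lambda>x. h n x - f x) = Lp_mass cm p (\<lambda>x. h n x - g x)"
      by (rule Lp_mass_cong_AE) (use eq in auto)
    then show ?thesis by (simp add: Lp_nrm_def)
  qed
  then show ?thesis using that[OF h(1,2)] h(3) by simp
qed

text \<open>For a polynomial \<open>f\<close>, coefficient n of the product is a finite sum pairing
  index k of \<open>f\<close> with n - k of \<open>g\<close>, and one of the two is negative.
  Analytic polynomials approximate every such \<open>f\<close>, and pairing with a fixed L^q
  function is continuous.\<close>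

lemma fc_mult_analytic:
  assumes pq: "1 < p" "1 < q" "1/p + 1/q = 1"
    and f: "f \<in> LpT p" "\<And>k. k < 0 \<Longrightarrow> fc f k = 0"
    and g: "g \<in> LpT q" "\<And>k. k < 0 \<Longrightarrow> fc g k = 0" and n: "n < 0"
  shows "fc (\<lambda>x. f x * g x) n = 0"
proof -
  have p1: "p \<ge> 1" "q \<ge> 1" using pq by auto
  obtain h where h: "\<forall>n::nat. h n \<in> trig" "\<forall>n. \<forall>k<0. fc (h n) k = 0"
    "(\<lambda>n. nrmT p (\<lambda>x. h n x - f x)) \<longlonglongrightarrow> 0"
    by (rule analytic_trig_approx[OF pq(1) f])
  define g' where "g' x = ee (- n) x * g x" for x
  have g'L: "g' \<in> LpT q" unfolding g'_def by (rule Lp_ee_mult[OF g(1) p1(2)])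
  have hL: "h m \<in> LpT p" for m using trig_Lp_space h(1) p1 by blast
  have "(\<lambda>m. \<integral>x. h m x * g' x \<partial>cm) \<longlonglongrightarrow> (\<integral>x. f x * g' x \<partial>cm)"
    by (rule Lp_pairing_tendsto[OF hL f(1) g'L pq h(3)])
  moreover have "(\<integral>x. h m x * g' x \<partial>cm) = 0" for m
  proof (rule trig_pairing_zero)
    show "h m \<in> trig" using h(1) by blast
    show "integrable cm g'" by (rule Lp_integrable_circle[OF g'L p1(2)])
    fix k
    show "fc (h m) k = 0 \<or> fc g' (- k) = 0"
      using h(2) g(2)[of "n - k"] n unfolding g'_def fc_ee_mult by (cases "k < 0") auto
  qed
  ultimately have "(\<integral>x. f x * g' x \<partial>cm) = 0" by (simp add: LIMSEQ_const_iff)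
  then show ?thesis by (simp add: fc_def g'_def mult.assoc mult.commute[of _ "ee (- n) _"] mult.left_commute[of _ "ee (- n) _"])
qed

lemma fc_mult_lower:
  assumes pq: "1 < p" "1 < q" "1/p + 1/q = 1"
    and f: "f \<in> LpT p" "\<And>k. k < a \<Longrightarrow> fc f k = 0"
    and g: "g \<in> LpT q" "\<And>k. k < b \<Longrightarrow> fc g k = 0" and n: "n < a + b"
  shows "fc (\<lambda>x. f x * g x) n = 0"
proof -
  have "fc (\<lambda>x. (ee (- a) x * f x) * (ee (- b) x * g x)) (n - (a + b)) = 0"
  proof (rule fc_mult_analytic[OF pq])
    show "(\<lambda>x. ee (- a) x * f x) \<in> LpT p" "(\<lambda>x. ee (- b) x * g x) \<in> LpT q"
      using pq f g by (auto intro!: Lp_ee_mult)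
  qed (use f g n in \<open>auto simp: fc_ee_mult\<close>)
  moreover have "(ee (- a) x * f x) * (ee (- b) x * g x) = ee (- (a + b)) x * (f x * g x)" for x
  proof -
    have "(ee (- a) x * f x) * (ee (- b) x * g x) = (ee (- a) x * ee (- b) x) * (f x * g x)" by (simp only: ac_simps)
    then show ?thesis by (simp add: ee_mult)
  qed
  ultimately show ?thesis by (simp only: fc_ee_mult) simp
qed

lemma fc_mult_upper:
  assumes pq: "1 < p" "1 < q" "1/p + 1/q = 1"
    and f: "f \<in> LpT p" "\<And>k. k > a \<Longrightarrow> fc f k = 0"
    and g: "g \<in> LpT q" "\<And>k. k > b \<Longrightarrow> fc g k = 0" and n: "n > a + b"
  shows "fc (\<lambda>x. f x * g x) n = 0"
proof -
  note [measurable] = Lp_spaceD(1)[OF f(1)] Lp_spaceD(1)[OF g(1)]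
  have "fc (\<lambda>x. f (crev x) * g (crev x)) (- n) = 0"
    by (rule fc_mult_lower[OF pq Lp_space_crev[OF f(1)] _ Lp_space_crev[OF g(1)], where a = "- a" and b = "- b"])
      (use f g n in \<open>auto simp: fc_crev\<close>)
  then show ?thesis using fc_crev[of "\<lambda>x. f x * g x" "- n"] by simp
qed

text \<open>Let \<open>u\<close> be the difference of \<open>f\<close> and its best approximation from the span of the \<open>t\<^sup>k f\<close> with
  \<open>k \<ge> 1\<close>. Then \<open>|u|\<^sup>p\<close> is orthogonal to all \<open>t\<^sup>j\<close> with \<open>j \<noteq> 0\<close>, hence constant, while
  \<open>u\<close> vanishes wherever \<open>f\<close> does.\<close>

theorem analytic_nonzero_AE:
  assumes p: "1 < p" and f: "f \<in> LpT p" "\<And>k. k < 0 \<Longrightarrow> fc f k = 0"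
    and nz: "\<not> (AE x in cm. f x = 0)"
  shows "AE x in cm. f x \<noteq> 0"
proof -
  let ?N = "nrmT p"
  define q where "q = p / (p - 1)"
  have q: "q > 1" "1/p + 1/q = 1" "1/q + 1/p = 1" using p by (auto simp: q_def field_simps)
  have p1: "p \<ge> 1" "q \<ge> 1" using p q by auto
  have "\<exists>k. fc f k \<noteq> 0" using fourier_uniqueness[OF Lp_integrable_circle[OF f(1) p1(1)]] nz by blast
  then obtain k where k: "fc f k \<noteq> 0" by blast
  then have "k \<ge> 0" using f(2)[of k] by force
  define N where "N = (LEAST n::nat. fc f (int n) \<noteq> 0)"
  have N1: "fc f (int N) \<noteq> 0" unfolding N_def
    by (rule LeastI[of _ "nat k"]) (use k \<open>k \<ge> 0\<close> in simp)
  have N2: "fc f j = 0" if "j < int N" for j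
  proof (cases "j < 0")
    case False
    then have "nat j < N" using that by linarith
    then have "fc f (int (nat j)) = 0" unfolding N_def using not_less_Least by blast
    then show ?thesis using False by simp
  qed (rule f(2))
  \<comment> \<open>The shift moves the first nonzero coefficient to index 0. This separates
    \<open>g\<close> from \<open>V\<close>, whose elements have mean zero.\<close>
  define g where "g x = ee (- int N) x * f x" for x
  have g: "g \<in> LpT p" unfolding g_def by (rule Lp_ee_mult[OF f(1) p1(1)])
  have g0: "fc g 0 \<noteq> 0" "\<And>j. j < 0 \<Longrightarrow> fc g j = 0" using N1 N2 by (auto simp: g_def[abs_def] fc_ee_mult)
  define T where "T = {t \<in> trig. \<forall>n\<le>0. fc t n = 0}"
  define V where "V = (\<lambda>t x. t x * g x) ` T"
  have Tadd: "(\<lambda>x. s x + t x) \<in> T" if "s \<in> T" "t \<in> T" for s t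
    using that by (auto simp: T_def fc_add trig_integrable intro: trig.add)
  have Tcm: "(\<lambda>x. c * t x) \<in> T" if "t \<in> T" for t c
    using that by (auto simp: T_def fc_cmult intro: trig.cmult)
  have T0: "(\<lambda>x. 0) \<in> T" using trig_const[of 0] by (simp add: T_def)
  have Tee: "ee j \<in> T" if "j \<ge> 1" for j using that by (auto simp: T_def fc_ee trig.ee)
  have Tshift: "(\<lambda>x. ee j x * t x) \<in> T" if "t \<in> T" "j \<ge> 1" for t j
    using that by (auto simp: T_def fc_ee_mult intro!: trig_mult trig.ee)
  have TL: "(\<lambda>x. t x * g x) \<in> LpT p" if "t \<in> T" for t
  proof -
    have "t \<in> trig" using that by (simp add: T_def)
    then have "\<exists>B. \<forall>x. norm (t x) \<le> B"
    proof (induction rule: trig.induct)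
      case (ee n) then show ?case by (intro exI[of _ 1]) simp
    next
      case (cmult s c)
      then obtain B where "\<forall>x. norm (s x) \<le> B" by blast
      then show ?case by (intro exI[of _ "norm c * B"]) (auto simp: norm_mult intro: mult_left_mono)
    next
      case (add s t)
      then obtain B D where "\<forall>x. norm (s x) \<le> B" "\<forall>x. norm (t x) \<le> D" by blast
      then show ?case by (intro exI[of _ "B + D"]) (auto intro: norm_triangle_mono)
    qed
    then obtain B where "\<forall>x. norm (t x) \<le> B" by blast
    then show ?thesis
      by (intro Lp_space_mult_bounded[OF g trig_measurable[OF \<open>t \<in> trig\<close>] _ p1(1), of B]) auto
  qed
  have V1: "V \<subseteq> LpT p" using TL by (auto simp: V_def)
  have V2: "(\<lambda>x. 0) \<in> V" unfolding V_def by (rule image_eqI[OF _ T0]) simp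
  have V3: "(\<lambda>x. v x + w x) \<in> V" if "v \<in> V" "w \<in> V" for v w
  proof -
    from that obtain s t where st: "s \<in> T" "t \<in> T" "v = (\<lambda>x. s x * g x)" "w = (\<lambda>x. t x * g x)" by (auto simp: V_def)
    show ?thesis unfolding V_def by (rule image_eqI[OF _ Tadd[OF st(1,2)]]) (simp add: st distrib_right)
  qed
  have V4: "(\<lambda>x. c * v x) \<in> V" if "v \<in> V" for v c
  proof -
    from that obtain t where t: "t \<in> T" "v = (\<lambda>x. t x * g x)" by (auto simp: V_def)
    show ?thesis unfolding V_def by (rule image_eqI[OF _ Tcm[OF t(1)]]) (simp add: t mult.assoc)
  qed
  \<comment> \<open>Hoelder's inequality against the constant 1 bounds the mean of g - v, which is
    the mean of \<open>g\<close>; the added 1 keeps the denominator positive.\<close>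
  define e where "e = norm (fc g 0) / (nrmT q (\<lambda>x. 1) + 1)"
  have e: "e > 0" using g0 by (simp add: e_def add_nonneg_pos)
  have far: "e \<le> ?N (\<lambda>x. g x - v x)" if v: "v \<in> V" for v
  proof -
    from v obtain t where t: "t \<in> T" "v = (\<lambda>x. t x * g x)" by (auto simp: V_def)
    have tt: "t \<in> LpT q" using t p1 trig_Lp_space by (auto simp: T_def)
    have vL: "v \<in> LpT p" using v V1 by blast
    have "fc v 0 = 0" unfolding t(2)
      by (rule fc_mult_lower[OF q(1) p q(3) tt _ g, of 1 0]) (use t g0 in \<open>auto simp: T_def\<close>)
    then have "fc g 0 = fc (\<lambda>x. g x - v x) 0"
      using fc_diff[OF Lp_integrable_circle[OF g p1(1)] Lp_integrable_circle[OF vL p1(1)], of 0] by simp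
    also have "norm \<dots> \<le> ?N (\<lambda>x. g x - v x) * nrmT q (\<lambda>x. 1)"
      using Lp_Holder[OF Lp_space_diff[OF g vL p1(1)] trig_Lp_space[OF trig_const[of 1] p1(2)] p q(1,2)]
      by (simp add: fc_def)
    also have "\<dots> \<le> ?N (\<lambda>x. g x - v x) * (nrmT q (\<lambda>x. 1) + 1)"
      by (intro mult_left_mono) auto
    finally show ?thesis unfolding e_def by (subst pos_divide_le_eq) (auto simp: add_nonneg_pos)
  qed
  obtain u v where u: "u \<in> LpT p" and v: "\<forall>n. v n \<in> V"
    and lim: "(\<lambda>n. ?N (\<lambda>x. g x - v n x - u x)) \<longlonglongrightarrow> 0" and upos: "?N u > 0"
    and orth: "\<forall>m\<in>V. (\<integral>x. pdual p (u x) * m x \<partial>cm) = 0"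
    by (rule Lp_best_approximation[OF p V1 V2 V3 V4 g e far])
  note [measurable] = Lp_spaceD(1)[OF u] Lp_spaceD(1)[OF g]
  define U where "U x = complex_of_real (norm (u x) powr p)" for x
  have Ui: "integrable cm U" using Lp_spaceD(2)[OF u] by (simp add: U_def[abs_def])
  have Uneg: "fc U (- j) = 0" if j: "j \<ge> 1" for j
  proof -
    \<comment> \<open>\<open>u\<close> is only a limit of g - v n, so orthogonality is applied to
      t^j (g - v n), which lies in \<open>V\<close> for j >= 1 and tends to t^j u.\<close>
    define w where "w n x = ee j x * (g x - v n x)" for n x
    have vL: "v n \<in> LpT p" for n using v V1 by blast
    have wL: "w n \<in> LpT p" for n
      unfolding w_def by (intro Lp_ee_mult Lp_space_diff g vL p1)
    have wV: "w n \<in> V" for n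
    proof -
      obtain t where t: "t \<in> T" "v n = (\<lambda>x. t x * g x)" using v by (auto simp: V_def)
      have "(\<lambda>x. ee j x + (-1) * (ee j x * t x)) \<in> T" by (intro Tadd Tcm Tshift Tee t j)
      then show ?thesis unfolding V_def by (rule image_eqI[rotated]) (auto simp: w_def t(2) algebra_simps)
    qed
    have euL: "(\<lambda>x. ee j x * u x) \<in> LpT p" by (rule Lp_ee_mult[OF u p1(1)])
    have dL: "(\<lambda>x. pdual p (u x)) \<in> LpT q" by (rule pdual_Lp_space[OF u p q(2)])
    have "?N (\<lambda>x. w n x - ee j x * u x) = ?N (\<lambda>x. g x - v n x - u x)" for n
    proof -
      have "norm (w n x - ee j x * u x) = norm (g x - v n x - u x)" for x
        unfolding w_def right_diff_distrib[symmetric] by (simp add: norm_mult)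
      then show ?thesis by (simp add: Lp_nrm_def Lp_mass_def)
    qed
    then have "(\<lambda>n. ?N (\<lambda>x. w n x - ee j x * u x)) \<longlonglongrightarrow> 0" using lim by simp
    then have "(\<lambda>n. \<integral>x. w n x * pdual p (u x) \<partial>cm) \<longlonglongrightarrow> (\<integral>x. (ee j x * u x) * pdual p (u x) \<partial>cm)"
      by (rule Lp_pairing_tendsto[OF wL euL dL p q(1,2)])
    moreover have "(\<integral>x. w n x * pdual p (u x) \<partial>cm) = 0" for n
      using orth wV by (simp add: mult.commute)
    ultimately have z: "(\<integral>x. (ee j x * u x) * pdual p (u x) \<partial>cm) = 0" by (simp add: LIMSEQ_const_iff)
    have "(ee j x * u x) * pdual p (u x) = U x * ee j x" for x
      using pdual_mult_self[OF p, of "u x"] by (simp add: U_def mult.commute mult.left_commute)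
    with z have "(\<integral>x. U x * ee j x \<partial>cm) = 0" by (simp only:)
    then show ?thesis by (simp add: fc_def)
  qed
  have Upos: "fc U j = 0" if "j \<ge> 1" for j
    using fc_cnj[of U j] Uneg[OF that] by (simp add: U_def[abs_def])
  define c where "c = fc U 0 / of_real (2*pi)"
  have "AE x in cm. U x = c"
  proof (rule fourier_uniqueness_eq[OF Ui])
    fix n
    have "fc (\<lambda>x. c) n = (if n = 0 then fc U 0 else 0)"
      using fc_cmult[of c "ee 0" n] by (auto simp: fc_ee c_def)
    then show "fc U n = fc (\<lambda>x. c) n"
      using Uneg[of "- n"] Upos[of n] by (cases "n = 0"; cases "n > 0") auto
  qed simp
  moreover have "c \<noteq> 0"
  proof -
    have "fc U 0 = of_real (Lp_mass cm p u)" by (simp add: fc_def U_def Lp_mass_def)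
    moreover have "Lp_mass cm p u \<noteq> 0" using upos p by (auto simp: Lp_nrm_def)
    ultimately show ?thesis by (simp add: c_def)
  qed
  ultimately have une: "AE x in cm. u x \<noteq> 0"
    by (auto simp: U_def elim: eventually_mono)
  \<comment> \<open>Every \<open>v n\<close> is a multiple of \<open>g\<close>, so where
    \<open>g\<close> vanishes g - v n - u equals -u. Convergence in norm then gives E = 0 without
    passing to a subsequence that converges almost everywhere.\<close>
  define E where "E x = (if g x = 0 then u x else 0)" for x
  have Em: "E \<in> borel_measurable cm" unfolding E_def by measurable
  have EL: "E \<in> LpT p"
    by (rule Lp_space_bound[OF Em Lp_spaceD(2)[OF u]]) (auto simp: E_def)
  have "Lp_mass cm p E \<le> ?N (\<lambda>x. g x - v n x - u x) powr p" for n
  proof -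
    have vL: "v n \<in> LpT p" using v V1 by blast
    obtain t where t: "v n = (\<lambda>x. t x * g x)" using v by (auto simp: V_def)
    have dL: "(\<lambda>x. g x - v n x - u x) \<in> LpT p" by (intro Lp_space_diff g vL u p1)
    have "Lp_mass cm p E \<le> Lp_mass cm p (\<lambda>x. g x - v n x - u x)"
      unfolding Lp_mass_def
      by (rule integral_mono[OF Lp_spaceD(2)[OF EL] Lp_spaceD(2)[OF dL]]) (auto simp: E_def t)
    then show ?thesis using p by (simp add: Lp_mass_eq_nrm)
  qed
  moreover have "(\<lambda>n. ?N (\<lambda>x. g x - v n x - u x) powr p) \<longlonglongrightarrow> 0 powr p"
    using p by (intro tendsto_powr' lim tendsto_const) auto
  ultimately have "Lp_mass cm p E \<le> 0 powr p" by (intro LIMSEQ_le_const) auto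
  then have "Lp_mass cm p E = 0" using Lp_mass_nonneg[of cm p E] p by simp
  then have "AE x in cm. E x = 0" using Lp_mass_eq_0_iff[OF EL] by simp
  with une show ?thesis by eventually_elim (auto simp: E_def g_def split: if_splits)
qed

section \<open>Toeplitz plus Hankel operators\<close>

text \<open>For \<open>f\<close> in \<open>H\<^sup>p\<close> the operators send \<open>f\<close> to the Riesz projection of \<open>a \<phi>\<close> with
  \<open>\<phi> = f + \<sigma> t\<^sup>m J f\<close>; the four operators correspond to the admissible pairs \<open>(m, \<sigma>)\<close> below.\<close>

definition symm :: "int \<Rightarrow> complex \<Rightarrow> (real \<Rightarrow> complex) \<Rightarrow> real \<Rightarrow> complex" where
  "symm m \<sigma> u x = u x + \<sigma> * (ee (m - 1) x * u (crev x))"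

definition admissible :: "int \<Rightarrow> complex \<Rightarrow> bool" where
  "admissible m \<sigma> \<longleftrightarrow> (m, \<sigma>) \<in> {(1, 1), (-1, -1), (0, 1), (0, -1)}"

lemma admissible_square: "admissible m \<sigma> \<Longrightarrow> \<sigma> * \<sigma> = 1"
  by (auto simp: admissible_def)

lemma symm_Lp_space:
  assumes "u \<in> LpT p" "p \<ge> 1"
  shows "symm m \<sigma> u \<in> LpT p"
  unfolding symm_def[abs_def]
  by (intro Lp_space_add Lp_space_cmult Lp_ee_mult Lp_space_crev assms)

lemma fc_symm:
  assumes "u \<in> LpT p" "p \<ge> 1"
  shows "fc (symm m \<sigma> u) n = fc u n + \<sigma> * fc u (m - 1 - n)"
proof -
  have "fc (symm m \<sigma> u) n = fc u n + fc (\<lambda>x. \<sigma> * (ee (m - 1) x * u (crev x))) n"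
    unfolding symm_def[abs_def]
    by (intro fc_add Lp_integrable_circle[OF _ assms(2)] Lp_space_cmult Lp_ee_mult Lp_space_crev assms)
  also have "\<dots> = fc u n + \<sigma> * fc u (- (n - (m - 1)))"
    unfolding fc_cmult fc_ee_mult fc_crev[OF Lp_spaceD(1)[OF assms(1)]] ..
  finally show ?thesis by simp
qed

text \<open>The identity \<chi> J \<phi> = \<phi> in the parameter. It is confined to the interval
  because \<open>crev\<close> is an involution only there.\<close>

lemma symm_crev:
  assumes "\<sigma> * \<sigma> = 1" "x \<in> {0..<2*pi}"
  shows "symm m \<sigma> u (crev x) = \<sigma> * ee (1 - m) x * symm m \<sigma> u x"
proof -
  have "ee (1 - m) x * ee (m - 1) x = 1" by (simp add: ee_mult)
  then have "\<sigma> * ee (1 - m) x * (\<sigma> * (ee (m - 1) x * u (crev x))) = u (crev x)"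
    using assms(1) by (metis mult.assoc mult.left_commute mult_1)
  then show ?thesis using crev_crev[OF assms(2)]
    by (simp add: symm_def ee_crev distrib_left mult.assoc)
qed

lemma symm_add: "symm m \<sigma> (\<lambda>x. u x + v x) x = symm m \<sigma> u x + symm m \<sigma> v x"
  by (simp add: symm_def algebra_simps)

lemma symm_cmult: "symm m \<sigma> (\<lambda>x. c * u x) x = c * symm m \<sigma> u x"
  by (simp add: symm_def algebra_simps)

text \<open>A nontrivial kernel forces every annihilator of the range to annihilate H^p. The
  conclusion is not k = 0, since pairings with H^p leave the coefficients of \<open>k\<close> at n
  >= 1 undetermined; it is \<open>k1\<close> below that vanishes.\<close>

theorem annihilator_of_range:
  assumes pq: "1 < p" "1 < q" "1/p + 1/q = 1" and adm: "admissible m \<sigma>"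
    and a: "a \<in> borel_measurable cm" "AE x in cm. norm (a x) \<le> B"
      "AE x in cm. a x \<noteq> 0"
    and u0: "u0 \<in> LpT p" "\<And>n. n < 0 \<Longrightarrow> fc u0 n = 0" "\<not> (AE x in cm. u0 x = 0)"
    and ker: "\<And>n. n \<ge> 0 \<Longrightarrow> fc (\<lambda>x. a x * symm m \<sigma> u0 x) n = 0"
    and k: "k \<in> LpT q"
    and ann: "\<And>u w. u \<in> LpT p \<Longrightarrow> (\<And>n. n < 0 \<Longrightarrow> fc u n = 0) \<Longrightarrow> w \<in> LpT p
        \<Longrightarrow> is_riesz (\<lambda>x. a x * symm m \<sigma> u x) w \<Longrightarrow> (\<integral>x. w x * k x \<partial>cm) = 0"
    and g: "g \<in> LpT p" "\<And>n. n < 0 \<Longrightarrow> fc g n = 0"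
  shows "(\<integral>x. g x * k x \<partial>cm) = 0"
proof -
  have p1: "p \<ge> 1" "q \<ge> 1" using pq by auto
  have sq: "\<sigma> * \<sigma> = 1" using adm by (rule admissible_square)
  have int0: "(\<integral>x. f x \<partial>cm) = fc f 0" for f by (simp add: fc_def)
  have aL: "(\<lambda>x. a x * f x) \<in> LpT r" if "f \<in> LpT r" "r \<ge> 1" for f r
    by (rule Lp_space_mult_bounded[OF that(1) a(1,2) that(2)])
  \<comment> \<open>Shifting by one before projecting isolates the indices n >= 1 of
    \<open>k\<close>; the coefficient at 0 stays in \<open>k1\<close>.\<close>
  obtain R where R: "R \<in> LpT q" "is_riesz (\<lambda>x. ee (-1) x * k x) R"
    using riesz_exists[OF pq(2) Lp_ee_mult[OF k p1(2), of "-1"]] by metis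
  define R1 where "R1 x = ee 1 x * R x" for x
  have R1: "R1 \<in> LpT q" unfolding R1_def by (rule Lp_ee_mult[OF R(1) p1(2)])
  have fcR1: "fc R1 n = (if n \<ge> 1 then fc k n else 0)" for n
    using R(2) unfolding R1_def fc_ee_mult is_riesz_def by simp
  define k1 where "k1 x = k x - R1 x" for x
  have k1: "k1 \<in> LpT q" unfolding k1_def by (rule Lp_space_diff[OF k R1 p1(2)])
  have fck1: "fc k1 n = 0" if "n > 0" for n
    unfolding k1_def using fc_diff[OF Lp_integrable_circle[OF k p1(2)] Lp_integrable_circle[OF R1 p1(2)], of n] fcR1[of n] that
    by simp
  have k_k1: "(\<integral>x. w x * k x \<partial>cm) = (\<integral>x. w x * k1 x \<partial>cm)"
    if w: "w \<in> LpT p" "\<And>n. n < 0 \<Longrightarrow> fc w n = 0" for w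
  proof -
    have "fc (\<lambda>x. w x * R1 x) 0 = 0"
      by (rule fc_mult_lower[OF pq w(1) _ R1, where a = 0 and b = 1]) (use w fcR1 in auto)
    then have "(\<integral>x. w x * R1 x \<partial>cm) = 0" by (simp add: int0)
    then show ?thesis
      using Lp_mult_integrable[OF w(1) k pq] Lp_mult_integrable[OF w(1) R1 pq]
      by (simp add: k1_def right_diff_distrib)
  qed
  have step2: "(\<integral>x. (a x * symm m \<sigma> u x) * k1 x \<partial>cm) = 0"
    if u: "u \<in> LpT p" "\<And>n. n < 0 \<Longrightarrow> fc u n = 0" for u
  proof -
    define s where "s x = a x * symm m \<sigma> u x" for x
    have s: "s \<in> LpT p" unfolding s_def by (intro aL symm_Lp_space u p1)
    obtain w where w: "w \<in> LpT p" "is_riesz s w"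
      using riesz_exists[OF pq(1) s] by metis
    have w0: "fc w n = 0" if "n < 0" for n using w(2) that by (simp add: is_riesz_def)
    have "(\<integral>x. w x * k x \<partial>cm) = 0"
      using ann[OF u w(1)] w(2) by (simp add: s_def[abs_def])
    then have wk: "(\<integral>x. w x * k1 x \<partial>cm) = 0" using k_k1[OF w(1) w0] by simp
    \<comment> \<open>s - w has spectrum in n <= -1 and \<open>k1\<close> in n <= 0, so their
      product has mean zero: against \<open>k1\<close> the projection \<open>w\<close> may be
      replaced by \<open>s\<close>.\<close>
    have "fc (\<lambda>x. (s x - w x) * k1 x) 0 = 0"
    proof (rule fc_mult_upper[OF pq _ _ k1 fck1, where a = "-1" and b = 0])
      show "(\<lambda>x. s x - w x) \<in> LpT p" by (rule Lp_space_diff[OF s w(1) p1(1)])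
      show "fc (\<lambda>x. s x - w x) n = 0" if "n > -1" for n
        using fc_diff[OF Lp_integrable_circle[OF s p1(1)] Lp_integrable_circle[OF w(1) p1(1)], of n] w(2) that
        by (simp add: is_riesz_def)
    qed auto
    then have "(\<integral>x. s x * k1 x \<partial>cm) = (\<integral>x. w x * k1 x \<partial>cm)"
      using Lp_mult_integrable[OF s k1 pq] Lp_mult_integrable[OF w(1) k1 pq]
      by (simp add: left_diff_distrib flip: int0)
    then show ?thesis using wk by (simp add: s_def)
  qed
  define w1 where "w1 x = a x * k1 x" for x
  have w1: "w1 \<in> LpT q" unfolding w1_def by (rule aL[OF k1 p1(2)])
  \<comment> \<open>\<open>\<psi> = a k\<^sub>1 + \<sigma> t\<^sup>1\<^sup>-\<^sup>m (a k\<^sub>1)(1/t)\<close>, whose spectrum lies in \<open>{1, 2, \<dots>}\<close> and is invariant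
    under \<open>j \<mapsto> 1 - m - j\<close>.\<close>
  define psi where "psi = symm (2 - m) \<sigma> w1"
  have psiL: "psi \<in> LpT q" unfolding psi_def by (rule symm_Lp_space[OF w1 p1(2)])
  have fpsi: "fc psi j = fc w1 j + \<sigma> * fc w1 (1 - m - j)" for j
    unfolding psi_def fc_symm[OF w1 p1(2)] by simp
  have psi_neg: "fc psi j = 0" if "j \<le> 0" for j
  proof -
    \<comment> \<open>The monomial \<open>ee (- j)\<close> is analytic for j <= 0, and testing with
      it reads off coefficient j of \<open>psi\<close>.\<close>
    have z: "(\<integral>x. (a x * symm m \<sigma> (ee (- j)) x) * k1 x \<partial>cm) = 0"
      by (rule step2) (use that pq in \<open>auto simp: fc_ee\<close>)
    have "(a x * symm m \<sigma> (ee (- j)) x) * k1 x = w1 x * ee (- j) x + \<sigma> * (w1 x * ee (- (1 - m - j)) x)" for x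
    proof -
      have "ee (m - 1) x * ee j x = ee (- (1 - m - j)) x" by (simp add: ee_mult algebra_simps)
      then show ?thesis by (simp add: symm_def w1_def ee_crev algebra_simps)
    qed
    with z have "(\<integral>x. w1 x * ee (- j) x + \<sigma> * (w1 x * ee (- (1 - m - j)) x) \<partial>cm) = 0"
      by (simp only:)
    then show ?thesis
      using integrable_ee_mult[OF Lp_integrable_circle[OF w1 p1(2)]] unfolding fpsi by (simp add: fc_def)
  qed
  have psi_refl: "fc psi (1 - m - j) = \<sigma> * fc psi j" for j
  proof -
    have "\<sigma> * (\<sigma> * fc w1 (1 - m - j)) = fc w1 (1 - m - j)" using sq by (metis mult.assoc mult_1)
    then show ?thesis by (simp add: fpsi distrib_left)
  qed
  have "fc psi j = 0" for j
  proof (cases "j \<le> 0")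
    case False
    consider "1 - m - j \<le> 0" | "m = -1" "\<sigma> = -1" "j = 1"
      using False adm by (auto simp: admissible_def) linarith
    then show ?thesis
    proof cases
      case 1
      then have "\<sigma> * fc psi j = 0" using psi_refl[of j] psi_neg by simp
      then show ?thesis using sq by auto
    next
      case 2
      then show ?thesis using psi_refl[of j] by simp
    qed
  qed (rule psi_neg)
  then have psi0: "AE x in cm. psi x = 0"
    by (intro fourier_uniqueness Lp_integrable_circle[OF psiL p1(2)])
  define A0 where "A0 x = a x * symm m \<sigma> u0 x" for x
  have A0: "A0 \<in> LpT p" unfolding A0_def by (intro aL symm_Lp_space u0 p1)
  have fA0: "fc A0 n = 0" if "n > -1" for n using ker[of n] that by (simp add: A0_def[abs_def])
  define h where "h x = A0 x * k1 x" for x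
  have hi: "integrable cm h" unfolding h_def by (rule Lp_mult_integrable[OF A0 k1 pq])
  have hm[measurable]: "h \<in> borel_measurable cm" using hi by auto
  \<comment> \<open>The upper bounds -1 and 0 of the two spectra add up to -1; oddness will carry
    this over to the negative indices.\<close>
  have h_nonneg: "fc h n = 0" if "n \<ge> 0" for n
    unfolding h_def by (rule fc_mult_upper[OF pq A0 fA0 k1 fck1]) (use that in auto)
  \<comment> \<open>Reflection multiplies the symmetrised \<open>u0\<close> by \<sigma> t^(1-m), the
    very factor in \<open>psi\<close>; as \<open>psi\<close> vanishes, moving it to
    \<open>w1\<close> leaves only a sign.\<close>
  have h_odd: "AE x in cm. h (crev x) = - h x"
  proof -
    have "AE x in cm. x \<in> {0..<2*pi}" by (rule AE_I2) simp
    with psi0 show ?thesis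
    proof eventually_elim
      case (elim x)
      have "h (crev x) = symm m \<sigma> u0 (crev x) * w1 (crev x)" by (simp add: h_def A0_def w1_def)
      also have "\<dots> = symm m \<sigma> u0 x * (\<sigma> * (ee (1 - m) x * w1 (crev x)))"
        unfolding symm_crev[OF sq elim(2)] by simp
      also have "\<sigma> * (ee (1 - m) x * w1 (crev x)) = - w1 x"
        using elim(1) by (simp add: psi_def symm_def add_eq_0_iff)
      finally show ?case by (simp add: h_def A0_def w1_def)
    qed
  qed
  have "fc h n = 0" for n
  proof (cases "n \<ge> 0")
    case False
    have "fc h n = fc (\<lambda>x. h (crev x)) (- n)" using fc_crev[OF hm, of "- n"] by simp
    also have "\<dots> = fc (\<lambda>x. (-1) * h x) (- n)"
      by (rule fc_cong_AE) (use h_odd in auto)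
    also have "\<dots> = 0" unfolding fc_cmult using h_nonneg[of "- n"] False by simp
    finally show ?thesis .
  qed (rule h_nonneg)
  then have h0: "AE x in cm. h x = 0" by (intro fourier_uniqueness hi)
  have sp: "AE x in cm. x \<in> {0..<2*pi}" by (rule AE_I2) simp
  have A0_ne: "\<not> (AE x in cm. A0 x = 0)"
  proof
    assume "AE x in cm. A0 x = 0"
    with a(3) have "AE x in cm. symm m \<sigma> u0 x = 0" by eventually_elim (simp add: A0_def)
    then have "fc (symm m \<sigma> u0) n = fc (\<lambda>x. 0) n" for n
      using Lp_spaceD(1)[OF symm_Lp_space[OF u0(1) p1(1)]] by (intro fc_cong_AE) auto
    then have z: "fc u0 n + \<sigma> * fc u0 (m - 1 - n) = 0" for n using fc_symm[OF u0(1) p1(1)] by simp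
    have "fc u0 n = 0" for n
    proof (cases "n \<ge> 0")
      case True
      consider "m - 1 - n < 0" | "m = 1" "\<sigma> = 1" "n = 0"
        using True adm by (auto simp: admissible_def) linarith
      then show ?thesis
      proof cases
        case 1
        then show ?thesis using z[of n] u0(2)[of "m - 1 - n"] by simp
      next
        case 2
        then show ?thesis using z[of 0] by simp
      qed
    qed (use u0(2) in simp)
    then have "AE x in cm. u0 x = 0"
      by (intro fourier_uniqueness Lp_integrable_circle[OF u0(1) p1(1)])
    with u0(3) show False ..
  qed
  \<comment> \<open>\<open>A0\<close> is anti-analytic, so the nonvanishing theorem is applied to
    its reflection.\<close>
  have "AE x in cm. A0 (crev x) \<noteq> 0"
  proof (rule analytic_nonzero_AE[OF pq(1) Lp_space_crev[OF A0]])
    show "fc (\<lambda>x. A0 (crev x)) n = 0" if "n < 0" for n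
      using fc_crev[OF Lp_spaceD(1)[OF A0], of n] fA0[of "- n"] that by simp
    show "\<not> (AE x in cm. A0 (crev x) = 0)"
    proof
      assume "AE x in cm. A0 (crev x) = 0"
      from AE_crev[OF this] sp have "AE x in cm. A0 x = 0"
        by eventually_elim (simp add: crev_crev)
      with A0_ne show False ..
    qed
  qed
  from AE_crev[OF this] sp h0 have "AE x in cm. g x * k1 x = 0"
    by eventually_elim (auto simp: crev_crev h_def)
  then have "(\<integral>x. g x * k1 x \<partial>cm) = (\<integral>x. 0 \<partial>cm)"
    using Lp_mult_integrable[OF g(1) k1 pq] by (intro integral_cong_AE) auto
  then show ?thesis using k_k1[OF g] by simp
qed

section \<open>Transfer between functions of the parameter and functions on the plane\<close>

lemma inLp_iff: "inLp p f \<longleftrightarrow> circ f \<in> LpT p"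
  by (simp add: inLp_def Lp_space_def circ_def)

lemma Hp_iff: "Hp p f \<longleftrightarrow> circ f \<in> LpT p \<and> (\<forall>n<0. fc (circ f) n = 0)"
  by (simp add: Hp_def inLp_iff fourier_eq_fc)

text \<open>\<open>Arg2pi\<close> inverts \<open>cis\<close> on [0, 2 pi), so every function of the
  parameter comes from a function on the plane.\<close>

lemma circ_Arg2pi: "x \<in> {0..<2*pi} \<Longrightarrow> circ (\<lambda>z. u (Arg2pi z)) x = u x"
  by (simp add: circ_def Arg2pi_cis)

lemma circ_Arg2pi_AE: "AE x in cm. u x = circ (\<lambda>z. u (Arg2pi z)) x"
  by (rule AE_I2) (simp add: circ_Arg2pi)

lemma circ_Arg2pi_Lp_space:
  assumes "u \<in> LpT p"
  shows "circ (\<lambda>z. u (Arg2pi z)) \<in> LpT p"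
proof (rule Lp_space_cong_AE[OF assms _ circ_Arg2pi_AE])
  show "circ (\<lambda>z. u (Arg2pi z)) \<in> borel_measurable cm"
    using Lp_spaceD(1)[OF assms] by (rule measurable_cong[THEN iffD1, rotated]) (simp add: circ_Arg2pi)
qed

text \<open>The theorem of M. Riesz supplies the witness that the choice in \<open>riesz\<close>
  depends on.\<close>

lemma riesz_spec:
  assumes p: "p > 1" and f: "circ f \<in> LpT p"
  shows "circ (riesz p f) \<in> LpT p" "is_riesz (circ f) (circ (riesz p f))"
proof -
  obtain u where u: "u \<in> LpT p" "is_riesz (circ f) u"
    using riesz_exists[OF p f] by metis
  define g where "g z = u (Arg2pi z)" for z
  have g: "circ g \<in> LpT p" unfolding g_def by (rule circ_Arg2pi_Lp_space[OF u(1)])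
  have "fc u n = fc (circ g) n" for n
    by (rule fc_cong_AE[OF Lp_spaceD(1)[OF u(1)] Lp_spaceD(1)[OF g]]) (unfold g_def, rule circ_Arg2pi_AE)
  then have "inLp p g \<and> (\<forall>n. fourier g n = (if n \<ge> 0 then fourier f n else 0))"
    using g u(2) by (simp add: inLp_iff fourier_eq_fc is_riesz_def)
  then have "inLp p (riesz p f) \<and> (\<forall>n. fourier (riesz p f) n = (if n \<ge> 0 then fourier f n else 0))"
    unfolding riesz_def
    by (rule someI[where P = "\<lambda>g. inLp p g \<and> (\<forall>n. fourier g n = (if n \<ge> 0 then fourier f n else 0))"])
  then show "circ (riesz p f) \<in> LpT p" "is_riesz (circ f) (circ (riesz p f))"
    by (auto simp: inLp_iff fourier_eq_fc is_riesz_def split: if_splits)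
qed

lemma circ_flipJ: "circ (flipJ f) x = ee (-1) x * circ f (crev x)"
  by (simp add: circ_def flipJ_def ee_def cis_crev)

text \<open>J sends spectrum n >= 0 to n <= -1, so P J f = 0 and Q J f = J f almost everywhere. The
  Hankel term is then the projection of a t^m J f, and the two projections combine into one.\<close>

lemma toeplitz_plus_hankel:
  assumes p: "p > 1" and f: "Hp p f"
    and a: "circ a \<in> borel_measurable cm" "AE x in cm. norm (circ a x) \<le> B"
    and b: "\<And>x. circ b x = ee m x * circ a x"
    and A: "\<And>t. A f t = toeplitz p a f t + \<sigma> * hankel p b f t"
  shows "circ (A f) \<in> LpT p"
    "is_riesz (\<lambda>x. circ a x * symm m \<sigma> (circ f) x) (circ (A f))"
proof -
  have p1: "p \<ge> 1" using p by simp
  have fL: "circ f \<in> LpT p" and f0: "\<And>n. n < 0 \<Longrightarrow> fc (circ f) n = 0"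
    using f by (auto simp: Hp_iff)
  note aL = Lp_space_mult_bounded[OF _ a p1]
  have JL: "circ (flipJ f) \<in> LpT p"
    unfolding circ_flipJ[abs_def] by (intro Lp_ee_mult Lp_space_crev fL p1)
  note rJ = riesz_spec[OF p JL]
  have "fc (circ (riesz p (flipJ f))) n = 0" for n
  proof -
    have "fc (circ (flipJ f)) n = fc (circ f) (- (n + 1))"
      unfolding circ_flipJ[abs_def] fc_ee_mult fc_crev[OF Lp_spaceD(1)[OF fL]] by simp
    then show ?thesis using rJ(2) f0[of "- (n + 1)"] by (auto simp: is_riesz_def)
  qed
  then have "AE x in cm. circ (riesz p (flipJ f)) x = 0"
    by (intro fourier_uniqueness Lp_integrable_circle[OF rJ(1) p1])
  then have Q: "AE x in cm. circ (rieszQ p (flipJ f)) x = ee (-1) x * circ f (crev x)"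
    by eventually_elim (simp add: rieszQ_def circ_def flipJ_def ee_def cis_crev)
  have QL: "circ (rieszQ p (flipJ f)) \<in> LpT p"
    using Lp_space_diff[OF JL rJ(1) p1] by (simp add: rieszQ_def circ_def)
  define s where "s = (\<lambda>t. b t * rieszQ p (flipJ f) t)"
  have cs: "circ s x = circ a x * (ee m x * circ (rieszQ p (flipJ f)) x)" for x
    using b[of x] by (simp add: s_def circ_def)
  have sL: "circ s \<in> LpT p"
    unfolding cs[abs_def] by (intro aL Lp_ee_mult QL p1)
  have sQ: "AE x in cm. circ s x = circ a x * (ee (m - 1) x * circ f (crev x))"
    using Q
  proof eventually_elim
    case (elim x)
    have "ee m x * (ee (-1) x * circ f (crev x)) = ee (m - 1) x * circ f (crev x)"
      by (simp add: ee_mult flip: mult.assoc)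
    then show ?case unfolding cs elim by simp
  qed
  define t where "t = (\<lambda>z. a z * f z)"
  have ct: "circ t x = circ a x * circ f x" for x by (simp add: t_def circ_def)
  have tL: "circ t \<in> LpT p" unfolding ct[abs_def] by (rule aL[OF fL])
  note rs = riesz_spec[OF p sL] and rt = riesz_spec[OF p tL]
  have cA: "circ (A f) x = circ (riesz p t) x + \<sigma> * circ (riesz p s) x" for x
    by (simp add: A circ_def toeplitz_def hankel_def s_def t_def)
  show AL: "circ (A f) \<in> LpT p"
    unfolding cA[abs_def] by (intro Lp_space_add Lp_space_cmult rs rt p1)
  have i: "integrable cm h" if "h \<in> LpT p" for h
    by (rule Lp_integrable_circle[OF that p1])
  have "fc (circ (A f)) n = fc (circ (riesz p t)) n + \<sigma> * fc (circ (riesz p s)) n" for n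
    unfolding cA[abs_def] using fc_add[OF i[OF rt(1)] i[OF Lp_space_cmult[OF rs(1)]]] by (simp add: fc_cmult)
  moreover have "fc (\<lambda>x. circ a x * symm m \<sigma> (circ f) x) n = fc (circ t) n + \<sigma> * fc (circ s) n" for n
  proof -
    have "fc (\<lambda>x. circ a x * symm m \<sigma> (circ f) x) n = fc (\<lambda>x. circ t x + \<sigma> * circ s x) n"
    proof (rule fc_cong_AE)
      show "(\<lambda>x. circ a x * symm m \<sigma> (circ f) x) \<in> borel_measurable cm"
        by (rule Lp_spaceD(1)[OF aL[OF symm_Lp_space[OF fL p1]]])
      show "(\<lambda>x. circ t x + \<sigma> * circ s x) \<in> borel_measurable cm"
        by (rule Lp_spaceD(1)[OF Lp_space_add[OF tL Lp_space_cmult[OF sL] p1]])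
      show "AE x in cm. circ a x * symm m \<sigma> (circ f) x = circ t x + \<sigma> * circ s x"
        using sQ by eventually_elim (simp add: ct symm_def algebra_simps)
    qed
    then show ?thesis using fc_add[OF i[OF tL] i[OF Lp_space_cmult[OF sL]]] by (simp add: fc_cmult)
  qed
  ultimately show "is_riesz (\<lambda>x. circ a x * symm m \<sigma> (circ f) x) (circ (A f))"
    using rs(2) rt(2) by (simp add: is_riesz_def)
qed

lemma Lp_norm_eq: "p > 0 \<Longrightarrow> Lp_norm p f = nrmT p (circ f) / (2*pi) powr (1/p)"
  by (simp add: Lp_norm_def Lp_nrm_def Lp_mass_def circ_def powr_divide)

text \<open>If the range is not dense, the functional of the approximation error annihilates the
  range and, by \<open>annihilator_of_range\<close>, also \<open>g\<close>. Hence it annihilates the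
  error, a limit of g - v n; but its value there is the positive mass of the error.\<close>

theorem coburn_simonenko:
  assumes p: "1 < p" and a: "GLinf a" and adm: "admissible m \<sigma>"
    and b: "\<And>x. circ b x = ee m x * circ a x"
    and A: "\<And>f t. A f t = toeplitz p a f t + \<sigma> * hankel p b f t"
  shows "ker_trivial p A \<or> coker_trivial p A"
proof (rule disjCI)
  assume nt: "\<not> coker_trivial p A"
  let ?N = "nrmT p"
  define q where "q = p / (p - 1)"
  have q: "q > 1" "1/p + 1/q = 1" "1/q + 1/p = 1" using p by (auto simp: q_def field_simps)
  have p1: "p \<ge> 1" "q \<ge> 1" using p q by auto
  obtain B where aB: "circ a \<in> borel_measurable cm" "AE x in cm. norm (circ a x) \<le> B"
    using a by (auto simp: GLinf_def inLinf_def circ_def)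
  have a0: "AE x in cm. circ a x \<noteq> 0"
    using a by (auto simp: GLinf_def ae_eq_def circ_def elim: eventually_mono)
  have th: "circ (A f) \<in> LpT p"
    "is_riesz (\<lambda>x. circ a x * symm m \<sigma> (circ f) x) (circ (A f))" if "Hp p f" for f
    by (rule toeplitz_plus_hankel[where A = A and f = f and a = a and b = b, OF p that aB b A])+
  show "ker_trivial p A"
    unfolding ker_trivial_def
  proof (intro allI impI, rule ccontr)
    fix f0 assume f0: "Hp p f0 \<and> ae_eq (A f0) (\<lambda>_. 0)" and ne: "\<not> ae_eq f0 (\<lambda>_. 0)"
    have u0: "circ f0 \<in> LpT p" "\<And>n. n < 0 \<Longrightarrow> fc (circ f0) n = 0"
      "\<not> (AE x in cm. circ f0 x = 0)"
      using f0 ne by (auto simp: Hp_iff ae_eq_def circ_def)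
    have ker: "fc (\<lambda>x. circ a x * symm m \<sigma> (circ f0) x) n = 0" if "n \<ge> 0" for n
    proof -
      have "fc (circ (A f0)) n = fc (\<lambda>x. 0) n"
        using f0 th(1)[of f0] by (intro fc_cong_AE) (auto simp: ae_eq_def circ_def dest: Lp_spaceD)
      then show ?thesis using th(2)[of f0] f0 that by (simp add: is_riesz_def)
    qed
    obtain g e where g: "Hp p g" and e: "e > 0" and far: "\<And>f. Hp p f \<Longrightarrow> e \<le> Lp_norm p (\<lambda>t. A f t - g t)"
      using nt unfolding coker_trivial_def by (meson not_less)
    have gL: "circ g \<in> LpT p" "\<And>n. n < 0 \<Longrightarrow> fc (circ g) n = 0" using g by (auto simp: Hp_iff)
    define an where "an u \<longleftrightarrow> u \<in> LpT p \<and> (\<forall>n<0. fc u n = 0)" for u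
    \<comment> \<open>All functions almost everywhere equal to values of \<open>A\<close>. The
      values themselves need not form a subspace, because \<open>riesz\<close> picks its
      representatives arbitrarily.\<close>
    define V where "V = {w \<in> LpT p. \<exists>u. an u \<and> is_riesz (\<lambda>x. circ a x * symm m \<sigma> u x) w}"
    have i: "integrable cm h" if "h \<in> LpT p" for h
      by (rule Lp_integrable_circle[OF that p1(1)])
    have asL: "(\<lambda>x. circ a x * symm m \<sigma> u x) \<in> LpT p" if "an u" for u
      using that unfolding an_def by (intro Lp_space_mult_bounded[OF _ aB p1(1)] symm_Lp_space p1) auto
    have V1: "V \<subseteq> LpT p" by (auto simp: V_def)
    have V2: "(\<lambda>x. 0) \<in> V"
      by (auto simp: V_def an_def is_riesz_def symm_def intro!: exI[of _ "\<lambda>x. 0"])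
    have V3: "(\<lambda>x. v x + w x) \<in> V" if vw: "v \<in> V" "w \<in> V" for v w
    proof -
      from vw obtain s t where s: "v \<in> LpT p" "an s" "is_riesz (\<lambda>x. circ a x * symm m \<sigma> s x) v"
        and t: "w \<in> LpT p" "an t" "is_riesz (\<lambda>x. circ a x * symm m \<sigma> t x) w" by (auto simp: V_def)
      have "an (\<lambda>x. s x + t x)"
        using s(2) t(2) p1 by (auto simp: an_def fc_add i intro: Lp_space_add)
      moreover have "fc (\<lambda>x. circ a x * symm m \<sigma> (\<lambda>x. s x + t x) x) n
          = fc (\<lambda>x. circ a x * symm m \<sigma> s x) n + fc (\<lambda>x. circ a x * symm m \<sigma> t x) n" for n
        unfolding symm_add distrib_left by (intro fc_add i asL s t)
      then have "is_riesz (\<lambda>x. circ a x * symm m \<sigma> (\<lambda>x. s x + t x) x) (\<lambda>x. v x + w x)"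
        using s t fc_add[OF i[OF s(1)] i[OF t(1)]] by (simp add: is_riesz_def)
      ultimately show ?thesis unfolding V_def using Lp_space_add[OF s(1) t(1) p1(1)] by blast
    qed
    have V4: "(\<lambda>x. c * v x) \<in> V" if v: "v \<in> V" for v c
    proof -
      from v obtain s where s: "v \<in> LpT p" "an s" "is_riesz (\<lambda>x. circ a x * symm m \<sigma> s x) v"
        by (auto simp: V_def)
      have "an (\<lambda>x. c * s x)" using s(2) by (auto simp: an_def fc_cmult intro: Lp_space_cmult)
      moreover have "fc (\<lambda>x. circ a x * symm m \<sigma> (\<lambda>x. c * s x) x) n = c * fc (\<lambda>x. circ a x * symm m \<sigma> s x) n" for n
        unfolding symm_cmult by (simp add: mult.left_commute flip: fc_cmult)
      then have "is_riesz (\<lambda>x. circ a x * symm m \<sigma> (\<lambda>x. c * s x) x) (\<lambda>x. c * v x)"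
        using s by (simp add: is_riesz_def fc_cmult)
      ultimately show ?thesis unfolding V_def using Lp_space_cmult[OF s(1)] by blast
    qed
    \<comment> \<open>Converts the distance from the normalised norm of the statement.\<close>
    define e' where "e' = e * (2*pi) powr (1/p)"
    have e': "e' > 0" using e by (simp add: e'_def)
    have far': "e' \<le> ?N (\<lambda>x. circ g x - w x)" if "w \<in> V" for w
    proof -
      from that obtain u where w: "w \<in> LpT p" and u: "an u"
        and r: "is_riesz (\<lambda>x. circ a x * symm m \<sigma> u x) w" by (auto simp: V_def)
      \<comment> \<open>\<open>A\<close> acts on functions on the plane, so \<open>u\<close> is
        first lifted from the parameter interval.\<close>
      define f where "f z = u (Arg2pi z)" for z
      have uL: "u \<in> LpT p" using u by (simp add: an_def)
      have fL: "circ f \<in> LpT p" unfolding f_def by (rule circ_Arg2pi_Lp_space[OF uL])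
      have uf: "AE x in cm. u x = circ f x" unfolding f_def by (rule circ_Arg2pi_AE)
      have "fc u n = fc (circ f) n" for n
        by (rule fc_cong_AE[OF Lp_spaceD(1)[OF uL] Lp_spaceD(1)[OF fL] uf])
      then have f: "Hp p f" using u fL by (simp add: Hp_iff an_def)
      then have anf: "an (circ f)" by (simp add: Hp_iff an_def)
      have "fc (\<lambda>x. circ a x * symm m \<sigma> u x) n = fc (\<lambda>x. circ a x * symm m \<sigma> (circ f) x) n" for n
      proof (rule fc_cong_AE)
        show "AE x in cm. circ a x * symm m \<sigma> u x = circ a x * symm m \<sigma> (circ f) x"
          using uf AE_crev[OF uf] by eventually_elim (simp add: symm_def)
      qed (use Lp_spaceD(1)[OF asL[OF u]] Lp_spaceD(1)[OF asL[OF anf]] in auto)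
      then have "fc w n = fc (circ (A f)) n" for n using r th(2)[OF f] by (simp add: is_riesz_def)
      then have wA: "AE x in cm. w x = circ (A f) x"
        by (intro fourier_uniqueness_eq i w th(1)[OF f])
      have "e \<le> ?N (circ (\<lambda>t. A f t - g t)) / (2*pi) powr (1/p)"
        using far[OF f] p by (simp add: Lp_norm_eq)
      then have "e' \<le> ?N (circ (\<lambda>t. A f t - g t))"
        unfolding e'_def by (subst (asm) pos_le_divide_eq) auto
      also have "circ (\<lambda>t. A f t - g t) = (\<lambda>x. circ (A f) x - circ g x)" by (simp add: circ_def)
      also have "?N (\<lambda>x. circ (A f) x - circ g x) = ?N (\<lambda>x. circ g x - circ (A f) x)"
        by (rule Lp_nrm_minus_commute)
      also have "\<dots> = ?N (\<lambda>x. circ g x - w x)"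
      proof -
        have "Lp_mass cm p (\<lambda>x. circ g x - circ (A f) x) = Lp_mass cm p (\<lambda>x. circ g x - w x)"
          by (rule Lp_mass_cong_AE) (use wA gL(1) w th(1)[OF f] in \<open>auto dest!: Lp_spaceD(1)\<close>)
        then show ?thesis by (simp add: Lp_nrm_def)
      qed
      finally show ?thesis .
    qed
    obtain u v where u: "u \<in> LpT p" and v: "\<forall>n. v n \<in> V"
      and lim: "(\<lambda>n. ?N (\<lambda>x. circ g x - v n x - u x)) \<longlonglongrightarrow> 0" and upos: "?N u > 0"
      and orth: "\<forall>w\<in>V. (\<integral>x. pdual p (u x) * w x \<partial>cm) = 0"
      by (rule Lp_best_approximation[OF p V1 V2 V3 V4 gL(1) e' far'])
    define k where "k x = pdual p (u x)" for x
    have k: "k \<in> LpT q" unfolding k_def by (rule pdual_Lp_space[OF u p q(2)])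
    have orth': "(\<integral>x. w x * k x \<partial>cm) = 0" if "w \<in> V" for w
      using orth that by (simp add: k_def mult.commute)
    have gk: "(\<integral>x. circ g x * k x \<partial>cm) = 0"
    proof (rule annihilator_of_range[OF p q(1,2) adm aB a0 u0 ker k _ gL])
      fix s w assume "s \<in> LpT p" "\<And>n. n < 0 \<Longrightarrow> fc s n = 0"
        "w \<in> LpT p" "is_riesz (\<lambda>x. circ a x * symm m \<sigma> s x) w"
      then show "(\<integral>x. w x * k x \<partial>cm) = 0" by (intro orth') (auto simp: V_def an_def)
    qed
    have vL: "v n \<in> LpT p" for n using v V1 by blast
    have "(\<lambda>n. \<integral>x. (circ g x - v n x) * k x \<partial>cm) \<longlonglongrightarrow> (\<integral>x. u x * k x \<partial>cm)"
      by (rule Lp_pairing_tendsto[OF Lp_space_diff[OF gL(1) vL p1(1)] u k p q(1,2) lim])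
    moreover have "(\<integral>x. (circ g x - v n x) * k x \<partial>cm) = 0" for n
      using Lp_mult_integrable[OF gL(1) k p q(1,2)] Lp_mult_integrable[OF vL k p q(1,2), of n] gk orth' v
      by (simp add: left_diff_distrib)
    ultimately have "(\<integral>x. u x * k x \<partial>cm) = 0" by (simp add: LIMSEQ_const_iff)
    then have "Lp_mass cm p u = 0"
      using integral_pdual_mult_self[OF p, of cm u] by (simp add: k_def mult.commute)
    with upos show False by (simp add: Lp_nrm_def)
  qed
qed

theorem theorem2p9:
  fixes p :: real and a :: "complex \<Rightarrow> complex"
    and A :: "(complex \<Rightarrow> complex) \<Rightarrow> (complex \<Rightarrow> complex)"
  assumes "1 < p"
    and "GLinf a"
    and "A = (\<lambda>f t. toeplitz p a f t + hankel p (\<lambda>s. a s * s) f t)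
       \<or> A = (\<lambda>f t. toeplitz p a f t - hankel p (\<lambda>s. a s * inverse s) f t)
       \<or> A = (\<lambda>f t. toeplitz p a f t + hankel p a f t)
       \<or> A = (\<lambda>f t. toeplitz p a f t - hankel p a f t)"
  shows "ker_trivial p A \<or> coker_trivial p A"
  using assms(3)
proof (elim disjE)
  assume A: "A = (\<lambda>f t. toeplitz p a f t + hankel p (\<lambda>s. a s * s) f t)"
  show ?thesis
    by (rule coburn_simonenko[OF assms(1,2), where m = 1 and \<sigma> = 1 and b = "\<lambda>s. a s * s"])
      (simp_all add: admissible_def A circ_def ee_def)
next
  assume A: "A = (\<lambda>f t. toeplitz p a f t - hankel p (\<lambda>s. a s * inverse s) f t)"
  show ?thesis
    by (rule coburn_simonenko[OF assms(1,2), where m = "-1" and \<sigma> = "-1" and b = "\<lambda>s. a s * inverse s"])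
      (simp_all add: admissible_def A circ_def ee_def)
next
  assume A: "A = (\<lambda>f t. toeplitz p a f t + hankel p a f t)"
  show ?thesis
    by (rule coburn_simonenko[OF assms(1,2), where m = 0 and \<sigma> = 1 and b = a])
      (simp_all add: admissible_def A)
next
  assume A: "A = (\<lambda>f t. toeplitz p a f t - hankel p a f t)"
  show ?thesis
    by (rule coburn_simonenko[OF assms(1,2), where m = 0 and \<sigma> = "-1" and b = a])
      (simp_all add: admissible_def A)
qed

end
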